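(* Let $n,r\ge 1$. For a cycloribbon $[I,\mathbf c]$ of size $n$, set $$S_{[I,\mathbf c]} := \mathcal H_{n,r}(0)\,\eta_{[I,\mathbf c]},\qquad \eta_{[I,\mathbf c]}:=L_{\mathbf c}\,\eta_I .$$ Then $S_{[I,\mathbf c]}$ is a simple $\mathcal H_{n,r}(0)$-module, realized as a minimal left ideal in the left regular representation of $\mathcal H_{n,r}(0)$. The eigenvalue of $\xi_i$ on it is $u_{c_i}$ ($1\le i\le n$), and the eigenvalue of $T_i$ ($1\le i\le n-1$) on it is $-1$ if $i$ is a descent of the shape of the anticycloribbon $\phi([I,\mathbf c])$, and $0$ otherwise. The modules $S_{[I,\mathbf c]}$, for $[I,\mathbf c]$ running over all cycloribbons of size $n$, are pairwise non-isomorphic and of dimension $1$. Moreover, every simple $\mathcal H_{n,r}(0)$-module is one-dimensional and isomorphic to some $S_{[I,\mathbf c]}$.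
   Context: **The algebra.** Fix $n,r\ge1$, the color set $C=\{1,\dots,r\}$, and $r$ distinct complex numbers $u_1,\dots,u_r$. Put $P_k(X)=\prod_{1\le l\le r,\,l\ne k}\frac{X-u_l}{u_k-u_l}$. The $0$-Ariki-Koike-Shoji algebra $\mathcal H_{n,r}(0)$ is the associative unital $\mathbb C$-algebra generated by $T_1,\dots,T_{n-1},\xi_1,\dots,\xi_n$ with relations: $T_i(T_i+1)=0$; $T_iT_{i+1}T_i=T_{i+1}T_iT_{i+1}$; $T_iT_j=T_jT_i$ for $|i-j|\ge2$; $(\xi_j-u_1)\cdots(\xi_j-u_r)=0$; $\xi_i\xi_j=\xi_j\xi_i$; $T_i\xi_i=\xi_{i+1}T_i+\sum_{1\le a<b\le r}(u_b-u_a)P_a(\xi_i)P_b(\xi_{i+1})$; $T_i(\xi_{i+1}+\xi_i)=(\xi_{i+1}+\xi_i)T_i$; $T_i\xi_j=\xi_jT_i$ for $j\ne i,i+1$. For a color word $\mathbf c=(c_1,\dots,c_n)\in C^n$ put $L_{\mathbf c}=P_{c_1}(\xi_1)\cdots P_{c_n}(\xi_n)$. For $\sigma\in\mathfrak S_n$, $T_\sigma=T_{i_1}\cdots T_{i_k}$ for any reduced word $s_{i_1}\cdots s_{i_k}$ of $\sigma$. The subalgebra generated by the $T_i$ is the $0$-Hecke algebra $H_n(0)$, with basis $(T_\sigma)_{\sigma\in\mathfrak S_n}$. **The elements $\eta_I$.** For a composition $I=(i_1,\dots,i_k)$ of $n$, its descents are the elements of $\mathrm{Des}(I)=\{i_1,i_1+i_2,\dots,i_1+\cdots+i_{k-1}\}$.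 $\eta_I$ is the generator of the minimal left ideal $H_n(0)\eta_I$ of $H_n(0)$ affording the one-dimensional simple module labelled by $I$: it is the unique element of $H_n(0)$ with $T_i\eta_I=-\eta_I$ for $i\in\mathrm{Des}(I)$, $T_i\eta_I=0$ for $i\notin\mathrm{Des}(I)$, normalized so that the coefficient of $T_{w_0}$ is $1$, where $w_0$ is the longest element of $\mathfrak S_n$. **Ribbons.** A colored ribbon of size $n$ is a pair $[I,\mathbf c]$ with $I$ a composition of $n$ (its shape) and $\mathbf c\in C^n$. The ribbon diagram of $I$ has $n$ cells; the $(j+1)$-th cell is just below the $j$-th if $j\in\mathrm{Des}(I)$ and just to its right otherwise, and the $j$-th cell is filled with $c_j$. $[I,\mathbf c]$ is a cycloribbon if it is weakly increasing along rows and weakly decreasing down columns: $c_j\le c_{j+1}$ if $j\notin\mathrm{Des}(I)$ and $c_j\ge c_{j+1}$ if $j\in\mathrm{Des}(I)$. It is an anticycloribbon if $c_j\ge c_{j+1}$ for $j\notin\mathrm{Des}(I)$ and $c_j\le c_{j+1}$ for $j\in\mathrm{Des}(I)$. The involution $\phi$ on colored ribbons sends $[I,\mathbf c]$ to $[I',\mathbf c]$ where $\mathrm{Des}(I')=\{j\in\mathrm{Des}(I): c_j=c_{j+1}\}\cup\{j\in\{1,\dots,n-1\}\setminus\mathrm{Des}(I): c_j\ne c_{j+1}\}$; it exchanges cycloribbons and anticycloribbons. *)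

theory Defs
  imports
    "HOL-Library.Poly_Mapping"
    "HOL-Combinatorics.Permutations"
    "HOL-Algebra.Ideal"
    "HOL-Algebra.QuotRing"
    "Jordan_Normal_Form.VS_Connect"
begin

section \<open>Left modules over a noncommutative ring\<close>

text \<open>The locale \<open>module\<close> of HOL-Algebra assumes a commutative base ring; the following is the same
  list of axioms without commutativity. Rings and modules use the same records as HOL-Algebra.\<close>

locale left_module = R?: ring R + M?: abelian_group M
  for R :: "('a, 'r) ring_scheme" (structure) and M :: "('a, 'm, 'k) module_scheme" (structure) +
  assumes lsmult_closed:
      "\<lbrakk>a \<in> carrier R; x \<in> carrier M\<rbrakk> \<Longrightarrow> a \<odot>\<^bsub>M\<^esub> x \<in> carrier M"
    and lsmult_l_distr:
      "\<lbrakk>a \<in> carrier R; b \<in> carrier R; x \<in> carrier M\<rbrakk> \<Longrightarrow>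
        (a \<oplus>\<^bsub>R\<^esub> b) \<odot>\<^bsub>M\<^esub> x = a \<odot>\<^bsub>M\<^esub> x \<oplus>\<^bsub>M\<^esub> b \<odot>\<^bsub>M\<^esub> x"
    and lsmult_r_distr:
      "\<lbrakk>a \<in> carrier R; x \<in> carrier M; y \<in> carrier M\<rbrakk> \<Longrightarrow>
        a \<odot>\<^bsub>M\<^esub> (x \<oplus>\<^bsub>M\<^esub> y) = a \<odot>\<^bsub>M\<^esub> x \<oplus>\<^bsub>M\<^esub> a \<odot>\<^bsub>M\<^esub> y"
    and lsmult_assoc:
      "\<lbrakk>a \<in> carrier R; b \<in> carrier R; x \<in> carrier M\<rbrakk> \<Longrightarrow>
        (a \<otimes>\<^bsub>R\<^esub> b) \<odot>\<^bsub>M\<^esub> x = a \<odot>\<^bsub>M\<^esub> (b \<odot>\<^bsub>M\<^esub> x)"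
    and lsmult_one:
      "x \<in> carrier M \<Longrightarrow> \<one>\<^bsub>R\<^esub> \<odot>\<^bsub>M\<^esub> x = x"

text \<open>The locale \<open>Module.submodule\<close> makes no commutativity assumption on the ring.\<close>

definition simple_left_module :: "('a, 'b) ring_scheme \<Rightarrow> ('a, 'm, 'k) module_scheme \<Rightarrow> bool" where
  "simple_left_module R M \<longleftrightarrow>
     left_module R M \<and> carrier M \<noteq> {\<zero>\<^bsub>M\<^esub>} \<and>
     (\<forall>N. Module.submodule N R M \<longrightarrow> N = {\<zero>\<^bsub>M\<^esub>} \<or> N = carrier M)"

definition left_module_iso ::
  "('a, 'b) ring_scheme \<Rightarrow> ('a, 'm, 'k) module_scheme \<Rightarrow> ('a, 'l, 'j) module_scheme \<Rightarrow> bool" where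
  "left_module_iso R M N \<longleftrightarrow>
     (\<exists>f. bij_betw f (carrier M) (carrier N) \<and>
          (\<forall>x\<in>carrier M. \<forall>y\<in>carrier M. f (x \<oplus>\<^bsub>M\<^esub> y) = f x \<oplus>\<^bsub>N\<^esub> f y) \<and>
          (\<forall>a\<in>carrier R. \<forall>x\<in>carrier M. f (a \<odot>\<^bsub>M\<^esub> x) = a \<odot>\<^bsub>N\<^esub> f x))"

definition left_regular :: "('a, 'b) ring_scheme \<Rightarrow> ('a, 'a) module" where
  "left_regular R =
     \<lparr>carrier = carrier R, mult = mult R, one = one R, zero = zero R, add = add R, smult = mult R\<rparr>"

definition left_ideal :: "'a set \<Rightarrow> ('a, 'b) ring_scheme \<Rightarrow> bool" where
  "left_ideal J R \<longleftrightarrow> Module.submodule J R (left_regular R)"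

definition minimal_left_ideal :: "'a set \<Rightarrow> ('a, 'b) ring_scheme \<Rightarrow> bool" where
  "minimal_left_ideal J R \<longleftrightarrow>
     left_ideal J R \<and> J \<noteq> {\<zero>\<^bsub>R\<^esub>} \<and>
     (\<forall>K. left_ideal K R \<and> K \<subseteq> J \<longrightarrow> K = {\<zero>\<^bsub>R\<^esub>} \<or> K = J)"

definition principal_left_ideal :: "('a, 'b) ring_scheme \<Rightarrow> 'a \<Rightarrow> 'a set" where
  "principal_left_ideal R x = (\<lambda>h. h \<otimes>\<^bsub>R\<^esub> x) ` carrier R"


section \<open>Free associative algebras\<close>

text \<open>The free monoid is written additively, so that the type \<open>'g word \<Rightarrow>\<^sub>0 complex\<close> of finitely
  supported functions, with its library convolution product, is the free associative unital complex
  algebra on the type \<open>'g\<close>.\<close>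

datatype 'g word = Word (letters: "'g list")

instantiation word :: (type) monoid_add
begin

definition zero_word :: "'a word" where "0 = Word []"

definition plus_word :: "'a word \<Rightarrow> 'a word \<Rightarrow> 'a word" where
  "v + w = Word (letters v @ letters w)"

instance by standard (simp_all add: zero_word_def plus_word_def)

end

type_synonym 'g free_alg = "'g word \<Rightarrow>\<^sub>0 complex"

definition fconst :: "complex \<Rightarrow> 'g free_alg" where
  "fconst z = Poly_Mapping.single 0 z"

definition fgen :: "'g \<Rightarrow> 'g free_alg" where
  "fgen g = Poly_Mapping.single (Word [g]) 1"

definition free_alg_on :: "'g set \<Rightarrow> 'g free_alg ring" where
  "free_alg_on G =
     \<lparr>carrier = {p. \<forall>w\<in>Poly_Mapping.keys p. set (letters w) \<subseteq> G},
      mult = (*), one = 1, zero = 0, add = (+)\<rparr>"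


section \<open>The 0-Ariki-Koike-Shoji algebra\<close>

datatype aks_gen = GenT nat | GenXi nat

type_synonym aks_free = "aks_gen free_alg"

definition aks_gens :: "nat \<Rightarrow> aks_gen set" where
  "aks_gens n = GenT ` {1..<n} \<union> GenXi ` {1..n}"

abbreviation fT :: "nat \<Rightarrow> aks_free" where "fT i \<equiv> fgen (GenT i)"
abbreviation fXi :: "nat \<Rightarrow> aks_free" where "fXi i \<equiv> fgen (GenXi i)"

text \<open>\<open>lagr r u k x\<close> is \<open>P\<^sub>k(x)\<close>. Its factors commute with each other, so the order of the list is
  irrelevant.\<close>

definition lagr :: "nat \<Rightarrow> (nat \<Rightarrow> complex) \<Rightarrow> nat \<Rightarrow> 'g free_alg \<Rightarrow> 'g free_alg" where
  "lagr r u k x =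
     (\<Prod>l\<leftarrow>filter (\<lambda>l. l \<noteq> k) [1..<Suc r]. fconst (1 / (u k - u l)) * (x - fconst (u l)))"

text \<open>A pair \<open>(p, q)\<close> stands for the defining relation \<open>p = q\<close>.\<close>

inductive_set aks_relations :: "nat \<Rightarrow> nat \<Rightarrow> (nat \<Rightarrow> complex) \<Rightarrow> (aks_free \<times> aks_free) set"
  for n r :: nat and u :: "nat \<Rightarrow> complex" where
  quadratic: "i \<in> {1..<n} \<Longrightarrow> (fT i * (fT i + 1), 0) \<in> aks_relations n r u"
| braid: "\<lbrakk>i \<in> {1..<n}; i + 1 \<in> {1..<n}\<rbrakk> \<Longrightarrow>
    (fT i * fT (i + 1) * fT i, fT (i + 1) * fT i * fT (i + 1)) \<in> aks_relations n r u"
| T_comm: "\<lbrakk>i \<in> {1..<n}; j \<in> {1..<n}; i + 2 \<le> j \<or> j + 2 \<le> i\<rbrakk> \<Longrightarrow>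
    (fT i * fT j, fT j * fT i) \<in> aks_relations n r u"
| Xi_poly: "j \<in> {1..n} \<Longrightarrow>
    (\<Prod>l\<leftarrow>[1..<Suc r]. fXi j - fconst (u l), 0) \<in> aks_relations n r u"
| Xi_comm: "\<lbrakk>i \<in> {1..n}; j \<in> {1..n}\<rbrakk> \<Longrightarrow>
    (fXi i * fXi j, fXi j * fXi i) \<in> aks_relations n r u"
| T_Xi: "i \<in> {1..<n} \<Longrightarrow>
    (fT i * fXi i,
     fXi (i + 1) * fT i +
       (\<Sum>(a, b)\<in>{(a, b). 1 \<le> a \<and> a < b \<and> b \<le> r}.
          fconst (u b - u a) * lagr r u a (fXi i) * lagr r u b (fXi (i + 1))))
    \<in> aks_relations n r u"
| T_Xi_sum: "i \<in> {1..<n} \<Longrightarrow>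
    (fT i * (fXi (i + 1) + fXi i), (fXi (i + 1) + fXi i) * fT i) \<in> aks_relations n r u"
| T_Xi_comm: "\<lbrakk>i \<in> {1..<n}; j \<in> {1..n}; j \<noteq> i; j \<noteq> i + 1\<rbrakk> \<Longrightarrow>
    (fT i * fXi j, fXi j * fT i) \<in> aks_relations n r u"

definition aks_ideal :: "nat \<Rightarrow> nat \<Rightarrow> (nat \<Rightarrow> complex) \<Rightarrow> aks_free set" where
  "aks_ideal n r u =
     Idl\<^bsub>free_alg_on (aks_gens n)\<^esub> {p - q | p q. (p, q) \<in> aks_relations n r u}"

definition aks :: "nat \<Rightarrow> nat \<Rightarrow> (nat \<Rightarrow> complex) \<Rightarrow> aks_free set ring" where
  "aks n r u = free_alg_on (aks_gens n) Quot aks_ideal n r u"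

definition aks_class :: "nat \<Rightarrow> nat \<Rightarrow> (nat \<Rightarrow> complex) \<Rightarrow> aks_free \<Rightarrow> aks_free set" where
  "aks_class n r u p = aks_ideal n r u +>\<^bsub>free_alg_on (aks_gens n)\<^esub> p"

definition aks_T :: "nat \<Rightarrow> nat \<Rightarrow> (nat \<Rightarrow> complex) \<Rightarrow> nat \<Rightarrow> aks_free set" where
  "aks_T n r u i = aks_class n r u (fT i)"

definition aks_Xi :: "nat \<Rightarrow> nat \<Rightarrow> (nat \<Rightarrow> complex) \<Rightarrow> nat \<Rightarrow> aks_free set" where
  "aks_Xi n r u i = aks_class n r u (fXi i)"

text \<open>The scalar \<open>z\<close> as an element \<open>z\<cdot>1\<close> of the algebra; it makes the algebra, and every left module
  over it, a complex vector space.\<close>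

definition aks_const :: "nat \<Rightarrow> nat \<Rightarrow> (nat \<Rightarrow> complex) \<Rightarrow> complex \<Rightarrow> aks_free set" where
  "aks_const n r u z = aks_class n r u (fconst z)"

definition aks_vspace ::
  "nat \<Rightarrow> nat \<Rightarrow> (nat \<Rightarrow> complex) \<Rightarrow> (aks_free set, 'm) module \<Rightarrow> (complex, 'm) module" where
  "aks_vspace n r u M =
     \<lparr>carrier = carrier M, mult = mult M, one = one M, zero = zero M, add = add M,
      smult = (\<lambda>z x. aks_const n r u z \<odot>\<^bsub>M\<^esub> x)\<rparr>"

text \<open>Finite-dimensionality is required separately, because \<open>vectorspace.dim\<close> is a \<open>LEAST\<close> over the
  cardinalities of finite generating sets.\<close>

definition aks_has_dim ::
  "nat \<Rightarrow> nat \<Rightarrow> (nat \<Rightarrow> complex) \<Rightarrow> (aks_free set, 'm) module \<Rightarrow> nat \<Rightarrow> bool" where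
  "aks_has_dim n r u M d \<longleftrightarrow>
     vectorspace class_ring (aks_vspace n r u M) \<and>
     vectorspace.fin_dim class_ring (aks_vspace n r u M) \<and>
     vectorspace.dim class_ring (aks_vspace n r u M) = d"

text \<open>A color word \<open>(c\<^sub>1, \<dots>, c\<^sub>n)\<close> is a list of length \<open>n\<close>, so \<open>c\<^sub>j\<close> is \<open>c ! (j - 1)\<close>.\<close>

definition color :: "nat list \<Rightarrow> nat \<Rightarrow> nat" where
  "color c j = c ! (j - 1)"

definition aks_L :: "nat \<Rightarrow> nat \<Rightarrow> (nat \<Rightarrow> complex) \<Rightarrow> nat list \<Rightarrow> aks_free set" where
  "aks_L n r u c = aks_class n r u (\<Prod>j\<leftarrow>[1..<Suc n]. lagr r u (color c j) (fXi j))"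


section \<open>Reduced words and the elements \<open>T\<^sub>\<sigma>\<close>\<close>

text \<open>Elements of the symmetric group are functions \<open>\<sigma>\<close> with \<open>\<sigma> permutes {1..n}\<close>.\<close>

definition perm_of_word :: "nat list \<Rightarrow> nat \<Rightarrow> nat" where
  "perm_of_word w = foldr (\<lambda>i \<sigma>. transpose i (i + 1) \<circ> \<sigma>) w id"

definition perm_length :: "nat \<Rightarrow> (nat \<Rightarrow> nat) \<Rightarrow> nat" where
  "perm_length n \<sigma> = (LEAST k. \<exists>w. set w \<subseteq> {1..<n} \<and> perm_of_word w = \<sigma> \<and> length w = k)"

definition reduced_word :: "nat \<Rightarrow> (nat \<Rightarrow> nat) \<Rightarrow> nat list \<Rightarrow> bool" where
  "reduced_word n \<sigma> w \<longleftrightarrow>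
     set w \<subseteq> {1..<n} \<and> perm_of_word w = \<sigma> \<and> length w = perm_length n \<sigma>"

definition longest_perm :: "nat \<Rightarrow> nat \<Rightarrow> nat" where
  "longest_perm n = (ARG_MAX (perm_length n) \<sigma>. \<sigma> permutes {1..n})"

text \<open>By the braid relations the choice of the reduced word does not matter.\<close>

definition aks_Tperm :: "nat \<Rightarrow> nat \<Rightarrow> (nat \<Rightarrow> complex) \<Rightarrow> (nat \<Rightarrow> nat) \<Rightarrow> aks_free set" where
  "aks_Tperm n r u \<sigma> = aks_class n r u (\<Prod>i\<leftarrow>(SOME w. reduced_word n \<sigma> w). fT i)"


section \<open>Compositions, ribbons and the elements \<open>\<eta>\<close>\<close>

definition composition :: "nat \<Rightarrow> nat list \<Rightarrow> bool" where
  "composition n I \<longleftrightarrow> sum_list I = n \<and> (\<forall>i\<in>set I. 1 \<le> i)"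

definition Des :: "nat list \<Rightarrow> nat set" where
  "Des I = {sum_list (take k I) | k. 1 \<le> k \<and> k < length I}"

text \<open>\<open>(T\<^sub>\<sigma>)\<close> is a basis of the 0-Hecke subalgebra generated by the \<open>T\<^sub>i\<close>; an element of this
  subalgebra is therefore given by its coefficient function \<open>a\<close> in this basis.\<close>

definition aks_eta :: "nat \<Rightarrow> nat \<Rightarrow> (nat \<Rightarrow> complex) \<Rightarrow> nat list \<Rightarrow> aks_free set" where
  "aks_eta n r u I = (THE x.
     (\<exists>a. x = (\<Oplus>\<^bsub>aks n r u\<^esub>\<sigma>\<in>{\<sigma>. \<sigma> permutes {1..n}}.
                  aks_const n r u (a \<sigma>) \<otimes>\<^bsub>aks n r u\<^esub> aks_Tperm n r u \<sigma>) \<and>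
          a (longest_perm n) = 1) \<and>
     (\<forall>i\<in>{1..<n}. aks_T n r u i \<otimes>\<^bsub>aks n r u\<^esub> x =
        (if i \<in> Des I then \<ominus>\<^bsub>aks n r u\<^esub> x else \<zero>\<^bsub>aks n r u\<^esub>)))"

type_synonym colored_ribbon = "nat list \<times> nat list"

fun is_colored_ribbon :: "nat \<Rightarrow> nat \<Rightarrow> colored_ribbon \<Rightarrow> bool" where
  "is_colored_ribbon n r (I, c) \<longleftrightarrow> composition n I \<and> length c = n \<and> set c \<subseteq> {1..r}"

fun is_cycloribbon :: "nat \<Rightarrow> nat \<Rightarrow> colored_ribbon \<Rightarrow> bool" where
  "is_cycloribbon n r (I, c) \<longleftrightarrow>
     is_colored_ribbon n r (I, c) \<and>
     (\<forall>j\<in>{1..<n}. (j \<notin> Des I \<longrightarrow> color c j \<le> color c (j + 1)) \<and>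
                  (j \<in> Des I \<longrightarrow> color c j \<ge> color c (j + 1)))"

fun is_anticycloribbon :: "nat \<Rightarrow> nat \<Rightarrow> colored_ribbon \<Rightarrow> bool" where
  "is_anticycloribbon n r (I, c) \<longleftrightarrow>
     is_colored_ribbon n r (I, c) \<and>
     (\<forall>j\<in>{1..<n}. (j \<notin> Des I \<longrightarrow> color c j \<ge> color c (j + 1)) \<and>
                  (j \<in> Des I \<longrightarrow> color c j \<le> color c (j + 1)))"

text \<open>A composition of \<open>n\<close> is determined by its descent set.\<close>

fun ribbon_phi :: "nat \<Rightarrow> colored_ribbon \<Rightarrow> colored_ribbon" where
  "ribbon_phi n (I, c) =
     ((THE I'. composition n I' \<and>
         Des I' = {j \<in> Des I. color c j = color c (j + 1)} \<union>
                  {j \<in> {1..<n} - Des I. color c j \<noteq> color c (j + 1)}), c)"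

fun aks_eta_ribbon :: "nat \<Rightarrow> nat \<Rightarrow> (nat \<Rightarrow> complex) \<Rightarrow> colored_ribbon \<Rightarrow> aks_free set" where
  "aks_eta_ribbon n r u (I, c) = aks_L n r u c \<otimes>\<^bsub>aks n r u\<^esub> aks_eta n r u I"

definition aks_S ::
  "nat \<Rightarrow> nat \<Rightarrow> (nat \<Rightarrow> complex) \<Rightarrow> colored_ribbon \<Rightarrow> (aks_free set, aks_free set) module" where
  "aks_S n r u Q =
     (left_regular (aks n r u))
       \<lparr>carrier := principal_left_ideal (aks n r u) (aks_eta_ribbon n r u Q)\<rparr>"

end

theory Submission
  imports Defs
begin

text \<open>The relations give \<open>T\<^sub>i L\<^sub>c = L\<^bsub>c s\<^sub>i\<^esub> T\<^sub>i + R\<close> with \<open>R = - L\<^sub>c\<close>, \<open>0\<close> or \<open>L\<^bsub>c s\<^sub>i\<^esub>\<close> according to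
  \<open>c\<^sub>i < c\<^bsub>i+1\<^esub>\<close>, \<open>c\<^sub>i = c\<^bsub>i+1\<^esub>\<close> or \<open>c\<^sub>i > c\<^bsub>i+1\<^esub>\<close>. For a cycloribbon this makes \<open>L\<^sub>c \<eta>\<^sub>I\<close> a simultaneous
  eigenvector of all generators. It is nonzero because the algebra acts on functions of a color word
  and a permutation as it would act on combinations of the \<open>L\<^sub>c T\<^sub>\<sigma>\<close>; the same action separates the
  \<open>T\<^sub>\<sigma>\<close>, which makes \<open>\<eta>\<^sub>I\<close> unique.

  Conversely, in a nonzero module \<open>M\<close> take \<open>x \<noteq> 0\<close> and a \<open>T\<^sub>\<sigma>\<close> of maximal length with \<open>y = T\<^sub>\<sigma> x \<noteq> 0\<close>. Then
  \<open>y\<close> is an eigenvector of every \<open>T\<^sub>i\<close>. Among the color words with \<open>L\<^sub>c y \<noteq> 0\<close>, one that maximizes a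
  suitable linear potential yields a simultaneous eigenvector \<open>L\<^sub>c y\<close>. If \<open>M\<close> is simple, it is the line
  spanned by this vector, and the relation between \<open>T\<^sub>i\<close> and \<open>\<xi>\<^sub>i\<close> forces the eigenvalues to be those of a
  cycloribbon. Modules \<open>M\<close> are handled through left ideals of the free algebra: the annihilator of a
  generator of \<open>M\<close>.\<close>

section \<open>Reduced words of permutations\<close>

text \<open>A presentation yields congruences easily but never shows that an element is nonzero. The
  explicit action supplies this; the other computations are congruences modulo a left ideal of the
  free algebra.

  The remainder \<open>R\<close> comes from eigenvalues. Let each \<open>\<xi>\<^sub>j\<close> act
  on \<open>z\<close> as \<open>u (c j)\<close>, and put \<open>k = 1\<close> if
  \<open>c i < c (Suc i)\<close> and \<open>k = 0\<close> otherwise. Then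
  \<open>T\<^sub>i z + k z\<close> has the colors of \<open>c\<close> exchanged at \<open>i\<close>
  and \<open>i + 1\<close>. Splitting \<open>T\<^sub>i\<close> along the decomposition of 1 into the
  \<open>L\<^sub>c\<close> gives the rule.

  If \<open>T\<^sub>i y = \<epsilon>\<^sub>i y\<close>, the obstruction to
  \<open>L\<^sub>c y\<close> being an eigenvector of \<open>T\<^sub>i\<close> is a multiple of the
  neighbour obtained by exchanging two colors. Its coefficient vanishes for one of the two orders of
  these colors, depending on \<open>\<epsilon>\<^sub>i\<close>. A linear potential with increments 1
  or -1 prescribed by \<open>\<epsilon>\<^sub>i\<close> grows along all surviving exchanges at once,
  so a maximal word has no surviving neighbour.

  Between unequal neighbouring colors the eigenvalue of \<open>T\<^sub>i\<close> is forced; between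
  equal ones both 0 and -1 remain. These are exactly the choices in a cycloribbon with given colors,
  and \<phi> translates its descents into eigenvalues.\<close>

text \<open>The notation \<open>inv\<close> is that of HOL-Algebra here.\<close>

abbreviation perm_inv :: "('a \<Rightarrow> 'a) \<Rightarrow> 'a \<Rightarrow> 'a" where "perm_inv \<equiv> inv_into UNIV"

abbreviation adj :: "nat \<Rightarrow> nat \<Rightarrow> nat" where "adj i \<equiv> transpose i (Suc i)"

lemma adj_permutes: "i \<in> {1..<n} \<Longrightarrow> adj i permutes {1..n}"
  by (rule permutes_swap_id) auto

section \<open>Inversions and adjacent exchanges of positions\<close>

definition inversions :: "nat \<Rightarrow> (nat \<Rightarrow> nat) \<Rightarrow> (nat \<times> nat) set" where
  "inversions n \<tau> = {(i, j). 1 \<le> i \<and> i < j \<and> j \<le> n \<and> \<tau> j < \<tau> i}"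

definition inv_count :: "nat \<Rightarrow> (nat \<Rightarrow> nat) \<Rightarrow> nat" where
  "inv_count n \<tau> = card (inversions n \<tau>)"

lemma finite_inversions: "finite (inversions n \<tau>)"
  by (rule finite_subset[of _ "{1..n} \<times> {1..n}"]) (auto simp: inversions_def)

lemma inv_count_id [simp]: "inv_count n id = 0"
proof -
  have "inversions n id = {}" by (auto simp: inversions_def)
  thus ?thesis by (simp add: inv_count_def)
qed

text \<open>An adjacent exchange preserves the order of every pair of positions except
  \<open>(i, Suc i)\<close>, which is therefore the one new inversion.\<close>

lemma inversions_adj:
  assumes "i \<in> {1..<n}" "\<tau> i < \<tau> (Suc i)"
  shows "inversions n (\<tau> \<circ> adj i) = insert (i, Suc i) (map_prod (adj i) (adj i) ` inversions n \<tau>)"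
proof (intro equalityI subsetI)
  fix p assume "p \<in> inversions n (\<tau> \<circ> adj i)"
  then obtain a b where p: "p = (a, b)" "1 \<le> a" "a < b" "b \<le> n" "\<tau> (adj i b) < \<tau> (adj i a)"
    by (auto simp: inversions_def)
  show "p \<in> insert (i, Suc i) (map_prod (adj i) (adj i) ` inversions n \<tau>)"
  proof (cases "p = (i, Suc i)")
    case False
    have "adj i a < adj i b" "1 \<le> adj i a" "adj i b \<le> n"
      using p False assms(1) by (auto simp: transpose_def split: if_splits)
    hence "(adj i a, adj i b) \<in> inversions n \<tau>"
      using p by (auto simp: inversions_def)
    moreover have "p = map_prod (adj i) (adj i) (adj i a, adj i b)"
      using p by simp
    ultimately show ?thesis by blast
  qed simp
next
  fix p assume "p \<in> insert (i, Suc i) (map_prod (adj i) (adj i) ` inversions n \<tau>)"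
  then consider "p = (i, Suc i)"
    | a b where "p = (adj i a, adj i b)" "1 \<le> a" "a < b" "b \<le> n" "\<tau> b < \<tau> a"
    by (auto simp: inversions_def)
  then show "p \<in> inversions n (\<tau> \<circ> adj i)"
  proof cases
    case 1
    then show ?thesis using assms by (auto simp: inversions_def)
  next
    case 2
    have "(a, b) \<noteq> (i, Suc i)" using 2 assms by auto
    hence "adj i a < adj i b" "1 \<le> adj i a" "adj i b \<le> n"
      using 2 assms(1) by (auto simp: transpose_def split: if_splits)
    then show ?thesis using 2 by (auto simp: inversions_def)
  qed
qed

lemma inv_count_adj_ascent:
  assumes "i \<in> {1..<n}" "\<tau> i < \<tau> (Suc i)"
  shows "inv_count n (\<tau> \<circ> adj i) = Suc (inv_count n \<tau>)"
proof -
  have "inj (map_prod (adj i) (adj i))"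
    by (intro prod.inj_map inj_on_transpose)
  hence "card (map_prod (adj i) (adj i) ` inversions n \<tau>) = inv_count n \<tau>"
    unfolding inv_count_def by (rule card_image[OF inj_on_subset]) simp
  moreover have "(i, Suc i) \<notin> map_prod (adj i) (adj i) ` inversions n \<tau>"
  proof
    assume "(i, Suc i) \<in> map_prod (adj i) (adj i) ` inversions n \<tau>"
    then obtain p where p: "p \<in> inversions n \<tau>" "map_prod (adj i) (adj i) p = (i, Suc i)"
      by (metis imageE)
    obtain a b where "p = (a, b)" by (cases p)
    with p have ab: "adj i a = i" "adj i b = Suc i" "a < b"
      by (simp_all add: inversions_def)
    hence "a = adj i i" "b = adj i (Suc i)"
      by (metis transpose_involutory)+
    thus False using ab(3) by simp
  qed
  ultimately show ?thesis
    unfolding inv_count_def inversions_adj[OF assms] by (simp add: finite_inversions)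
qed

lemma adj_adj [simp]: "\<tau> \<circ> adj i \<circ> adj i = \<tau>"
  by (simp add: comp_assoc)

lemma inv_count_adj_descent:
  assumes "i \<in> {1..<n}" "\<tau> (Suc i) < \<tau> i"
  shows "Suc (inv_count n (\<tau> \<circ> adj i)) = inv_count n \<tau>"
proof -
  have "inv_count n ((\<tau> \<circ> adj i) \<circ> adj i) = Suc (inv_count n (\<tau> \<circ> adj i))"
    by (rule inv_count_adj_ascent) (use assms in simp_all)
  thus ?thesis unfolding adj_adj by simp
qed

lemma permutes_neq_Suc: "\<tau> permutes A \<Longrightarrow> \<tau> i \<noteq> \<tau> (Suc i)"
  using injD[OF permutes_inj[of \<tau> A], of i "Suc i"] by linarith

lemma inv_count_adj_le:
  assumes "i \<in> {1..<n}" "\<tau> permutes {1..n}"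
  shows "inv_count n (\<tau> \<circ> adj i) \<le> Suc (inv_count n \<tau>)"
  using inv_count_adj_ascent[of i n \<tau>] inv_count_adj_descent[of i n \<tau>] assms
    permutes_neq_Suc[OF assms(2), of i] by linarith

text \<open>Strict growth forces \<open>i \<le> f i\<close> when counted from the left end and
  \<open>f i \<le> i\<close> when counted from the right end.\<close>

lemma increasing_self_map_id:
  fixes f :: "nat \<Rightarrow> nat"
  assumes "\<And>i. i \<in> {1..n} \<Longrightarrow> f i \<in> {1..n}" "\<And>i. i \<in> {1..<n} \<Longrightarrow> f i < f (Suc i)" "i \<in> {1..n}"
  shows "f i = i"
proof (rule antisym)
  have "1 \<le> i" using assms by simp
  thus "i \<le> f i" using assms(3)
  proof (induction i rule: dec_induct)
    case base
    then show ?case using assms(1)[of 1] by simp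
  next
    case (step m)
    then show ?case using assms(2)[of m] by simp
  qed
  have "i \<le> n" using assms by simp
  thus "f i \<le> i" using assms(3)
  proof (induction i rule: inc_induct)
    case base
    then show ?case using assms(1)[of n] by simp
  next
    case (step m)
    then show ?case using assms(2)[of m] by simp
  qed
qed

lemma permutes_no_descent_id:
  assumes "\<tau> permutes {1..n}" "\<And>i. i \<in> {1..<n} \<Longrightarrow> \<tau> i \<le> \<tau> (Suc i)"
  shows "\<tau> = id"
proof
  fix x
  show "\<tau> x = id x"
  proof (cases "x \<in> {1..n}")
    case True
    have "\<tau> i \<in> {1..n}" if "i \<in> {1..n}" for i
      using permutes_in_image[OF assms(1)] that by blast
    moreover have "\<tau> i < \<tau> (Suc i)" if "i \<in> {1..<n}" for i
      using assms(2)[OF that] permutes_neq_Suc[OF assms(1), of i] by simp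
    ultimately show ?thesis using increasing_self_map_id[of n \<tau> x] True by simp
  next
    case False
    then show ?thesis using permutes_not_in[OF assms(1)] by simp
  qed
qed

lemma permutes_no_ascent:
  assumes "\<tau> permutes {1..n}" "\<And>i. i \<in> {1..<n} \<Longrightarrow> \<tau> (Suc i) \<le> \<tau> i" "i \<in> {1..n}"
  shows "\<tau> i = Suc n - i"
proof -
  have m: "\<tau> i \<in> {1..n}" if "i \<in> {1..n}" for i
    using permutes_in_image[OF assms(1)] that by blast
  have "Suc n - \<tau> i = i"
  proof (rule increasing_self_map_id[of n "\<lambda>i. Suc n - \<tau> i", OF _ _ assms(3)])
    show "Suc n - \<tau> j \<in> {1..n}" if "j \<in> {1..n}" for j
      using m[OF that] by auto
    show "Suc n - \<tau> j < Suc n - \<tau> (Suc j)" if "j \<in> {1..<n}" for j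
      using assms(2)[OF that] permutes_neq_Suc[OF assms(1), of j] m[of j] that by auto
  qed
  thus ?thesis using m[OF assms(3)] by auto
qed

lemma permutes_no_ascent_unique:
  assumes "\<tau> permutes {1..n}" "\<And>i. i \<in> {1..<n} \<Longrightarrow> \<tau> (Suc i) \<le> \<tau> i"
    and "\<tau>' permutes {1..n}" "\<And>i. i \<in> {1..<n} \<Longrightarrow> \<tau>' (Suc i) \<le> \<tau>' i"
  shows "\<tau> = \<tau>'"
proof
  fix i show "\<tau> i = \<tau>' i"
  proof (cases "i \<in> {1..n}")
    case True
    have "\<tau> i = Suc n - i" by (rule permutes_no_ascent[OF assms(1)]) (use assms(2) True in auto)
    moreover have "\<tau>' i = Suc n - i" by (rule permutes_no_ascent[OF assms(3)]) (use assms(4) True in auto)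
    ultimately show ?thesis by simp
  next
    case False
    then show ?thesis using permutes_not_in[OF assms(1)] permutes_not_in[OF assms(3)] by simp
  qed
qed

text \<open>Left multiplication of \<open>\<sigma>\<close> by a simple transposition becomes
  an exchange of two adjacent positions in the one-line notation of \<open>\<sigma>\<^sup>-\<^sup>1\<close>.\<close>

definition pos_of_word :: "nat list \<Rightarrow> nat \<Rightarrow> nat" where
  "pos_of_word w = perm_inv (perm_of_word w)"

lemma perm_of_word_Nil [simp]: "perm_of_word [] = id"
  and perm_of_word_Cons [simp]: "perm_of_word (i # w) = adj i \<circ> perm_of_word w"
  by (simp_all add: perm_of_word_def)

lemma bij_perm_of_word: "bij (perm_of_word w)"
proof (induction w)
  case Nil
  show ?case unfolding perm_of_word_Nil by (rule bij_id)
next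
  case (Cons i w)
  show ?case unfolding perm_of_word_Cons by (rule bij_comp[OF Cons bij_transpose])
qed

lemma pos_of_word_Nil [simp]: "pos_of_word [] = id"
  by (simp add: pos_of_word_def)

lemma pos_of_word_Cons [simp]: "pos_of_word (i # w) = pos_of_word w \<circ> adj i"
  using o_inv_distrib[of "adj i" "perm_of_word w"] bij_perm_of_word[of w]
  by (simp add: pos_of_word_def)

lemma pos_of_word_permutes: "set w \<subseteq> {1..<n} \<Longrightarrow> pos_of_word w permutes {1..n}"
proof (induction w)
  case (Cons i w)
  then show ?case
    unfolding pos_of_word_Cons by (intro permutes_compose adj_permutes) auto
qed (simp add: permutes_id)

lemma perm_of_word_permutes: "set w \<subseteq> {1..<n} \<Longrightarrow> perm_of_word w permutes {1..n}"
  using permutes_inv[OF pos_of_word_permutes[of w n]] inv_inv_eq[OF bij_perm_of_word[of w]]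
  unfolding pos_of_word_def by metis

lemma inv_count_pos_of_word_le:
  "set w \<subseteq> {1..<n} \<Longrightarrow> inv_count n (pos_of_word w) \<le> length w"
proof (induction w)
  case (Cons i w)
  hence "inv_count n (pos_of_word w \<circ> adj i) \<le> Suc (inv_count n (pos_of_word w))"
    by (intro inv_count_adj_le pos_of_word_permutes) auto
  also have "\<dots> \<le> length (i # w)" using Cons by simp
  finally show ?case unfolding pos_of_word_Cons .
qed simp

text \<open>Bubble sort: removing a descent lowers the inversion number by one, and only the
  identity has no descent.\<close>

lemma word_of_permutation:
  assumes "\<tau> permutes {1..n}"
  shows "\<exists>w. set w \<subseteq> {1..<n} \<and> pos_of_word w = \<tau> \<and> length w = inv_count n \<tau>"
  using assms
proof (induction "inv_count n \<tau>" arbitrary: \<tau> rule: less_induct)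
  case less
  show ?case
  proof (cases "\<exists>i\<in>{1..<n}. \<tau> (Suc i) < \<tau> i")
    case True
    then obtain i where i: "i \<in> {1..<n}" "\<tau> (Suc i) < \<tau> i" by blast
    have "\<tau> \<circ> adj i permutes {1..n}"
      using permutes_compose[OF adj_permutes[OF i(1)] less.prems] .
    then obtain w where w: "set w \<subseteq> {1..<n}" "pos_of_word w = \<tau> \<circ> adj i"
        "length w = inv_count n (\<tau> \<circ> adj i)"
      using less.hyps[of "\<tau> \<circ> adj i"] inv_count_adj_descent[of i n \<tau>] i by auto
    show ?thesis
      using w i inv_count_adj_descent[of i n \<tau>] by (intro exI[of _ "i # w"]) auto
  next
    case False
    hence "\<tau> = id" using permutes_no_descent_id[OF less.prems] by (meson not_le_imp_less)
    then show ?thesis by (intro exI[of _ "[]"]) simp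
  qed
qed

lemma perm_length_eq:
  assumes "\<sigma> permutes {1..n}"
  shows "perm_length n \<sigma> = inv_count n (perm_inv \<sigma>)"
  unfolding perm_length_def
proof (rule Least_equality)
  obtain w where w: "set w \<subseteq> {1..<n}" "pos_of_word w = perm_inv \<sigma>" "length w = inv_count n (perm_inv \<sigma>)"
    using word_of_permutation[OF permutes_inv[OF assms]] by blast
  have "perm_of_word w = \<sigma>"
    using w(2) unfolding pos_of_word_def
    by (metis assms bij_perm_of_word inv_inv_eq permutes_bij)
  thus "\<exists>w. set w \<subseteq> {1..<n} \<and> perm_of_word w = \<sigma> \<and> length w = inv_count n (perm_inv \<sigma>)"
    using w by blast
next
  fix k assume "\<exists>w. set w \<subseteq> {1..<n} \<and> perm_of_word w = \<sigma> \<and> length w = k"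
  thus "inv_count n (perm_inv \<sigma>) \<le> k"
    using inv_count_pos_of_word_le unfolding pos_of_word_def by blast
qed

text \<open>The inversion number replaces the \<open>LEAST\<close> in \<open>perm_length\<close>, so
  that reducedness can be tested letter by letter; \<open>reduced_word_iff\<close> is the
  bridge.\<close>

definition reduced :: "nat \<Rightarrow> nat list \<Rightarrow> bool" where
  "reduced n w \<longleftrightarrow> set w \<subseteq> {1..<n} \<and> length w = inv_count n (pos_of_word w)"

lemma reduced_word_iff:
  "reduced_word n \<sigma> w \<longleftrightarrow> reduced n w \<and> perm_of_word w = \<sigma>"
  unfolding reduced_word_def reduced_def pos_of_word_def
  using perm_length_eq perm_of_word_permutes by auto

lemma reduced_Nil [simp]: "reduced n []"
  by (simp add: reduced_def)

text \<open>A letter raises the inversion number by at most one, so a word that has fallen behind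
  its length never catches up.\<close>

lemma reduced_Cons_iff:
  "reduced n (i # w) \<longleftrightarrow>
     i \<in> {1..<n} \<and> reduced n w \<and> pos_of_word w i < pos_of_word w (Suc i)"
proof (cases "set w \<subseteq> {1..<n} \<and> i \<in> {1..<n}")
  case True
  let ?\<tau> = "pos_of_word w"
  have t: "?\<tau> permutes {1..n}" using True pos_of_word_permutes by blast
  have le: "inv_count n ?\<tau> \<le> length w" using True inv_count_pos_of_word_le by blast
  consider "?\<tau> i < ?\<tau> (Suc i)" | "?\<tau> (Suc i) < ?\<tau> i"
    using permutes_neq_Suc[OF t, of i] by linarith
  then show ?thesis
  proof cases
    case 1
    then show ?thesis using inv_count_adj_ascent[of i n ?\<tau>] True le by (auto simp: reduced_def)
  next
    case 2
    then show ?thesis using inv_count_adj_descent[of i n ?\<tau>] True le by (auto simp: reduced_def)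
  qed
qed (auto simp: reduced_def)

text \<open>This takes the place of the exchange condition: any descent of the position function can
  be made the first letter of a reduced word.\<close>

lemma reduced_descent:
  assumes "reduced n w" "i \<in> {1..<n}" "pos_of_word w (Suc i) < pos_of_word w i"
  obtains v where "reduced n (i # v)" "pos_of_word (i # v) = pos_of_word w"
proof -
  let ?\<tau> = "pos_of_word w"
  have "?\<tau> permutes {1..n}" using assms(1) pos_of_word_permutes by (auto simp: reduced_def)
  hence "?\<tau> \<circ> adj i permutes {1..n}"
    using permutes_compose[OF adj_permutes[OF assms(2)]] by blast
  from word_of_permutation[OF this] obtain v where
    v: "set v \<subseteq> {1..<n}" "pos_of_word v = ?\<tau> \<circ> adj i" "length v = inv_count n (?\<tau> \<circ> adj i)" by blast
  have "reduced n (i # v)"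
    using v assms by (simp add: reduced_Cons_iff) (simp add: reduced_def)
  moreover have "pos_of_word (i # v) = ?\<tau>" using v by simp
  ultimately show ?thesis using that by blast
qed

lemma reduced_word_exists:
  assumes "\<sigma> permutes {1..n}"
  shows "\<exists>w. reduced_word n \<sigma> w"
proof -
  obtain w where w: "set w \<subseteq> {1..<n}" "pos_of_word w = perm_inv \<sigma>" "length w = inv_count n (perm_inv \<sigma>)"
    using word_of_permutation[OF permutes_inv[OF assms]] by blast
  have "perm_of_word w = \<sigma>"
    using w(2) unfolding pos_of_word_def
    by (metis assms bij_perm_of_word inv_inv_eq permutes_bij)
  thus ?thesis using w by (auto simp: reduced_word_iff reduced_def)
qed

text \<open>Matsumoto's theorem in type \<open>A\<close>. In a position function with descents at \<open>i\<close> and \<open>j\<close>, both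
  can be removed independently if \<open>\<bar>i - j\<bar> \<ge> 2\<close>, and three adjacent values are decreasing if
  \<open>j = i + 1\<close>.\<close>

locale braid_invariant =
  fixes n :: nat and f :: "nat list \<Rightarrow> 'b"
  assumes Cons_cong: "\<lbrakk>i \<in> {1..<n}; set v \<subseteq> {1..<n}; set w \<subseteq> {1..<n}; f v = f w\<rbrakk> \<Longrightarrow> f (i # v) = f (i # w)"
    and braid: "\<lbrakk>i \<in> {1..<n}; Suc i \<in> {1..<n}; set w \<subseteq> {1..<n}\<rbrakk> \<Longrightarrow>
      f (i # Suc i # i # w) = f (Suc i # i # Suc i # w)"
    and far: "\<lbrakk>i \<in> {1..<n}; j \<in> {1..<n}; Suc i < j; set w \<subseteq> {1..<n}\<rbrakk> \<Longrightarrow> f (i # j # w) = f (j # i # w)"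
begin

text \<open>The length bound is a separate parameter \<open>m\<close>, so that the statement can be
  applied with the two words interchanged, which reduces \<open>matsumoto\<close> to
  \<open>i < j\<close>.\<close>

lemma matsumoto_step:
  assumes IH: "\<And>v w. \<lbrakk>length v < m; reduced n v; reduced n w; pos_of_word v = pos_of_word w\<rbrakk> \<Longrightarrow> f v = f w"
    and red: "reduced n (i # v)" "reduced n (j # w)" and eq: "pos_of_word (i # v) = pos_of_word (j # w)"
    and len: "length (i # v) = m" and "i < j"
  shows "f (i # v) = f (j # w)"
proof -
  define \<tau> where "\<tau> = pos_of_word (i # v)"
  have ij: "i \<in> {1..<n}" "j \<in> {1..<n}" and sub: "set v \<subseteq> {1..<n}" "set w \<subseteq> {1..<n}"
    using red by (auto simp: reduced_def)
  have v: "pos_of_word v = \<tau> \<circ> adj i"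
    unfolding \<tau>_def pos_of_word_Cons adj_adj ..
  have w: "pos_of_word w = \<tau> \<circ> adj j"
    unfolding \<tau>_def eq unfolding pos_of_word_Cons adj_adj ..
  have di: "\<tau> (Suc i) < \<tau> i"
    using red(1) unfolding reduced_Cons_iff v by simp
  have dj: "\<tau> (Suc j) < \<tau> j"
    using red(2) unfolding reduced_Cons_iff w by simp
  have rv: "reduced n v" and rw: "reduced n w" using red by (auto simp: reduced_Cons_iff)
  have lw: "length w < m" "length v < m"
    using red eq len by (auto simp: reduced_def)
  show ?thesis
  proof (cases "Suc i < j")
    case True
    have "pos_of_word v (Suc j) < pos_of_word v j"
      using True dj by (simp add: v transpose_def)
    \<comment> \<open>A common tail: by induction \<open>v\<close> may be replaced by
      \<open>j # x\<close> and \<open>w\<close> by \<open>i # x\<close>.\<close>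
    then obtain x where x: "reduced n (j # x)" "pos_of_word (j # x) = pos_of_word v"
      using reduced_descent[OF rv ij(2)] by blast
    have px: "pos_of_word x = \<tau> \<circ> adj i \<circ> adj j"
      using x(2) v by (metis adj_adj pos_of_word_Cons)
    have com: "\<tau> \<circ> adj i \<circ> adj j = \<tau> \<circ> adj j \<circ> adj i"
      using True by (auto simp: fun_eq_iff transpose_def)
    have "reduced n (i # x)"
      using x(1) True ij di by (auto simp: reduced_Cons_iff px transpose_def)
    moreover have "pos_of_word (i # x) = pos_of_word w"
      using px com w by simp
    ultimately have fw: "f w = f (i # x)" using IH[of w "i # x"] lw rw by simp
    have fv: "f v = f (j # x)" using IH[of v "j # x"] lw x rv by simp
    have sx: "set x \<subseteq> {1..<n}" using x(1) by (simp add: reduced_def)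
    have "f (i # v) = f (i # j # x)"
      by (rule Cons_cong[OF ij(1) sub(1) _ fv]) (use ij sx in simp)
    moreover have "f (j # w) = f (j # i # x)"
      by (rule Cons_cong[OF ij(2) sub(2) _ fw]) (use ij sx in simp)
    ultimately show ?thesis using far[OF ij True sx] by simp
  next
    case False
    \<comment> \<open>By induction \<open>v\<close> may be replaced by \<open>j # i # y\<close> and
      \<open>w\<close> by \<open>i # j # y\<close> with a common \<open>y\<close>; one braid move
      then joins the two words.\<close>
    hence j: "j = Suc i" using \<open>i < j\<close> by simp
    have d: "\<tau> (Suc (Suc i)) < \<tau> (Suc i)" using dj j by simp
    have "pos_of_word v (Suc (Suc i)) < pos_of_word v (Suc i)"
      using d di by (simp add: v transpose_def)
    then obtain x where x: "reduced n (j # x)" "pos_of_word (j # x) = pos_of_word v"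
      using reduced_descent[OF rv ij(2)] j by blast
    have px: "pos_of_word x = \<tau> \<circ> adj i \<circ> adj j"
      using x(2) v by (metis adj_adj pos_of_word_Cons)
    have rx: "reduced n x" using x(1) by (simp add: reduced_Cons_iff)
    have "pos_of_word x (Suc i) < pos_of_word x i"
      using d di by (simp add: px j transpose_def)
    then obtain y where y: "reduced n (i # y)" "pos_of_word (i # y) = pos_of_word x"
      using reduced_descent[OF rx ij(1)] by blast
    have py: "pos_of_word y = \<tau> \<circ> adj i \<circ> adj j \<circ> adj i"
      using y(2) px by (metis adj_adj pos_of_word_Cons)
    have sy: "set y \<subseteq> {1..<n}" and sx: "set x \<subseteq> {1..<n}"
      using x(1) y(1) by (auto simp: reduced_def)
    have br: "\<tau> \<circ> adj i \<circ> adj j \<circ> adj i = \<tau> \<circ> adj j \<circ> adj i \<circ> adj j"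
      by (auto simp: fun_eq_iff transpose_def j)
    have pjy: "pos_of_word (j # y) = \<tau> \<circ> adj j \<circ> adj i"
      using py br by simp
    have rjy: "reduced n (j # y)"
      using y(1) ij d di by (auto simp: reduced_Cons_iff py transpose_def j)
    have rijy: "reduced n (i # j # y)"
      using rjy ij d di unfolding reduced_Cons_iff[of n i] pjy by (auto simp: transpose_def j)
    have "pos_of_word (i # j # y) = pos_of_word w"
      using pjy w by simp
    hence fw: "f w = f (i # j # y)" using IH[of w "i # j # y"] lw rw rijy by simp
    have fv: "f v = f (j # x)" using IH[of v "j # x"] lw x rv by simp
    have "length x < m" using x rv lw by (simp add: reduced_def)
    hence fx: "f x = f (i # y)" using IH[of x "i # y"] y rx by simp
    have "f (j # x) = f (j # i # y)"
      by (rule Cons_cong[OF ij(2) sx _ fx]) (use ij sy in simp)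
    with fv have fv': "f v = f (j # i # y)" by simp
    have "f (i # v) = f (i # j # i # y)"
      by (rule Cons_cong[OF ij(1) sub(1) _ fv']) (use ij sy in simp)
    moreover have "f (j # w) = f (j # i # j # y)"
      by (rule Cons_cong[OF ij(2) sub(2) _ fw]) (use ij sy in simp)
    ultimately show ?thesis using braid[of i y] ij sy unfolding j by simp
  qed
qed

lemma matsumoto:
  assumes "reduced n v" "reduced n w" "pos_of_word v = pos_of_word w"
  shows "f v = f w"
  using assms
proof (induction "length v" arbitrary: v w rule: less_induct)
  case less
  have len: "length v = length w" using less.prems by (simp add: reduced_def)
  show ?case
  proof (cases v)
    case Nil
    then show ?thesis using len by simp
  next
    case (Cons i v')
    then obtain j w' where w: "w = j # w'" using len by (cases w) auto
    consider "i = j" | "i < j" | "j < i" by linarith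
    then show ?thesis
    proof cases
      case 1
      have "pos_of_word v' = pos_of_word w'"
        using less.prems(3) Cons w 1 by (metis adj_adj pos_of_word_Cons)
      hence "f v' = f w'"
        using less.hyps[of v' w'] less.prems Cons w by (simp add: reduced_Cons_iff)
      then show ?thesis
        using Cons_cong[of i v' w'] less.prems Cons w 1 by (simp add: reduced_def)
    next
      case 2
      show ?thesis unfolding Cons w
      proof (rule matsumoto_step[where m = "length v"])
        show "f x = f y" if "length x < length v" "reduced n x" "reduced n y" "pos_of_word x = pos_of_word y" for x y
          by (rule less.hyps[OF that])
        show "reduced n (i # v')" "reduced n (j # w')" "pos_of_word (i # v') = pos_of_word (j # w')"
          using less.prems unfolding Cons w .
        show "length (i # v') = length v" by (simp only: Cons)
        show "i < j" by (rule 2)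
      qed
    next
      case 3
      have "f (j # w') = f (i # v')"
      proof (rule matsumoto_step[where m = "length v"])
        show "f x = f y" if "length x < length v" "reduced n x" "reduced n y" "pos_of_word x = pos_of_word y" for x y
          by (rule less.hyps[OF that])
        show "reduced n (j # w')" "reduced n (i # v')"
          using less.prems(2,1) unfolding Cons w .
        show "pos_of_word (j # w') = pos_of_word (i # v')"
          using less.prems(3)[symmetric] unfolding Cons w .
        show "length (j # w') = length v" by (simp only: len w)
        show "j < i" by (rule 3)
      qed
      then show ?thesis unfolding Cons w by simp
    qed
  qed
qed

end

section \<open>The longest permutation\<close>

lemma inv_count_le: "inv_count n \<tau> \<le> n * n"
proof -
  have "inversions n \<tau> \<subseteq> {1..n} \<times> {1..n}" by (auto simp: inversions_def)
  from card_mono[OF _ this] show ?thesis by (simp add: inv_count_def)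
qed

text \<open>Lengths are bounded by \<open>n * n\<close>, so the \<open>ARG_MAX\<close> is attained;
  at an ascent an exchange would produce a longer permutation. With
  \<open>permutes_no_ascent\<close> the inverse is then known explicitly on
  \<open>{1..n}\<close>.\<close>

lemma
  shows longest_perm_permutes: "longest_perm n permutes {1..n}"
    and longest_perm_no_ascent: "\<And>i. i \<in> {1..<n} \<Longrightarrow> perm_inv (longest_perm n) (Suc i) \<le> perm_inv (longest_perm n) i"
proof -
  have b: "perm_length n \<sigma> < Suc (n * n)" if "\<sigma> permutes {1..n}" for \<sigma>
    using perm_length_eq[OF that] inv_count_le[of n "perm_inv \<sigma>"] by simp
  have *: "longest_perm n permutes {1..n} \<and>
      (\<forall>\<sigma>. \<sigma> permutes {1..n} \<longrightarrow> perm_length n \<sigma> \<le> perm_length n (longest_perm n))"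
    unfolding longest_perm_def
    by (rule arg_max_nat_lemma[of "\<lambda>\<sigma>. \<sigma> permutes {1..n}" id "perm_length n" "Suc (n * n)"])
      (use b permutes_id in auto)
  thus p: "longest_perm n permutes {1..n}" by blast
  let ?\<tau> = "perm_inv (longest_perm n)"
  show "?\<tau> (Suc i) \<le> ?\<tau> i" if i: "i \<in> {1..<n}" for i
  proof (rule ccontr)
    assume "\<not> ?thesis"
    hence "inv_count n (?\<tau> \<circ> adj i) = Suc (inv_count n ?\<tau>)"
      using inv_count_adj_ascent[OF i] by simp
    moreover have t: "?\<tau> \<circ> adj i permutes {1..n}"
      using permutes_compose[OF adj_permutes[OF i] permutes_inv[OF p]] .
    have "perm_inv (perm_inv (?\<tau> \<circ> adj i)) = ?\<tau> \<circ> adj i"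
      using t by (rule permutes_inv_inv)
    ultimately have "perm_length n (perm_inv (?\<tau> \<circ> adj i)) = Suc (perm_length n (longest_perm n))"
      using perm_length_eq[OF permutes_inv[OF t]] perm_length_eq[OF p] by simp
    thus False using * permutes_inv[OF t] by (metis Suc_n_not_le_n)
  qed
qed

section \<open>Actions of free algebras\<close>

lemma single_word_Cons: "Poly_Mapping.single (Word (g # gs)) a = fgen g * Poly_Mapping.single (Word gs) a"
  by (simp add: fgen_def mult_single plus_word_def)

lemma free_alg_on_simps [simp]:
  "mult (free_alg_on G) = (*)" "one (free_alg_on G) = 1" "zero (free_alg_on G) = 0"
  "add (free_alg_on G) = (+)"
  by (simp_all add: free_alg_on_def)

lemma mem_free_alg_on: "p \<in> carrier (free_alg_on G) \<longleftrightarrow> (\<forall>w\<in>Poly_Mapping.keys p. set (letters w) \<subseteq> G)"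
  by (simp add: free_alg_on_def)

lemma sum_monomials: "(\<Sum>w\<in>Poly_Mapping.keys p. Poly_Mapping.single w (Poly_Mapping.lookup p w)) = p"
proof (rule poly_mapping_eqI)
  fix v
  show "Poly_Mapping.lookup (\<Sum>w\<in>Poly_Mapping.keys p. Poly_Mapping.single w (Poly_Mapping.lookup p w)) v
      = Poly_Mapping.lookup p v"
    by (simp add: lookup_sum lookup_single when_def in_keys_iff)
qed

lemma free_alg_on_monomial_induct [consumes 1, case_names monomial add]:
  assumes p: "p \<in> carrier (free_alg_on G)"
    and mono: "\<And>w a. set (letters w) \<subseteq> G \<Longrightarrow> P (Poly_Mapping.single w a)"
    and add: "\<And>p q. P p \<Longrightarrow> P q \<Longrightarrow> P (p + q)"
  shows "P p"
proof -
  have "P (\<Sum>w\<in>S. Poly_Mapping.single w (Poly_Mapping.lookup p w))"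
    if "finite S" "S \<subseteq> Poly_Mapping.keys p" for S
    using that
  proof (induction S)
    case empty
    have "P (Poly_Mapping.single 0 0)" by (rule mono) (simp add: zero_word_def)
    then show ?case by simp
  next
    case (insert w S)
    have "P (Poly_Mapping.single w (Poly_Mapping.lookup p w))"
      using p insert.prems by (intro mono) (auto simp: mem_free_alg_on)
    then show ?case using insert add by simp
  qed
  from this[of "Poly_Mapping.keys p"] show ?thesis by (simp add: sum_monomials)
qed

lemma mem_free_alg_on_single: "set (letters w) \<subseteq> G \<Longrightarrow> Poly_Mapping.single w a \<in> carrier (free_alg_on G)"
  by (auto simp: mem_free_alg_on)

lemma mem_free_alg_on_add:
  "\<lbrakk>p \<in> carrier (free_alg_on G); q \<in> carrier (free_alg_on G)\<rbrakk> \<Longrightarrow> p + q \<in> carrier (free_alg_on G)"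
  using keys_add[of p q] by (auto simp: mem_free_alg_on)

lemma mem_free_alg_on_mult:
  assumes "p \<in> carrier (free_alg_on G)" "q \<in> carrier (free_alg_on G)"
  shows "p * q \<in> carrier (free_alg_on G)"
proof -
  have "set (letters w) \<subseteq> G" if "w \<in> Poly_Mapping.keys (p * q)" for w
  proof -
    obtain v v' where "w = v + v'" "v \<in> Poly_Mapping.keys p" "v' \<in> Poly_Mapping.keys q"
      using keys_mult[of p q] \<open>w \<in> _\<close> by auto
    thus ?thesis using assms by (auto simp: mem_free_alg_on plus_word_def)
  qed
  thus ?thesis by (simp add: mem_free_alg_on)
qed

lemma mem_free_alg_on_const: "fconst z \<in> carrier (free_alg_on G)"
  unfolding fconst_def by (rule mem_free_alg_on_single) (simp add: zero_word_def)

lemma mem_free_alg_on_gen: "g \<in> G \<Longrightarrow> fgen g \<in> carrier (free_alg_on G)"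
  unfolding fgen_def by (rule mem_free_alg_on_single) simp

lemma fconst_0 [simp]: "fconst 0 = 0" and fconst_1 [simp]: "fconst 1 = 1"
  and fconst_add: "fconst (a + b) = fconst a + fconst b"
  and fconst_diff: "fconst (a - b) = fconst a - fconst b"
  and fconst_minus: "fconst (- a) = - fconst a"
  and fconst_mult: "fconst (a * b) = fconst a * fconst b"
  by (simp_all add: fconst_def single_add single_diff single_uminus mult_single)

lemma fconst_commute: "fconst z * p = p * fconst z"
proof -
  have "p \<in> carrier (free_alg_on UNIV)" by (simp add: mem_free_alg_on)
  thus ?thesis
  proof (induction p rule: free_alg_on_monomial_induct)
    case (monomial w a)
    then show ?case by (simp add: fconst_def mult_single mult.commute)
  qed (simp add: distrib_left distrib_right)
qed

lemma fconst_left_commute: "p * (fconst z * q) = fconst z * (p * q)"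
  by (metis fconst_commute mult.assoc)

lemma mem_free_alg_on_0: "0 \<in> carrier (free_alg_on G)" and mem_free_alg_on_1: "1 \<in> carrier (free_alg_on G)"
  using mem_free_alg_on_const[of 0 G] mem_free_alg_on_const[of 1 G] by simp_all

lemma mem_free_alg_on_uminus: "p \<in> carrier (free_alg_on G) \<Longrightarrow> - p \<in> carrier (free_alg_on G)"
  by (simp add: mem_free_alg_on)

lemma mem_free_alg_on_diff:
  "\<lbrakk>p \<in> carrier (free_alg_on G); q \<in> carrier (free_alg_on G)\<rbrakk> \<Longrightarrow> p - q \<in> carrier (free_alg_on G)"
  using mem_free_alg_on_add[of p G "- q"] mem_free_alg_on_uminus[of q G] by simp

lemma mem_free_alg_on_sum:
  "(\<And>i. i \<in> I \<Longrightarrow> f i \<in> carrier (free_alg_on G)) \<Longrightarrow> sum f I \<in> carrier (free_alg_on G)"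
  by (induction I rule: infinite_finite_induct) (auto simp: mem_free_alg_on_0 intro!: mem_free_alg_on_add)

lemma mem_free_alg_on_prod_list:
  "(\<And>p. p \<in> set ps \<Longrightarrow> p \<in> carrier (free_alg_on G)) \<Longrightarrow> prod_list ps \<in> carrier (free_alg_on G)"
  by (induction ps) (auto simp: mem_free_alg_on_1 intro!: mem_free_alg_on_mult)

lemmas mem_free_alg_on_intros =
  mem_free_alg_on_add mem_free_alg_on_mult mem_free_alg_on_const mem_free_alg_on_gen
  mem_free_alg_on_0 mem_free_alg_on_1 mem_free_alg_on_uminus mem_free_alg_on_diff
  mem_free_alg_on_sum mem_free_alg_on_prod_list

text \<open>Words grow on the left, which is the direction in which elements are applied to a vector
  of a left module.\<close>

lemma free_alg_on_induct [consumes 1, case_names const gen add]: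
  assumes p: "p \<in> carrier (free_alg_on G)"
    and const: "\<And>z. P (fconst z)"
    and gen: "\<And>g q. \<lbrakk>g \<in> G; q \<in> carrier (free_alg_on G); P q\<rbrakk> \<Longrightarrow> P (fgen g * q)"
    and add: "\<And>p q. \<lbrakk>p \<in> carrier (free_alg_on G); q \<in> carrier (free_alg_on G); P p; P q\<rbrakk> \<Longrightarrow> P (p + q)"
  shows "P p"
proof -
  have mono: "P (Poly_Mapping.single (Word gs) a)" if "set gs \<subseteq> G" for gs a
    using that
  proof (induction gs)
    case Nil
    then show ?case using const[of a] by (simp add: fconst_def zero_word_def)
  next
    case (Cons g gs)
    then show ?case unfolding single_word_Cons
      by (intro gen mem_free_alg_on_single) auto
  qed
  from p have "p \<in> carrier (free_alg_on G) \<and> P p"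
  proof (induction p rule: free_alg_on_monomial_induct)
    case (monomial w a)
    then show ?case using mono[of "letters w" a] mem_free_alg_on_single[of w G a] by simp
  next
    case (add p q)
    then show ?case using assms(4) mem_free_alg_on_add by blast
  qed
  thus ?thesis ..
qed

lemma ring_free_alg_on: "ring (free_alg_on G)"
proof (rule ringI)
  show "abelian_group (free_alg_on G)"
    by (rule abelian_groupI)
      (auto simp: mem_free_alg_on_add mem_free_alg_on_0 add.assoc add.commute
        intro: bexI[of _ "- x" for x] mem_free_alg_on_uminus)
  show "Group.monoid (free_alg_on G)"
    by (rule Group.monoidI) (auto simp: mem_free_alg_on_mult mem_free_alg_on_1 mult.assoc)
qed (simp_all add: distrib_left distrib_right)

lemma a_inv_free_alg_on:
  assumes "p \<in> carrier (free_alg_on G)"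
  shows "\<ominus>\<^bsub>free_alg_on G\<^esub> p = - p"
proof -
  interpret ring "free_alg_on G" by (rule ring_free_alg_on)
  show ?thesis
    using minus_equality[of "- p" p] assms by (simp add: mem_free_alg_on_uminus)
qed

section \<open>Operators on functions attached to elements of the free algebra\<close>

definition act_word :: "('g \<Rightarrow> ('v \<Rightarrow> complex) \<Rightarrow> 'v \<Rightarrow> complex) \<Rightarrow> 'g word \<Rightarrow> ('v \<Rightarrow> complex) \<Rightarrow> 'v \<Rightarrow> complex" where
  "act_word A w = foldr A (letters w)"

definition act :: "('g \<Rightarrow> ('v \<Rightarrow> complex) \<Rightarrow> 'v \<Rightarrow> complex) \<Rightarrow> 'g free_alg \<Rightarrow> ('v \<Rightarrow> complex) \<Rightarrow> 'v \<Rightarrow> complex" where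
  "act A p F = (\<lambda>x. \<Sum>w\<in>Poly_Mapping.keys p. Poly_Mapping.lookup p w * act_word A w F x)"

lemma act_superset:
  assumes "finite S" "Poly_Mapping.keys p \<subseteq> S"
  shows "act A p F x = (\<Sum>w\<in>S. Poly_Mapping.lookup p w * act_word A w F x)"
  unfolding act_def using assms by (intro sum.mono_neutral_left) (auto simp: in_keys_iff)

lemma act_add: "act A (p + q) F = (\<lambda>x. act A p F x + act A q F x)"
proof
  fix x
  let ?S = "Poly_Mapping.keys p \<union> Poly_Mapping.keys q"
  have "act A (p + q) F x = (\<Sum>w\<in>?S. Poly_Mapping.lookup (p + q) w * act_word A w F x)"
    using keys_add[of p q] by (intro act_superset) auto
  also have "\<dots> = act A p F x + act A q F x"
    by (simp add: act_superset[of ?S p] act_superset[of ?S q] lookup_add distrib_right sum.distrib)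
  finally show "act A (p + q) F x = act A p F x + act A q F x" .
qed

lemma act_single: "act A (Poly_Mapping.single w a) F = (\<lambda>x. a * act_word A w F x)"
  by (simp add: act_def)

lemma act_0 [simp]: "act A 0 F = (\<lambda>x. 0)"
  by (simp add: act_def)

lemma act_const: "act A (fconst z) F = (\<lambda>x. z * F x)"
  by (simp add: fconst_def act_single act_word_def zero_word_def)

lemma act_1: "act A 1 F = F"
  using act_const[of A 1 F] by simp

lemma act_gen: "act A (fgen g) F = A g F"
  by (simp add: fgen_def act_single act_word_def)

lemma act_uminus: "act A (- p) F = (\<lambda>x. - act A p F x)"
  by (simp add: act_def sum_negf)

lemma act_diff: "act A (p - q) F = (\<lambda>x. act A p F x - act A q F x)"
  using act_add[of A p "- q" F] by (simp add: act_uminus)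

lemma act_sum: "act A (sum f I) F = (\<lambda>x. \<Sum>i\<in>I. act A (f i) F x)"
  by (induction I rule: infinite_finite_induct) (simp_all add: act_add)

locale linear_action =
  fixes A :: "'g \<Rightarrow> ('v \<Rightarrow> complex) \<Rightarrow> 'v \<Rightarrow> complex"
  assumes A_add: "A g (\<lambda>x. F x + H x) = (\<lambda>x. A g F x + A g H x)"
    and A_scale: "A g (\<lambda>x. z * F x) = (\<lambda>x. z * A g F x)"
begin

lemma act_word_add: "act_word A w (\<lambda>x. F x + H x) = (\<lambda>x. act_word A w F x + act_word A w H x)"
proof -
  have "foldr A gs (\<lambda>x. F x + H x) = (\<lambda>x. foldr A gs F x + foldr A gs H x)" for gs
    by (induction gs) (simp_all add: A_add)
  thus ?thesis by (simp add: act_word_def)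
qed

lemma act_word_scale: "act_word A w (\<lambda>x. z * F x) = (\<lambda>x. z * act_word A w F x)"
proof -
  have "foldr A gs (\<lambda>x. z * F x) = (\<lambda>x. z * foldr A gs F x)" for gs
    by (induction gs) (simp_all add: A_scale)
  thus ?thesis by (simp add: act_word_def)
qed

lemma act_mult: "act A (p * q) F = act A p (act A q F)"
proof -
  have "p \<in> carrier (free_alg_on UNIV)" "q \<in> carrier (free_alg_on UNIV)"
    by (simp_all add: mem_free_alg_on)
  from this(1) show ?thesis
  proof (induction p rule: free_alg_on_monomial_induct)
    case (monomial v a)
    from \<open>q \<in> _\<close> show ?case
    proof (induction q rule: free_alg_on_monomial_induct)
      case (monomial w b)
      have "act_word A (v + w) F = act_word A v (act_word A w F)"
        by (simp add: act_word_def plus_word_def)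
      then show ?case by (simp add: mult_single act_single act_word_scale mult.assoc)
    next
      case (add p q)
      then show ?case by (simp add: distrib_left act_add act_single act_word_add)
    qed
  next
    case (add p q)
    then show ?case by (simp add: distrib_right act_add)
  qed
qed

text \<open>The functions that vanish on \<open>V\<close> are stable, so relations need to be checked only at the points
  of \<open>V\<close>.\<close>

lemma ideal_annihilator:
  assumes V: "\<And>g F x. \<lbrakk>g \<in> G; \<And>y. y \<in> V \<Longrightarrow> F y = 0; x \<in> V\<rbrakk> \<Longrightarrow> A g F x = 0"
  shows "ideal {p \<in> carrier (free_alg_on G). \<forall>F. \<forall>x\<in>V. act A p F x = 0} (free_alg_on G)"
    (is "ideal ?K _")
proof (rule idealI[OF ring_free_alg_on])
  interpret ring "free_alg_on G" by (rule ring_free_alg_on)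
  show "subgroup ?K (add_monoid (free_alg_on G))"
  proof (rule add.subgroupI)
    fix p assume "p \<in> ?K"
    thus "\<ominus>\<^bsub>free_alg_on G\<^esub> p \<in> ?K"
      by (simp add: a_inv_free_alg_on act_uminus mem_free_alg_on_uminus)
  next
    have "0 \<in> ?K" by (simp add: mem_free_alg_on_0)
    thus "?K \<noteq> {}" by blast
  qed (auto simp: mem_free_alg_on_add act_add)
next
  fix p q assume p: "p \<in> ?K" and q: "q \<in> carrier (free_alg_on G)"
  show "p \<otimes>\<^bsub>free_alg_on G\<^esub> q \<in> ?K"
    using p q by (simp add: act_mult mem_free_alg_on_mult)
  have "act A q F x = 0" if "\<And>y. y \<in> V \<Longrightarrow> F y = 0" "x \<in> V" for F x
    using q that
  proof (induction q arbitrary: x rule: free_alg_on_induct)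
    case (gen g q)
    then show ?case by (simp add: act_mult act_gen V)
  qed (simp_all add: act_const act_add)
  thus "q \<otimes>\<^bsub>free_alg_on G\<^esub> p \<in> ?K"
    using p q by (simp add: act_mult mem_free_alg_on_mult)
qed

text \<open>Diagonality is asked for at the single point \<open>x\<close> only. For polynomials in
  one \<open>\<xi>\<^sub>j\<close> the eigenvalue \<open>d p\<close> is obtained as the value at
  \<open>x\<close> of \<open>p\<close> applied to the constant function 1.\<close>

lemma act_prod_list_diagonal:
  assumes "\<And>p F. p \<in> set ps \<Longrightarrow> act A p F x = d p * F x"
  shows "act A (prod_list ps) F x = prod_list (map d ps) * F x"
  using assms by (induction ps) (simp_all add: act_mult act_1)

end

section \<open>The regular representation\<close>

text \<open>Left multiplication by \<open>T\<^sub>i\<close>, where \<open>f \<tau>\<close> is the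
  coefficient of \<open>T\<^sub>\<sigma>\<close> with \<tau> the inverse of \<sigma>. At an ascent
  of \<tau> the product is the next longer basis element, at a descent it is
  \<open>- T\<^sub>\<sigma>\<close>; so the result lives on the \<tau> with a descent at
  \<open>i\<close>.\<close>

definition hecke_op :: "nat \<Rightarrow> ((nat \<Rightarrow> nat) \<Rightarrow> complex) \<Rightarrow> (nat \<Rightarrow> nat) \<Rightarrow> complex" where
  "hecke_op i f = (\<lambda>\<tau>. if \<tau> (Suc i) < \<tau> i then f (\<tau> \<circ> adj i) - f \<tau> else 0)"

lemma hecke_op_add: "hecke_op i (\<lambda>\<tau>. f \<tau> + g \<tau>) = (\<lambda>\<tau>. hecke_op i f \<tau> + hecke_op i g \<tau>)"
  and hecke_op_diff: "hecke_op i (\<lambda>\<tau>. f \<tau> - g \<tau>) = (\<lambda>\<tau>. hecke_op i f \<tau> - hecke_op i g \<tau>)"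
  and hecke_op_uminus: "hecke_op i (\<lambda>\<tau>. - f \<tau>) = (\<lambda>\<tau>. - hecke_op i f \<tau>)"
  and hecke_op_zero: "hecke_op i (\<lambda>\<tau>. 0) = (\<lambda>\<tau>. 0)"
  by (auto simp: hecke_op_def algebra_simps)

lemma hecke_op_quadratic: "hecke_op i (hecke_op i f) = (\<lambda>\<tau>. - hecke_op i f \<tau>)"
  by (auto simp: hecke_op_def)

lemma comp_adj_braid: "\<tau> \<circ> adj i \<circ> adj (Suc i) \<circ> adj i = \<tau> \<circ> adj (Suc i) \<circ> adj i \<circ> adj (Suc i)"
  by (auto simp: fun_eq_iff transpose_def)

lemma comp_adj_absorb: "c (Suc i) = c i \<Longrightarrow> c \<circ> adj i = c"
  by (auto simp: fun_eq_iff transpose_def)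

lemma comp_adj_commute: "Suc i < j \<Longrightarrow> \<tau> \<circ> adj i \<circ> adj j = \<tau> \<circ> adj j \<circ> adj i"
  by (auto simp: fun_eq_iff transpose_def)

text \<open>Both sides depend on \<tau> through the relative order of its values at three
  consecutive positions. Ties have to be included because \<tau> is an arbitrary function.\<close>

lemma hecke_op_braid:
  "hecke_op i (hecke_op (Suc i) (hecke_op i f)) = hecke_op (Suc i) (hecke_op i (hecke_op (Suc i) f))"
proof
  fix \<tau> :: "nat \<Rightarrow> nat"
  consider "\<tau> (Suc i) < \<tau> i" | "\<tau> (Suc i) = \<tau> i" | "\<tau> i < \<tau> (Suc i)" by linarith
  note 1 = this
  consider "\<tau> (Suc (Suc i)) < \<tau> (Suc i)" | "\<tau> (Suc (Suc i)) = \<tau> (Suc i)" | "\<tau> (Suc i) < \<tau> (Suc (Suc i))" by linarith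
  note 2 = this
  consider "\<tau> (Suc (Suc i)) < \<tau> i" | "\<tau> (Suc (Suc i)) = \<tau> i" | "\<tau> i < \<tau> (Suc (Suc i))" by linarith
  note 3 = this
  show "hecke_op i (hecke_op (Suc i) (hecke_op i f)) \<tau> = hecke_op (Suc i) (hecke_op i (hecke_op (Suc i) f)) \<tau>"
    by (rule 1; rule 2; rule 3; simp add: hecke_op_def comp_adj_braid transpose_def)
qed

lemma hecke_op_commute:
  assumes "Suc i < j"
  shows "hecke_op i (hecke_op j f) = hecke_op j (hecke_op i f)"
  using assms by (intro ext) (simp add: hecke_op_def transpose_def comp_adj_commute[OF assms] algebra_simps)

text \<open>The rule for \<open>T\<^sub>i L\<^sub>c\<close> transposed to coefficients. The first
  term collects \<open>L\<^sub>c T\<^sub>i\<close> arising from the exchanged word. The second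
  collects the remainders equal to \<open>L\<^sub>c\<close> up to sign: for
  \<open>c i < c (Suc i)\<close> one comes from \<open>c\<close> itself with sign -1 and one from
  the exchanged word with sign 1.\<close>

definition colored_op :: "nat \<Rightarrow> ((nat \<Rightarrow> nat) \<Rightarrow> (nat \<Rightarrow> nat) \<Rightarrow> complex) \<Rightarrow> (nat \<Rightarrow> nat) \<Rightarrow> (nat \<Rightarrow> nat) \<Rightarrow> complex" where
  "colored_op i G = (\<lambda>c \<tau>. hecke_op i (G (c \<circ> adj i)) \<tau> +
     (if c i < c (Suc i) then G (c \<circ> adj i) \<tau> - G c \<tau> else 0))"

lemmas hecke_op_simps = hecke_op_add hecke_op_diff hecke_op_uminus hecke_op_zero hecke_op_quadratic

lemma colored_op_quadratic: "colored_op i (colored_op i G) c \<tau> = - colored_op i G c \<tau>"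
proof -
  consider "c (Suc i) < c i" | "c (Suc i) = c i" | "c i < c (Suc i)" by linarith
  then show ?thesis by cases (simp_all add: colored_op_def hecke_op_simps comp_adj_absorb)
qed

text \<open>Only the order of the three colors is split here; the dependence on \<tau> is absorbed
  by the operator identities for \<open>hecke_op\<close>.\<close>

lemma colored_op_braid:
  "colored_op i (colored_op (Suc i) (colored_op i G)) c \<tau> =
   colored_op (Suc i) (colored_op i (colored_op (Suc i) G)) c \<tau>"
proof -
  consider "c (Suc i) < c i" | "c (Suc i) = c i" | "c i < c (Suc i)" by linarith
  note 1 = this
  consider "c (Suc (Suc i)) < c (Suc i)" | "c (Suc (Suc i)) = c (Suc i)" | "c (Suc i) < c (Suc (Suc i))" by linarith
  note 2 = this
  consider "c (Suc (Suc i)) < c i" | "c (Suc (Suc i)) = c i" | "c i < c (Suc (Suc i))" by linarith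
  note 3 = this
  show ?thesis
    by (rule 1; rule 2; rule 3; simp add: colored_op_def hecke_op_simps hecke_op_braid comp_adj_braid comp_adj_absorb transpose_def)
qed

lemma colored_op_commute:
  assumes "Suc i < j"
  shows "colored_op i (colored_op j G) c \<tau> = colored_op j (colored_op i G) c \<tau>"
proof -
  consider "c (Suc i) < c i" | "c (Suc i) = c i" | "c i < c (Suc i)" by linarith
  note 1 = this
  consider "c (Suc j) < c j" | "c (Suc j) = c j" | "c j < c (Suc j)" by linarith
  note 2 = this
  from assms show ?thesis
    by - (rule 1; rule 2; simp add: colored_op_def hecke_op_simps hecke_op_commute[OF assms] comp_adj_commute[OF assms] transpose_def)
qed

lemma set_upt_Suc: "set [1..<Suc n] = {1..n}"
  by auto

text \<open>The value of a function at \<open>(c, \<tau>)\<close> is the coefficient of \<open>L\<^sub>c T\<^sub>\<sigma>\<close> with \<open>\<tau> = \<sigma>\<^sup>-\<^sup>1\<close>, and the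
  action is left multiplication; color words are extended to functions on all positions.\<close>

fun aks_action :: "(nat \<Rightarrow> complex) \<Rightarrow> aks_gen \<Rightarrow> ((nat \<Rightarrow> nat) \<times> (nat \<Rightarrow> nat) \<Rightarrow> complex) \<Rightarrow>
    (nat \<Rightarrow> nat) \<times> (nat \<Rightarrow> nat) \<Rightarrow> complex" where
  "aks_action u (GenT i) F = (\<lambda>(c, \<tau>). colored_op i (curry F) c \<tau>)"
| "aks_action u (GenXi j) F = (\<lambda>(c, \<tau>). u (c j) * F (c, \<tau>))"

interpretation aks: linear_action "aks_action u" for u
proof
  fix g and F H :: "(nat \<Rightarrow> nat) \<times> (nat \<Rightarrow> nat) \<Rightarrow> complex" and z
  show "aks_action u g (\<lambda>x. F x + H x) = (\<lambda>x. aks_action u g F x + aks_action u g H x)"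
    by (cases g) (auto simp: colored_op_def hecke_op_def fun_eq_iff algebra_simps)
  show "aks_action u g (\<lambda>x. z * F x) = (\<lambda>x. z * aks_action u g F x)"
    by (cases g) (auto simp: colored_op_def hecke_op_def fun_eq_iff algebra_simps)
qed

abbreviation "aks_act u \<equiv> act (aks_action u)"

text \<open>The relations on \<open>\<xi>\<^sub>j\<close> hold only where \<open>c j\<close> is a
  color. Bounding the whole range of \<open>c\<close> makes the set stable under every exchange of
  positions.\<close>

definition colored_points :: "nat \<Rightarrow> ((nat \<Rightarrow> nat) \<times> (nat \<Rightarrow> nat)) set" where
  "colored_points r = {(c, \<tau>). range c \<subseteq> {1..r}}"

lemma prod_list_eq_1:
  fixes xs :: "'a::monoid_mult list"
  shows "(\<And>x. x \<in> set xs \<Longrightarrow> x = 1) \<Longrightarrow> prod_list xs = 1"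
  by (induction xs) simp_all

lemma lagrange_value:
  fixes u :: "nat \<Rightarrow> complex"
  assumes "inj_on u {1..r}" "a \<in> {1..r}" "k \<in> {1..r}"
  shows "(\<Prod>l\<leftarrow>filter (\<lambda>l. l \<noteq> k) [1..<Suc r]. (u a - u l) / (u k - u l)) = (if a = k then 1 else 0)"
proof (cases "a = k")
  case True
  have "(u k - u l) / (u k - u l) = 1" if "l \<in> {1..r}" "l \<noteq> k" for l
    using inj_onD[OF assms(1), of k l] that assms(3) by auto
  then have "(\<Prod>l\<leftarrow>filter (\<lambda>l. l \<noteq> k) [1..<Suc r]. (u a - u l) / (u k - u l)) = 1"
    using True by (intro prod_list_eq_1) (auto simp del: upt_Suc)
  then show ?thesis using True by simp
next
  case False
  then have "(u a - u a) / (u k - u a) \<in> set (map (\<lambda>l. (u a - u l) / (u k - u l)) (filter (\<lambda>l. l \<noteq> k) [1..<Suc r]))"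
    using assms by (intro image_eqI[of _ _ a] set_map[THEN equalityD2, THEN subsetD]) auto
  then have "(\<Prod>l\<leftarrow>filter (\<lambda>l. l \<noteq> k) [1..<Suc r]. (u a - u l) / (u k - u l)) = 0"
    by (subst prod_list_zero_iff) simp
  then show ?thesis using False by simp
qed

lemma aks_act_gen:
  "aks_act u (fT i) F = (\<lambda>(c, \<tau>). colored_op i (curry F) c \<tau>)"
  "aks_act u (fXi j) F = (\<lambda>(c, \<tau>). u (c j) * F (c, \<tau>))"
  by (simp_all add: act_gen)

lemmas aks_act_simps = aks.act_mult act_add act_diff act_uminus act_const act_1 aks_act_gen

lemma aks_act_lagr:
  assumes "inj_on u {1..r}" "k \<in> {1..r}" "c j \<in> {1..r}"
  shows "aks_act u (lagr r u k (fXi j)) F (c, \<tau>) = (if c j = k then F (c, \<tau>) else 0)"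
proof -
  let ?f = "\<lambda>l. fconst (1 / (u k - u l)) * (fXi j - fconst (u l))"
  have "aks_act u (lagr r u k (fXi j)) F (c, \<tau>) = (\<Prod>p\<leftarrow>map ?f (filter (\<lambda>l. l \<noteq> k) [1..<Suc r]). aks_act u p (\<lambda>_. 1) (c, \<tau>)) * F (c, \<tau>)"
    unfolding lagr_def
    by (rule aks.act_prod_list_diagonal) (auto simp: aks_act_simps algebra_simps)
  also have "map (\<lambda>p. aks_act u p (\<lambda>_. 1) (c, \<tau>)) (map ?f (filter (\<lambda>l. l \<noteq> k) [1..<Suc r])) =
     map (\<lambda>l. (u (c j) - u l) / (u k - u l)) (filter (\<lambda>l. l \<noteq> k) [1..<Suc r])"
    by (simp add: aks_act_simps)
  finally show ?thesis using lagrange_value[OF assms(1,3,2)] by simp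
qed

lemma aks_act_relation:
  assumes "inj_on u {1..r}" "(p, q) \<in> aks_relations n r u" "x \<in> colored_points r"
  shows "aks_act u (p - q) F x = 0"
proof -
  obtain c \<tau> where x: "x = (c, \<tau>)" by (cases x)
  have "range c \<subseteq> {1..r}" using assms(3) by (simp add: x colored_points_def)
  hence c: "c j \<in> {1..r}" for j by blast
  have curry: "curry (\<lambda>(c, \<tau>). G c \<tau>) = G" for G :: "(nat \<Rightarrow> nat) \<Rightarrow> (nat \<Rightarrow> nat) \<Rightarrow> complex"
    by (simp add: curry_def)
  from assms(2) have "aks_act u (p - q) F (c, \<tau>) = 0"
  proof cases
    case (quadratic i)
    have "aks_act u (fT i * fT i + fT i) F (c, \<tau>) = 0"
      by (simp add: aks_act_simps curry colored_op_quadratic)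
    then show ?thesis using quadratic by (simp add: distrib_left)
  next
    case (braid i)
    then show ?thesis using colored_op_braid[of i "curry F" c \<tau>]
      by (simp add: aks_act_simps curry)
  next
    case (T_comm i j)
    then show ?thesis using colored_op_commute[of i j "curry F" c \<tau>] colored_op_commute[of j i "curry F" c \<tau>]
      by (auto simp: aks_act_simps curry)
  next
    case (Xi_poly j)
    let ?f = "\<lambda>l. fXi j - fconst (u l)"
    have "aks_act u (prod_list (map ?f [1..<Suc r])) F (c, \<tau>) =
      (\<Prod>p\<leftarrow>map ?f [1..<Suc r]. aks_act u p (\<lambda>_. 1) (c, \<tau>)) * F (c, \<tau>)"
      by (rule aks.act_prod_list_diagonal) (auto simp: aks_act_simps algebra_simps)
    also have "map (\<lambda>p. aks_act u p (\<lambda>_. 1) (c, \<tau>)) (map ?f [1..<Suc r]) = map (\<lambda>l. u (c j) - u l) [1..<Suc r]"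
      by (simp add: aks_act_simps)
    also have "prod_list (map (\<lambda>l. u (c j) - u l) [1..<Suc r]) = 0"
      using c[of j] by (subst prod_list_zero_iff) (force simp: image_iff)
    finally show ?thesis using Xi_poly by simp
  next
    case (Xi_comm i j)
    then show ?thesis by (simp add: aks_act_simps)
  next
    case (T_Xi i)
    let ?I = "{(a, b). 1 \<le> a \<and> a < b \<and> b \<le> r}"
    have "finite ?I" by (rule finite_subset[of _ "{1..r} \<times> {1..r}"]) auto
    \<comment> \<open>At the point \<open>(c, \<tau>)\<close> the Lagrange factors are projections,
      so only the pair \<open>(c i, c (Suc i))\<close> can survive, and it is in the index set
      exactly if \<open>c i < c (Suc i)\<close>.\<close>
    have "aks_act u (\<Sum>(a, b)\<in>?I. fconst (u b - u a) * lagr r u a (fXi i) * lagr r u b (fXi (Suc i))) F (c, \<tau>)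
        = (\<Sum>(a, b)\<in>?I. if (a, b) = (c i, c (Suc i)) then (u b - u a) * F (c, \<tau>) else 0)"
      unfolding act_sum using assms(1) c
      by (intro sum.cong) (auto simp: aks_act_simps aks_act_lagr)
    also have "\<dots> = (\<Sum>p\<in>?I. if p = (c i, c (Suc i)) then (u (snd p) - u (fst p)) * F (c, \<tau>) else 0)"
      by (intro sum.cong refl) (simp add: case_prod_unfold prod_eq_iff)
    also have "\<dots> = (if c i < c (Suc i) then (u (c (Suc i)) - u (c i)) * F (c, \<tau>) else 0)"
      using \<open>finite ?I\<close> c[of i] c[of "Suc i"] by (subst sum.delta) auto
    finally show ?thesis using T_Xi
      by (simp add: aks_act_simps colored_op_def hecke_op_def curry_def algebra_simps)
  next
    case (T_Xi_sum i)
    then show ?thesis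
      by (simp add: aks_act_simps colored_op_def hecke_op_def curry_def algebra_simps)
  next
    case (T_Xi_comm i j)
    then show ?thesis
      by (simp add: aks_act_simps colored_op_def hecke_op_def curry_def algebra_simps)
  qed
  thus ?thesis by (simp only: x)
qed

section \<open>The defining ideal and its action\<close>

lemma mem_lagr: "x \<in> carrier (free_alg_on G) \<Longrightarrow> lagr r u k x \<in> carrier (free_alg_on G)"
  unfolding lagr_def by (auto intro!: mem_free_alg_on_intros)

lemma mem_fT: "i \<in> {1..<n} \<Longrightarrow> fT i \<in> carrier (free_alg_on (aks_gens n))"
  and mem_fXi: "j \<in> {1..n} \<Longrightarrow> fXi j \<in> carrier (free_alg_on (aks_gens n))"
  by (auto simp: aks_gens_def intro!: mem_free_alg_on_gen)

lemma aks_relations_carrier: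
  assumes "(p, q) \<in> aks_relations n r u"
  shows "p - q \<in> carrier (free_alg_on (aks_gens n))"
  using assms
proof cases
  case (T_Xi i)
  have "fT i \<in> carrier (free_alg_on (aks_gens n))" "fXi i \<in> carrier (free_alg_on (aks_gens n))"
    "fXi (i + 1) \<in> carrier (free_alg_on (aks_gens n))"
    using T_Xi by (auto intro!: mem_fT mem_fXi)
  then show ?thesis unfolding T_Xi
    by (auto intro!: mem_free_alg_on_intros mem_lagr)
qed (auto intro!: mem_free_alg_on_diff mem_free_alg_on_mult mem_free_alg_on_add mem_free_alg_on_const
      mem_free_alg_on_0 mem_free_alg_on_1 mem_free_alg_on_prod_list mem_fT mem_fXi)

lemma aks_relations_subset:
  "{p - q | p q. (p, q) \<in> aks_relations n r u} \<subseteq> carrier (free_alg_on (aks_gens n))"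
  using aks_relations_carrier by blast

lemma ideal_aks: "ideal (aks_ideal n r u) (free_alg_on (aks_gens n))"
  unfolding aks_ideal_def
  by (rule ring.genideal_ideal[OF ring_free_alg_on aks_relations_subset])

lemma aks_relation_in_ideal: "(p, q) \<in> aks_relations n r u \<Longrightarrow> p - q \<in> aks_ideal n r u"
  using ring.genideal_self[OF ring_free_alg_on aks_relations_subset[of n r u]]
  unfolding aks_ideal_def by blast

lemma aks_act_ideal:
  assumes "inj_on u {1..r}" "p \<in> aks_ideal n r u" "x \<in> colored_points r"
  shows "aks_act u p F x = 0"
proof -
  let ?K = "{p \<in> carrier (free_alg_on (aks_gens n)). \<forall>F. \<forall>x\<in>colored_points r. aks_act u p F x = 0}"
  have "ideal ?K (free_alg_on (aks_gens n))"
  proof (rule aks.ideal_annihilator)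
    fix g and F :: "(nat \<Rightarrow> nat) \<times> (nat \<Rightarrow> nat) \<Rightarrow> complex" and x
    assume F: "\<And>y. y \<in> colored_points r \<Longrightarrow> F y = 0" and x: "x \<in> colored_points r"
    obtain c \<tau> where c: "x = (c, \<tau>)" by (cases x)
    have "(c, \<tau>') \<in> colored_points r" "(c \<circ> adj i, \<tau>') \<in> colored_points r" for i \<tau>'
      using x by (auto simp: c colored_points_def)
    thus "aks_action u g F x = 0"
      by (cases g) (simp_all add: c F colored_op_def hecke_op_def)
  qed
  moreover have "{p - q | p q. (p, q) \<in> aks_relations n r u} \<subseteq> ?K"
    using aks_act_relation[OF assms(1)] aks_relations_carrier by blast
  ultimately have "aks_ideal n r u \<subseteq> ?K"
    unfolding aks_ideal_def by (rule ring.genideal_minimal[OF ring_free_alg_on])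
  thus ?thesis using assms by blast
qed

text \<open>The image of 1, which is the sum of all \<open>L\<^sub>c\<close>. It does not depend on
  the color word, and on such functions the color correction in \<open>colored_op\<close> cancels,
  so that \<open>T\<^sub>i\<close> acts by \<open>hecke_op\<close> alone.\<close>

definition vacuum :: "(nat \<Rightarrow> nat) \<times> (nat \<Rightarrow> nat) \<Rightarrow> complex" where
  "vacuum = (\<lambda>(c, \<tau>). if \<tau> = id then 1 else 0)"

lemma aks_act_T_colorless:
  "aks_act u (fT i) (\<lambda>(c, \<tau>). f \<tau>) = (\<lambda>(c, \<tau>). hecke_op i f \<tau>)"
  by (auto simp: aks_act_gen colored_op_def curry_def)

lemma hecke_op_delta:
  assumes "\<tau>0 i < \<tau>0 (Suc i)"
  shows "hecke_op i (\<lambda>\<tau>. if \<tau> = \<tau>0 then 1 else 0) = (\<lambda>\<tau>. if \<tau> = \<tau>0 \<circ> adj i then 1 else 0)"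
proof
  fix \<tau> :: "nat \<Rightarrow> nat"
  have "\<tau> \<circ> adj i = \<tau>0 \<longleftrightarrow> \<tau> = \<tau>0 \<circ> adj i" by (metis adj_adj)
  moreover have "(\<tau>0 \<circ> adj i) i \<noteq> \<tau>0 i" using assms by simp
  hence "\<tau>0 \<noteq> \<tau>0 \<circ> adj i" by metis
  ultimately show "hecke_op i (\<lambda>\<tau>. if \<tau> = \<tau>0 then 1 else 0) \<tau> = (if \<tau> = \<tau>0 \<circ> adj i then 1 else 0)"
    using assms by (auto simp: hecke_op_def)
qed

lemma aks_act_reduced_word:
  assumes "reduced n w"
  shows "aks_act u (\<Prod>i\<leftarrow>w. fT i) vacuum = (\<lambda>(c, \<tau>). if \<tau> = pos_of_word w then 1 else 0)"
  using assms
proof (induction w)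
  case Nil
  then show ?case unfolding pos_of_word_Nil vacuum_def by (simp only: list.map prod_list.Nil act_1)
next
  case (Cons i w)
  then have "aks_act u (\<Prod>i\<leftarrow>i # w. fT i) vacuum =
      aks_act u (fT i) (\<lambda>(c, \<tau>). if \<tau> = pos_of_word w then 1 else 0)"
    by (simp add: aks.act_mult reduced_Cons_iff)
  also have "\<dots> = (\<lambda>(c, \<tau>). if \<tau> = pos_of_word (i # w) then 1 else 0)"
    using Cons.prems unfolding aks_act_T_colorless pos_of_word_Cons
    by (subst hecke_op_delta) (simp_all add: reduced_Cons_iff)
  finally show ?case .
qed

definition perm_word :: "nat \<Rightarrow> (nat \<Rightarrow> nat) \<Rightarrow> nat list" where
  "perm_word n \<sigma> = (SOME w. reduced_word n \<sigma> w)"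

lemma
  assumes "\<sigma> permutes {1..n}"
  shows reduced_perm_word: "reduced n (perm_word n \<sigma>)"
    and pos_of_perm_word: "pos_of_word (perm_word n \<sigma>) = perm_inv \<sigma>"
proof -
  have "reduced_word n \<sigma> (perm_word n \<sigma>)"
    unfolding perm_word_def by (rule someI_ex[OF reduced_word_exists[OF assms]])
  thus "reduced n (perm_word n \<sigma>)" "pos_of_word (perm_word n \<sigma>) = perm_inv \<sigma>"
    unfolding reduced_word_iff pos_of_word_def by simp_all
qed

definition hecke_elem :: "nat \<Rightarrow> ((nat \<Rightarrow> nat) \<Rightarrow> complex) \<Rightarrow> aks_free" where
  "hecke_elem n a = (\<Sum>\<sigma>\<in>{\<sigma>. \<sigma> permutes {1..n}}. fconst (a \<sigma>) * (\<Prod>i\<leftarrow>perm_word n \<sigma>. fT i))"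

text \<open>The coefficients can be read off from the action. As the ideal acts by zero on
  \<open>colored_points\<close>, this gives the linear independence of the
  \<open>T\<^sub>\<sigma>\<close> in the quotient.\<close>

lemma aks_act_hecke_elem:
  "aks_act u (hecke_elem n a) vacuum = (\<lambda>(c, \<tau>). if \<tau> permutes {1..n} then a (perm_inv \<tau>) else 0)"
proof (intro ext, clarify)
  fix c \<tau>
  let ?S = "{\<sigma>. \<sigma> permutes {1..n}}"
  have eq: "\<tau> = perm_inv \<sigma> \<longleftrightarrow> \<tau> permutes {1..n} \<and> \<sigma> = perm_inv \<tau>" if "\<sigma> \<in> ?S" for \<sigma>
    using that permutes_inv_inv[of \<sigma> "{1..n}"] permutes_inv_inv[of \<tau> "{1..n}"] permutes_inv[of \<sigma> "{1..n}"]
    by auto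
  have "aks_act u (hecke_elem n a) vacuum (c, \<tau>) =
      (\<Sum>\<sigma>\<in>?S. if \<tau> permutes {1..n} \<and> \<sigma> = perm_inv \<tau> then a \<sigma> else 0)"
    unfolding hecke_elem_def act_sum
    by (intro sum.cong) (auto simp: aks.act_mult act_const aks_act_reduced_word[OF reduced_perm_word] pos_of_perm_word eq)
  also have "\<dots> = (if \<tau> permutes {1..n} then a (perm_inv \<tau>) else 0)"
    using permutes_inv[of \<tau> "{1..n}"] finite_permutations[of "{1..n}"]
    by (cases "\<tau> permutes {1..n}") (simp_all add: sum.delta)
  finally show "aks_act u (hecke_elem n a) vacuum (c, \<tau>) = (if \<tau> permutes {1..n} then a (perm_inv \<tau>) else 0)" .
qed

text \<open>The color word is a function here, so that an exchange of colors is the composition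
  \<open>d \<circ> adj i\<close>.\<close>

definition color_elem :: "nat \<Rightarrow> nat \<Rightarrow> (nat \<Rightarrow> complex) \<Rightarrow> (nat \<Rightarrow> nat) \<Rightarrow> aks_free" where
  "color_elem n r u d = (\<Prod>j\<leftarrow>[1..<Suc n]. lagr r u (d j) (fXi j))"

lemma color_elem_hecke_elem_notin_ideal:
  assumes "inj_on u {1..r}" "1 \<le> r" "\<And>j. j \<in> {1..n} \<Longrightarrow> d j \<in> {1..r}" "\<sigma> permutes {1..n}" "a \<sigma> \<noteq> 0"
  shows "color_elem n r u d * hecke_elem n a \<notin> aks_ideal n r u"
proof
  assume I: "color_elem n r u d * hecke_elem n a \<in> aks_ideal n r u"
  \<comment> \<open>Beyond position \<open>n\<close> the color 1 is filled in, to obtain a point of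
    \<open>colored_points\<close>.\<close>
  define e where "e = (\<lambda>j. if j \<in> {1..n} then d j else 1)"
  have e: "e j \<in> {1..r}" for j using assms(2,3) by (auto simp: e_def)
  hence "(e, perm_inv \<sigma>) \<in> colored_points r" by (auto simp: colored_points_def)
  have "aks_act u (color_elem n r u d) F (e, \<tau>) = F (e, \<tau>)" for F \<tau>
  proof -
    have "aks_act u (color_elem n r u d) F (e, \<tau>) =
       prod_list (map (\<lambda>_. 1) (map (\<lambda>j. lagr r u (d j) (fXi j)) [1..<Suc n])) * F (e, \<tau>)"
      unfolding color_elem_def
    proof (rule aks.act_prod_list_diagonal)
      fix p F assume "p \<in> set (map (\<lambda>j. lagr r u (d j) (fXi j)) [1..<Suc n])"
      then obtain j where j: "j \<in> {1..n}" "p = lagr r u (d j) (fXi j)"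
        unfolding set_map set_upt_Suc by blast
      have "aks_act u p F (e, \<tau>) = (if e j = d j then F (e, \<tau>) else 0)"
        unfolding j(2) by (rule aks_act_lagr[where c = e and j = j, OF assms(1) assms(3)[OF j(1)] e])
      thus "aks_act u p F (e, \<tau>) = 1 * F (e, \<tau>)" using j(1) by (simp add: e_def)
    qed
    also have "prod_list (map (\<lambda>_. 1) (map (\<lambda>j. lagr r u (d j) (fXi j)) [1..<Suc n])) = (1::complex)"
      by (intro prod_list_eq_1) auto
    finally show ?thesis by simp
  qed
  hence "aks_act u (color_elem n r u d * hecke_elem n a) vacuum (e, perm_inv \<sigma>) = a \<sigma>"
    using permutes_inv[OF assms(4)] permutes_inv_inv[OF assms(4)]
    by (simp add: aks.act_mult aks_act_hecke_elem)
  thus False using aks_act_ideal[OF assms(1) I \<open>_ \<in> colored_points r\<close>] assms(5) by simp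
qed

section \<open>Weight spaces modulo a left ideal\<close>

text \<open>Evaluating ordinary polynomials at one element of the free algebra transfers the
  identities between Lagrange polynomials from the commutative polynomial ring.\<close>

definition peval :: "complex poly \<Rightarrow> 'g free_alg \<Rightarrow> 'g free_alg" where
  "peval p x = fold_coeffs (\<lambda>a q. fconst a + x * q) p 0"

lemma peval_0 [simp]: "peval 0 x = 0"
  by (simp add: peval_def)

lemma peval_pCons: "peval (pCons a p) x = fconst a + x * peval p x"
proof (cases "p = 0")
  case True
  then show ?thesis by (cases "a = 0") (simp_all add: peval_def)
qed (simp add: peval_def)

lemma peval_1 [simp]: "peval 1 x = 1"
  by (simp add: one_pCons peval_pCons)

lemma peval_add: "peval (p + q) x = peval p x + peval q x"
  by (induction p q rule: poly_induct2) (simp_all add: peval_pCons fconst_add algebra_simps)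

lemma peval_smult: "peval (Polynomial.smult a p) x = fconst a * peval p x"
proof (induction p)
  case (pCons b p)
  have "x * (fconst a * peval p x) = fconst a * (x * peval p x)"
    by (rule fconst_left_commute)
  then show ?case using pCons by (simp add: peval_pCons fconst_mult distrib_left)
qed simp

lemma peval_mult: "peval (p * q) x = peval p x * peval q x"
  by (induction p) (simp_all add: peval_pCons peval_add peval_smult distrib_right mult.assoc)

lemma peval_prod_list: "peval (prod_list ps) x = (\<Prod>p\<leftarrow>ps. peval p x)"
  by (induction ps) (simp_all add: peval_mult)

lemma peval_sum: "peval (sum f I) x = (\<Sum>i\<in>I. peval (f i) x)"
  by (induction I rule: infinite_finite_induct) (simp_all add: peval_add)

lemma peval_linear: "peval [:- a, 1:] x = x - fconst a"
  by (simp add: peval_pCons fconst_minus)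

lemma mem_peval: "x \<in> carrier (free_alg_on G) \<Longrightarrow> peval p x \<in> carrier (free_alg_on G)"
  by (induction p) (auto simp: peval_pCons intro!: mem_free_alg_on_intros)

definition lagrange_poly :: "nat \<Rightarrow> (nat \<Rightarrow> complex) \<Rightarrow> nat \<Rightarrow> complex poly" where
  "lagrange_poly r u k = (\<Prod>l\<leftarrow>filter (\<lambda>l. l \<noteq> k) [1..<Suc r]. Polynomial.smult (1 / (u k - u l)) [:- u l, 1:])"

lemma lagr_eq_peval: "lagr r u k x = peval (lagrange_poly r u k) x"
  by (simp only: lagr_def lagrange_poly_def peval_prod_list list.map_comp o_def peval_smult peval_linear)

lemma lagrange_poly_eq_prod:
  "lagrange_poly r u k = (\<Prod>l\<in>{1..r} - {k}. Polynomial.smult (1 / (u k - u l)) [:- u l, 1:])"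
proof -
  have "set (filter (\<lambda>l. l \<noteq> k) [1..<Suc r]) = {1..r} - {k}" by auto
  moreover have "distinct (filter (\<lambda>l. l \<noteq> k) [1..<Suc r])" by simp
  ultimately show ?thesis
    using prod.distinct_set_conv_list[of "filter (\<lambda>l. l \<noteq> k) [1..<Suc r]" "\<lambda>l. Polynomial.smult (1 / (u k - u l)) [:- u l, 1:]"]
    by (simp only: lagrange_poly_def)
qed

lemma poly_lagrange:
  assumes "inj_on u {1..r}" "a \<in> {1..r}" "k \<in> {1..r}"
  shows "poly (lagrange_poly r u k) (u a) = (if a = k then 1 else 0)"
proof -
  have "poly (prod_list ps) z = (\<Prod>p\<leftarrow>ps. poly p z)" for ps and z :: complex
    by (induction ps) simp_all
  hence "poly (lagrange_poly r u k) (u a) =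
      (\<Prod>l\<leftarrow>filter (\<lambda>l. l \<noteq> k) [1..<Suc r]. (u a - u l) / (u k - u l))"
    unfolding lagrange_poly_def by (simp add: o_def diff_divide_distrib del: upt_Suc)
  thus ?thesis using lagrange_value[OF assms] by simp
qed

lemma degree_lagrange:
  assumes "k \<in> {1..r}"
  shows "degree (lagrange_poly r u k) < r"
proof -
  have "degree (lagrange_poly r u k) \<le> (\<Sum>l\<in>{1..r} - {k}. degree (Polynomial.smult (1 / (u k - u l)) [:- u l, 1:]))"
    unfolding lagrange_poly_eq_prod by (rule degree_prod_sum_le[unfolded o_def]) simp
  also have "\<dots> \<le> (\<Sum>l\<in>{1..r} - {k}. 1)"
    by (intro sum_mono) (simp add: degree_smult_le)
  also have "\<dots> < r" using assms by (auto simp: card_Diff_singleton)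
  finally show ?thesis .
qed

text \<open>The difference of the two sides has degree below \<open>r\<close> and the
  \<open>r\<close> distinct roots \<open>u a\<close>.\<close>

lemma sum_lagrange:
  assumes "inj_on u {1..r}" "1 \<le> r"
  shows "(\<Sum>k\<in>{1..r}. lagrange_poly r u k) = 1"
proof (rule ccontr)
  define q where "q = (\<Sum>k\<in>{1..r}. lagrange_poly r u k) - 1"
  assume "\<not> ?thesis"
  hence q: "q \<noteq> 0" by (simp add: q_def)
  have "poly q (u a) = 0" if "a \<in> {1..r}" for a
  proof -
    have "(\<Sum>k\<in>{1..r}. poly (lagrange_poly r u k) (u a)) = (\<Sum>k\<in>{1..r}. if a = k then 1 else 0)"
      by (intro sum.cong) (use poly_lagrange[OF assms(1) that] in auto)
    thus ?thesis using that by (simp add: q_def poly_sum)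
  qed
  hence "u ` {1..r} \<subseteq> {x. poly q x = 0}" by auto
  hence "card (u ` {1..r}) \<le> degree q"
    using card_mono[OF poly_roots_finite[OF q]] card_poly_roots_bound[OF q] by (meson le_trans)
  moreover have "degree (\<Sum>k\<in>{1..r}. lagrange_poly r u k) < r"
    by (rule degree_sum_less) (use degree_lagrange assms(2) in auto)
  hence "degree q < r"
    unfolding q_def using assms(2) by (intro degree_diff_less) auto
  ultimately show False using card_image[OF assms(1)] by simp
qed

text \<open>The right-hand side is a multiple of the defining relation of
  \<open>\<xi>\<^sub>j\<close>; so \<open>P\<^sub>k(\<xi>\<^sub>j)\<close> maps into the eigenspace
  of \<open>u k\<close>.\<close>

lemma lagrange_annihilated:
  assumes "k \<in> {1..r}"
  shows "\<exists>z. [:- u k, 1:] * lagrange_poly r u k = Polynomial.smult z (\<Prod>l\<leftarrow>[1..<Suc r]. [:- u l, 1:])"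
proof
  have "(\<Prod>l\<leftarrow>[1..<Suc r]. [:- u l, 1:]) = (\<Prod>l\<in>{1..r}. [:- u l, 1:])"
    using prod.distinct_set_conv_list[of "[1..<Suc r]" "\<lambda>l. [:- u l, 1:]"] by (simp only: set_upt_Suc distinct_upt)
  also have "\<dots> = [:- u k, 1:] * (\<Prod>l\<in>{1..r} - {k}. [:- u l, 1:])"
    using assms by (simp add: prod.remove)
  finally show "[:- u k, 1:] * lagrange_poly r u k =
      Polynomial.smult (\<Prod>l\<in>{1..r} - {k}. 1 / (u k - u l)) (\<Prod>l\<leftarrow>[1..<Suc r]. [:- u l, 1:])"
    unfolding lagrange_poly_eq_prod prod_smult by (simp only: mult_smult_right)
qed

text \<open>Extensional functions, so that each color word of length \<open>n\<close> is represented
  once, the set is finite, and equality can be tested on \<open>{1..n}\<close>.\<close>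

definition colorings :: "nat \<Rightarrow> nat \<Rightarrow> (nat \<Rightarrow> nat) set" where
  "colorings n r = {1..n} \<rightarrow>\<^sub>E {1..r}"

lemma finite_colorings: "finite (colorings n r)"
  by (simp add: colorings_def finite_PiE)

lemma colorings_range: "\<lbrakk>d \<in> colorings n r; j \<in> {1..n}\<rbrakk> \<Longrightarrow> d j \<in> {1..r}"
  by (auto simp: colorings_def)

lemma colorings_comp_adj:
  assumes "d \<in> colorings n r" "i \<in> {1..<n}"
  shows "d \<circ> adj i \<in> colorings n r"
  using assms permutes_in_image[OF adj_permutes[OF assms(2)]]
  by (auto simp: colorings_def PiE_iff extensional_def)

lemma colorings_eqI: "\<lbrakk>d \<in> colorings n r; e \<in> colorings n r; \<And>j. j \<in> {1..n} \<Longrightarrow> d j = e j\<rbrakk> \<Longrightarrow> d = e"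
  unfolding colorings_def by (rule PiE_ext)

text \<open>The identity holds in the free algebra itself: the sum is the product over the positions
  \<open>j\<close> of the sums of \<open>P\<^sub>k(\<xi>\<^sub>j)\<close> over all colors
  \<open>k\<close>, each equal to 1. The induction splits off the last position.\<close>

lemma sum_color_elem:
  assumes "inj_on u {1..r}" "1 \<le> r"
  shows "(\<Sum>d\<in>colorings n r. color_elem n r u d) = 1"
proof (induction n)
  case 0
  then show ?case by (simp add: colorings_def color_elem_def)
next
  case (Suc n)
  let ?h = "\<lambda>(k, d). d(Suc n := k)"
  have n: "Suc n \<notin> {1..n}" by simp
  have col: "colorings (Suc n) r = ?h ` ({1..r} \<times> colorings n r)"
  proof -
    have "{1..Suc n} = insert (Suc n) {1..n}" by auto
    thus ?thesis unfolding colorings_def by (simp only: PiE_insert_eq)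
  qed
  have inj: "inj_on ?h ({1..r} \<times> colorings n r)"
    unfolding colorings_def by (rule inj_combinator[OF n])
  have el: "color_elem (Suc n) r u (d(Suc n := k)) = color_elem n r u d * lagr r u k (fXi (Suc n))" for d k
  proof -
    have "map (\<lambda>j. lagr r u ((d(Suc n := k)) j) (fXi j)) [1..<Suc n] = map (\<lambda>j. lagr r u (d j) (fXi j)) [1..<Suc n]"
      by (intro map_cong) auto
    moreover have "[1..<Suc (Suc n)] = [1..<Suc n] @ [Suc n]" by simp
    ultimately show ?thesis
      unfolding color_elem_def by (simp only: map_append prod_list.append) simp
  qed
  have "(\<Sum>d\<in>colorings (Suc n) r. color_elem (Suc n) r u d) =
      (\<Sum>(k, d)\<in>{1..r} \<times> colorings n r. color_elem n r u d * lagr r u k (fXi (Suc n)))"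
    unfolding col by (subst sum.reindex[OF inj]) (simp add: el case_prod_unfold o_def)
  also have "\<dots> = (\<Sum>k\<in>{1..r}. \<Sum>d\<in>colorings n r. color_elem n r u d * lagr r u k (fXi (Suc n)))"
    by (rule sum.cartesian_product[symmetric])
  also have "\<dots> = (\<Sum>k\<in>{1..r}. lagr r u k (fXi (Suc n)))"
    by (simp add: sum_distrib_right[symmetric] Suc.IH)
  also have "\<dots> = peval (\<Sum>k\<in>{1..r}. lagrange_poly r u k) (fXi (Suc n))"
    by (simp add: peval_sum lagr_eq_peval)
  finally show ?case using sum_lagrange[OF assms] by simp
qed

lemma mem_color_elem: "color_elem n r u d \<in> carrier (free_alg_on (aks_gens n))"
  unfolding color_elem_def
  by (rule mem_free_alg_on_prod_list) (auto intro!: mem_lagr mem_fXi)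

lemma mem_T_word: "set w \<subseteq> {1..<n} \<Longrightarrow> (\<Prod>i\<leftarrow>w. fT i) \<in> carrier (free_alg_on (aks_gens n))"
  by (rule mem_free_alg_on_prod_list) (auto intro!: mem_fT)

section \<open>Congruence modulo a left ideal\<close>

abbreviation "aks_carrier n \<equiv> carrier (free_alg_on (aks_gens n))"

lemma aks_ideal_add: "\<lbrakk>p \<in> aks_ideal n r u; q \<in> aks_ideal n r u\<rbrakk> \<Longrightarrow> p + q \<in> aks_ideal n r u"
  using additive_subgroup.a_closed[OF ideal.axioms(1)[OF ideal_aks[of n r u]], of p q] by simp

lemma aks_ideal_0: "0 \<in> aks_ideal n r u"
  using additive_subgroup.zero_closed[OF ideal.axioms(1)[OF ideal_aks[of n r u]]] by simp

lemma aks_ideal_l: "\<lbrakk>p \<in> aks_carrier n; q \<in> aks_ideal n r u\<rbrakk> \<Longrightarrow> p * q \<in> aks_ideal n r u"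
  using ideal.I_l_closed[OF ideal_aks[of n r u], of q p] by simp

lemma aks_ideal_r: "\<lbrakk>p \<in> aks_ideal n r u; q \<in> aks_carrier n\<rbrakk> \<Longrightarrow> p * q \<in> aks_ideal n r u"
  using ideal.I_r_closed[OF ideal_aks[of n r u], of p q] by simp

lemma aks_ideal_carrier: "p \<in> aks_ideal n r u \<Longrightarrow> p \<in> aks_carrier n"
  using additive_subgroup.a_subset[OF ideal.axioms(1)[OF ideal_aks[of n r u]]] by blast

text \<open>The multiple of \<open>z\<close> that has to be added to \<open>T\<^sub>i z\<close> to
  obtain a vector with exchanged weight, see \<open>weight_T\<close>.\<close>

definition asc :: "(nat \<Rightarrow> nat) \<Rightarrow> nat \<Rightarrow> complex" where
  "asc d i = (if d i < d (Suc i) then 1 else 0)"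

text \<open>Two instances matter: the defining ideal itself, for computations in the algebra, and
  the annihilator of a vector \<open>x\<close> of a module, for which \<open>p \<approx> q\<close>
  means that \<open>p\<close> and \<open>q\<close> agree on \<open>x\<close> and
  \<open>1 \<notin> K\<close> means that \<open>x\<close> is nonzero.\<close>

locale aks_left_ideal =
  fixes n r :: nat and u :: "nat \<Rightarrow> complex" and K :: "aks_free set"
  assumes inj_u: "inj_on u {1..r}" and r_pos: "1 \<le> r"
    and K_add: "\<lbrakk>p \<in> K; q \<in> K\<rbrakk> \<Longrightarrow> p + q \<in> K"
    and K_mult: "\<lbrakk>p \<in> aks_carrier n; q \<in> K\<rbrakk> \<Longrightarrow> p * q \<in> K"
    and ideal_sub: "aks_ideal n r u \<subseteq> K"
begin

lemma K_0: "0 \<in> K"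
  using ideal_sub aks_ideal_0 by blast

lemma K_const: "q \<in> K \<Longrightarrow> fconst z * q \<in> K"
  by (intro K_mult mem_free_alg_on_const)

lemma K_uminus: "p \<in> K \<Longrightarrow> - p \<in> K"
  using K_const[of p "- 1"] by (simp add: fconst_minus)

lemma K_diff: "\<lbrakk>p \<in> K; q \<in> K\<rbrakk> \<Longrightarrow> p - q \<in> K"
  using K_add[of p "- q"] K_uminus[of q] by simp

lemma K_sum: "(\<And>i. i \<in> I \<Longrightarrow> f i \<in> K) \<Longrightarrow> sum f I \<in> K"
  by (induction I rule: infinite_finite_induct) (auto simp: K_0 K_add)

definition eqK :: "aks_free \<Rightarrow> aks_free \<Rightarrow> bool" (infix "\<approx>" 50) where
  "p \<approx> q \<longleftrightarrow> p - q \<in> K"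

lemma eqK_refl [simp]: "p \<approx> p"
  by (simp add: eqK_def K_0)

lemma eqK_sym: "p \<approx> q \<Longrightarrow> q \<approx> p"
  using K_uminus[of "p - q"] by (simp add: eqK_def)

lemma eqK_trans [trans]: "\<lbrakk>p \<approx> q; q \<approx> s\<rbrakk> \<Longrightarrow> p \<approx> s"
  using K_add[of "p - q" "q - s"] by (simp add: eqK_def)

lemma eqK_add: "\<lbrakk>p \<approx> p'; q \<approx> q'\<rbrakk> \<Longrightarrow> p + q \<approx> p' + q'"
  using K_add[of "p - p'" "q - q'"] by (simp add: eqK_def algebra_simps)

lemma eqK_diff: "\<lbrakk>p \<approx> p'; q \<approx> q'\<rbrakk> \<Longrightarrow> p - q \<approx> p' - q'"
  using K_diff[of "p - p'" "q - q'"] by (simp add: eqK_def algebra_simps)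

lemma eqK_mult: "\<lbrakk>f \<in> aks_carrier n; p \<approx> q\<rbrakk> \<Longrightarrow> f * p \<approx> f * q"
  using K_mult[of f "p - q"] by (simp add: eqK_def algebra_simps)

lemma eqK_const: "p \<approx> q \<Longrightarrow> fconst z * p \<approx> fconst z * q"
  by (intro eqK_mult mem_free_alg_on_const)

lemma eqK_sum: "(\<And>i. i \<in> I \<Longrightarrow> f i \<approx> g i) \<Longrightarrow> sum f I \<approx> sum g I"
  using K_sum[of I "\<lambda>i. f i - g i"] by (simp add: eqK_def sum_subtractf)

lemma eqK_0_iff: "p \<approx> 0 \<longleftrightarrow> p \<in> K"
  by (simp add: eqK_def)

text \<open>\<open>K\<close> is a left ideal only; a relation may still be multiplied from the right
  because it lies in the two-sided ideal contained in \<open>K\<close>.\<close>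

lemma eqK_ideal: "\<lbrakk>p - q \<in> aks_ideal n r u; f \<in> aks_carrier n\<rbrakk> \<Longrightarrow> p * f \<approx> q * f"
  using aks_ideal_r[of "p - q" n r u f] ideal_sub by (auto simp: eqK_def algebra_simps)

lemma eqK_relation: "\<lbrakk>(p, q) \<in> aks_relations n r u; f \<in> aks_carrier n\<rbrakk> \<Longrightarrow> p * f \<approx> q * f"
  by (intro eqK_ideal aks_relation_in_ideal)

lemma Xi_commute:
  assumes "i \<in> {1..n}" "j \<in> {1..n}" "f \<in> aks_carrier n"
  shows "fXi i * (fXi j * f) \<approx> fXi j * (fXi i * f)"
  using eqK_relation[OF aks_relations.Xi_comm[OF assms(1,2)] assms(3)] by (simp add: mult.assoc)

lemma peval_eigenvector:
  assumes "z \<in> aks_carrier n" "j \<in> {1..n}" "fXi j * z \<approx> fconst l * z"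
  shows "peval p (fXi j) * z \<approx> fconst (poly p l) * z"
proof (induction p)
  case (pCons a p)
  have "fXi j * (peval p (fXi j) * z) \<approx> fXi j * (fconst (poly p l) * z)"
    by (intro eqK_mult mem_fXi assms pCons)
  also have "\<dots> = fconst (poly p l) * (fXi j * z)"
    by (rule fconst_left_commute)
  also have "\<dots> \<approx> fconst (poly p l) * (fconst l * z)"
    by (intro eqK_const assms)
  finally have "fconst a * z + fXi j * (peval p (fXi j) * z) \<approx> fconst a * z + fconst (poly p l) * (fconst l * z)"
    by (intro eqK_add) auto
  then show ?case
    by (simp add: peval_pCons distrib_right fconst_add fconst_mult mult.assoc fconst_left_commute[of "fconst l"])
qed simp

lemma peval_commute:
  assumes "i \<in> {1..n}" "j \<in> {1..n}" "f \<in> aks_carrier n"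
  shows "fXi j * (peval p (fXi i) * f) \<approx> peval p (fXi i) * (fXi j * f)"
proof (induction p)
  case (pCons a p)
  have m: "peval p (fXi i) * f \<in> aks_carrier n"
    by (intro mem_free_alg_on_mult mem_peval mem_fXi assms)
  have "fXi j * (fXi i * (peval p (fXi i) * f)) \<approx> fXi i * (fXi j * (peval p (fXi i) * f))"
    by (intro Xi_commute assms m)
  also have "\<dots> \<approx> fXi i * (peval p (fXi i) * (fXi j * f))"
    by (intro eqK_mult mem_fXi assms pCons)
  finally have "fconst a * (fXi j * f) + fXi j * (fXi i * (peval p (fXi i) * f)) \<approx>
      fconst a * (fXi j * f) + fXi i * (peval p (fXi i) * (fXi j * f))"
    by (intro eqK_add) auto
  then show ?case
    by (simp add: peval_pCons distrib_right distrib_left mult.assoc fconst_left_commute[of "fXi j" a f])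
qed simp

lemma lagr_eigenvector:
  assumes "j \<in> {1..n}" "k \<in> {1..r}" "f \<in> aks_carrier n"
  shows "fXi j * (lagr r u k (fXi j) * f) \<approx> fconst (u k) * (lagr r u k (fXi j) * f)"
proof -
  obtain z where z: "[:- u k, 1:] * lagrange_poly r u k = Polynomial.smult z (\<Prod>l\<leftarrow>[1..<Suc r]. [:- u l, 1:])"
    using lagrange_annihilated[OF assms(2)] by blast
  have "(fXi j - fconst (u k)) * lagr r u k (fXi j) = peval ([:- u k, 1:] * lagrange_poly r u k) (fXi j)"
    by (simp only: peval_mult peval_linear lagr_eq_peval)
  also have "\<dots> = fconst z * (\<Prod>l\<leftarrow>[1..<Suc r]. fXi j - fconst (u l))"
    unfolding z by (simp only: peval_smult peval_prod_list list.map_comp o_def peval_linear)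
  finally have "(fXi j - fconst (u k)) * lagr r u k (fXi j) * f = fconst z * ((\<Prod>l\<leftarrow>[1..<Suc r]. fXi j - fconst (u l)) * f)"
    by (simp only: mult.assoc)
  moreover have "(\<Prod>l\<leftarrow>[1..<Suc r]. fXi j - fconst (u l)) * f \<approx> 0 * f"
    by (intro eqK_relation aks_relations.Xi_poly assms)
  ultimately have "(fXi j - fconst (u k)) * lagr r u k (fXi j) * f \<in> K"
    using K_const by (simp add: eqK_0_iff)
  thus ?thesis by (simp add: eqK_def left_diff_distrib mult.assoc)
qed

section \<open>Weight vectors, and how \<open>T\<^sub>i\<close> moves them\<close>

definition weight :: "(nat \<Rightarrow> nat) \<Rightarrow> aks_free \<Rightarrow> bool" where
  "weight d z \<longleftrightarrow> z \<in> aks_carrier n \<and> (\<forall>j\<in>{1..n}. fXi j * z \<approx> fconst (u (d j)) * z)"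

text \<open>Each new factor of the product fixes the eigenvalue of its own \<xi> and, because the
  \<xi> commute, keeps those already fixed.\<close>

lemma weight_color_elem:
  assumes "d \<in> colorings n r" "z \<in> aks_carrier n"
  shows "weight d (color_elem n r u d * z)"
proof -
  have "(\<Prod>j\<leftarrow>js. lagr r u (d j) (fXi j)) * z \<in> aks_carrier n \<and>
      (\<forall>j\<in>set js. fXi j * ((\<Prod>j\<leftarrow>js. lagr r u (d j) (fXi j)) * z)
        \<approx> fconst (u (d j)) * ((\<Prod>j\<leftarrow>js. lagr r u (d j) (fXi j)) * z))"
    if "set js \<subseteq> {1..n}" for js
    using that
  proof (induction js)
    case Nil
    then show ?case using assms by simp
  next
    case (Cons i js)
    let ?w = "(\<Prod>j\<leftarrow>js. lagr r u (d j) (fXi j)) * z"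
    have w: "?w \<in> aks_carrier n" and IH: "\<And>j. j \<in> set js \<Longrightarrow> fXi j * ?w \<approx> fconst (u (d j)) * ?w"
      using Cons by auto
    have i: "i \<in> {1..n}" using Cons.prems by simp
    have mem: "lagr r u (d i) (fXi i) \<in> aks_carrier n" by (intro mem_lagr mem_fXi i)
    have "fXi j * (lagr r u (d i) (fXi i) * ?w) \<approx> fconst (u (d j)) * (lagr r u (d i) (fXi i) * ?w)"
      if j: "j \<in> set (i # js)" for j
    proof (cases "j = i")
      case True
      then show ?thesis
        using lagr_eigenvector[OF i colorings_range[OF assms(1) i] w] by simp
    next
      case False
      hence js: "j \<in> set js" using j by simp
      have "fXi j * (lagr r u (d i) (fXi i) * ?w) \<approx> lagr r u (d i) (fXi i) * (fXi j * ?w)"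
      proof -
      have "j \<in> {1..n}" using j Cons.prems by auto
      from peval_commute[OF i this w, of "lagrange_poly r u (d i)"] show ?thesis by (simp only: lagr_eq_peval)
    qed
      also have "\<dots> \<approx> lagr r u (d i) (fXi i) * (fconst (u (d j)) * ?w)"
        by (intro eqK_mult mem IH js)
      also have "\<dots> = fconst (u (d j)) * (lagr r u (d i) (fXi i) * ?w)"
        by (rule fconst_left_commute)
      finally show ?thesis .
    qed
    then show ?case using mem w by (simp add: mult.assoc mem_free_alg_on_mult)
  qed
  from this[of "[1..<Suc n]"] show ?thesis
    unfolding weight_def color_elem_def set_upt_Suc by blast
qed

lemma lagr_weight:
  assumes "weight d z" "d j \<in> {1..r}" "j \<in> {1..n}" "k \<in> {1..r}"
  shows "lagr r u k (fXi j) * z \<approx> (if d j = k then z else 0)"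
proof -
  have "lagr r u k (fXi j) * z \<approx> fconst (poly (lagrange_poly r u k) (u (d j))) * z"
    unfolding lagr_eq_peval using assms by (intro peval_eigenvector) (auto simp: weight_def)
  thus ?thesis using poly_lagrange[OF inj_u assms(2,4)] by (simp split: if_splits)
qed

text \<open>Together with \<open>weight_color_elem\<close> and \<open>sum_color_elem\<close> this
  makes the \<open>color_elem n r u d\<close> a complete system of projections onto the weight
  spaces.\<close>

lemma color_elem_weight:
  assumes "weight d z" "d \<in> colorings n r" "e \<in> colorings n r"
  shows "color_elem n r u e * z \<approx> (if d = e then z else 0)"
proof -
  have "(\<Prod>j\<leftarrow>js. lagr r u (e j) (fXi j)) * z \<approx> (if \<forall>j\<in>set js. d j = e j then z else 0)"
    if "set js \<subseteq> {1..n}" for js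
    using that
  proof (induction js)
    case (Cons i js)
    have i: "i \<in> {1..n}" using Cons.prems by simp
    let ?w = "if \<forall>j\<in>set js. d j = e j then z else 0"
    have "lagr r u (e i) (fXi i) * ((\<Prod>j\<leftarrow>js. lagr r u (e j) (fXi j)) * z) \<approx> lagr r u (e i) (fXi i) * ?w"
      by (intro eqK_mult mem_lagr mem_fXi i Cons) (use Cons.prems in auto)
    also have "\<dots> \<approx> (if d i = e i then ?w else 0)"
      using lagr_weight[OF assms(1) colorings_range[OF assms(2) i] i colorings_range[OF assms(3) i]]
      by (auto split: if_splits)
    also have "\<dots> = (if \<forall>j\<in>set (i # js). d j = e j then z else 0)" by simp
    finally show ?case by (simp add: mult.assoc)
  qed simp
  from this[of "[1..<Suc n]"]
  have "color_elem n r u e * z \<approx> (if \<forall>j\<in>{1..n}. d j = e j then z else 0)"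
    unfolding color_elem_def set_upt_Suc by blast
  moreover have "(\<forall>j\<in>{1..n}. d j = e j) \<longleftrightarrow> d = e"
    using colorings_eqI[OF assms(2,3)] by blast
  ultimately show ?thesis by simp
qed

text \<open>On a weight vector each Lagrange factor is 0 or 1, so at most the pair of the two
  neighbouring colors contributes, and only when these are strictly increasing.\<close>

lemma lagr_sum_weight:
  assumes "weight d z" "i \<in> {1..<n}" "d \<in> colorings n r"
  shows "(\<Sum>(a, b)\<in>{(a, b). 1 \<le> a \<and> a < b \<and> b \<le> r}.
      fconst (u b - u a) * lagr r u a (fXi i) * lagr r u b (fXi (i + 1))) * z
    \<approx> fconst (asc d i * (u (d (Suc i)) - u (d i))) * z"
proof -
  let ?I = "{(a, b). 1 \<le> a \<and> a < b \<and> b \<le> r}"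
  have fin: "finite ?I" by (rule finite_subset[of _ "{1..r} \<times> {1..r}"]) auto
  have i: "i \<in> {1..n}" "Suc i \<in> {1..n}" using assms(2) by auto
  have di: "d i \<in> {1..r}" "d (Suc i) \<in> {1..r}" using colorings_range[OF assms(3)] i by auto
  have "(\<Sum>p\<in>?I. fconst (u (snd p) - u (fst p)) * (lagr r u (fst p) (fXi i) * (lagr r u (snd p) (fXi (Suc i)) * z)))
      \<approx> (\<Sum>p\<in>?I. if p = (d i, d (Suc i)) then fconst (u (snd p) - u (fst p)) * z else 0)"
  proof (rule eqK_sum)
    fix p assume "p \<in> ?I"
    then obtain a b where p: "p = (a, b)" "a \<in> {1..r}" "b \<in> {1..r}" by auto
    have "lagr r u a (fXi i) * (lagr r u b (fXi (Suc i)) * z) \<approx> lagr r u a (fXi i) * (if d (Suc i) = b then z else 0)"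
      by (intro eqK_mult mem_lagr mem_fXi i lagr_weight assms di p)
    also have "\<dots> \<approx> (if d (Suc i) = b then if d i = a then z else 0 else 0)"
      using lagr_weight[OF assms(1) di(1) i(1) p(2)] by simp
    finally have "fconst (u b - u a) * (lagr r u a (fXi i) * (lagr r u b (fXi (Suc i)) * z))
        \<approx> fconst (u b - u a) * (if d (Suc i) = b then if d i = a then z else 0 else 0)"
      by (rule eqK_const)
    thus "fconst (u (snd p) - u (fst p)) * (lagr r u (fst p) (fXi i) * (lagr r u (snd p) (fXi (Suc i)) * z))
        \<approx> (if p = (d i, d (Suc i)) then fconst (u (snd p) - u (fst p)) * z else 0)"
      unfolding p(1) by (auto split: if_splits)
  qed
  also have "\<dots> = fconst (asc d i * (u (d (Suc i)) - u (d i))) * z"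
    using fin di by (subst sum.delta) (auto simp: asc_def)
  finally show ?thesis by (simp add: sum_distrib_right case_prod_unfold mult.assoc)
qed

lemma weight_T:
  assumes z: "weight d z" and i: "i \<in> {1..<n}" and d: "d \<in> colorings n r"
  shows "weight (d \<circ> adj i) (fT i * z + fconst (asc d i) * z)"
proof -
  define D where "D = (\<Sum>(a, b)\<in>{(a, b). 1 \<le> a \<and> a < b \<and> b \<le> r}.
      fconst (u b - u a) * lagr r u a (fXi i) * lagr r u b (fXi (i + 1)))"
  let ?a = "u (d i)" and ?b = "u (d (Suc i))" and ?k = "asc d i"
  let ?y = "fT i * z + fconst ?k * z"
  have zc: "z \<in> aks_carrier n" using z by (simp add: weight_def)
  have j: "i \<in> {1..n}" "Suc i \<in> {1..n}" using i by auto
  have T: "fT i \<in> aks_carrier n" by (rule mem_fT[OF i])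
  have yc: "?y \<in> aks_carrier n" by (intro mem_free_alg_on_intros T zc)
  have W1: "fXi i * z - fconst ?a * z \<in> K" and W2: "fXi (Suc i) * z - fconst ?b * z \<in> K"
    using z j by (auto simp: weight_def eqK_def)
  have Dz: "D * z - fconst (?k * (?b - ?a)) * z \<in> K"
    using lagr_sum_weight[OF z i d] by (simp add: D_def eqK_def)
  have R1: "fT i * (fXi i * z) - fXi (Suc i) * (fT i * z) - D * z \<in> K"
    using eqK_relation[OF aks_relations.T_Xi[OF i] zc]
    unfolding D_def[symmetric] by (simp add: eqK_def algebra_simps)
  have R2: "fT i * (fXi (Suc i) * z) + fT i * (fXi i * z) - fXi (Suc i) * (fT i * z) - fXi i * (fT i * z) \<in> K"
    using eqK_relation[OF aks_relations.T_Xi_sum[OF i] zc]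
    by (simp add: eqK_def algebra_simps)
  have cT: "fT i * (fconst a * z) = fconst a * (fT i * z)" for a by (rule fconst_left_commute)
  have cX: "fXi j * (fconst a * z) = fconst a * (fXi j * z)" for a j by (rule fconst_left_commute)
  have cc: "fconst a * (fconst b * z) = fconst (a * b) * z" for a b by (simp add: fconst_mult mult.assoc)
  \<comment> \<open>The difference is written as a combination of elements known to lie in
    \<open>K\<close>; the multiple \<open>?k\<close> makes the terms in \<open>z\<close>
    cancel.\<close>
  have "fXi (Suc i) * ?y - fconst ?a * ?y =
      - (fT i * (fXi i * z) - fXi (Suc i) * (fT i * z) - D * z) + fT i * (fXi i * z - fconst ?a * z)
      - (D * z - fconst (?k * (?b - ?a)) * z) + fconst ?k * (fXi (Suc i) * z - fconst ?b * z)"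
    by (simp add: distrib_left right_diff_distrib cT cX cc fconst_diff left_diff_distrib mult.commute[of ?k])
  also have "\<dots> \<in> K" by (intro K_add K_diff K_uminus K_mult K_const R1 W1 W2 Dz T)
  finally have E1: "fXi (Suc i) * ?y \<approx> fconst ?a * ?y" by (simp add: eqK_def)
  \<comment> \<open>\<open>R1\<close> minus \<open>R2\<close> eliminates the \<xi> at position
    \<open>i + 1\<close> in front of \<open>T\<^sub>i z\<close>: it says that
    \<open>fXi i * (fT i * z)\<close> is congruent to
    \<open>fT i * (fXi (Suc i) * z) + D * z\<close>.\<close>
  have "fXi i * ?y - fconst ?b * ?y =
      (fT i * (fXi i * z) - fXi (Suc i) * (fT i * z) - D * z)
      - (fT i * (fXi (Suc i) * z) + fT i * (fXi i * z) - fXi (Suc i) * (fT i * z) - fXi i * (fT i * z))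
      + fT i * (fXi (Suc i) * z - fconst ?b * z)
      + (D * z - fconst (?k * (?b - ?a)) * z) + fconst ?k * (fXi i * z - fconst ?a * z)"
    by (simp add: distrib_left right_diff_distrib cT cX cc fconst_diff left_diff_distrib mult.commute[of ?k])
  also have "\<dots> \<in> K" by (intro K_add K_diff K_uminus K_mult K_const R1 R2 W1 W2 Dz T)
  finally have E2: "fXi i * ?y \<approx> fconst ?b * ?y" by (simp add: eqK_def)
  have E3: "fXi m * ?y \<approx> fconst (u (d m)) * ?y" if m: "m \<in> {1..n}" "m \<noteq> i" "m \<noteq> Suc i" for m
  proof -
    have W: "fXi m * z \<approx> fconst (u (d m)) * z" using z m by (simp add: weight_def)
    have "fXi m * (fT i * z) \<approx> fT i * (fXi m * z)"
      using eqK_sym[OF eqK_relation[OF aks_relations.T_Xi_comm[OF i m(1,2)] zc]] m by (simp add: mult.assoc)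
    also have "\<dots> \<approx> fT i * (fconst (u (d m)) * z)" by (intro eqK_mult T W)
    finally have "fXi m * (fT i * z) + fconst ?k * (fXi m * z)
        \<approx> fT i * (fconst (u (d m)) * z) + fconst ?k * (fconst (u (d m)) * z)"
      by (intro eqK_add eqK_const W)
    thus ?thesis by (simp add: distrib_left cT cX cc mult.commute)
  qed
  show ?thesis
    unfolding weight_def
  proof (intro conjI ballI)
    fix m assume m: "m \<in> {1..n}"
    consider "m = i" | "m = Suc i" | "m \<noteq> i" "m \<noteq> Suc i" by blast
    then show "fXi m * ?y \<approx> fconst (u ((d \<circ> adj i) m)) * ?y"
      by cases (use E1 E2 E3[OF m] in simp_all)
  qed (rule yc)
qed

end

text \<open>Cosets turn congruence modulo the ideal into equality of values, the form in which
  \<open>braid_invariant\<close> takes its function.\<close>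

lemma coset_eq_iff: "{p. p - a \<in> aks_ideal n r u} = {p. p - b \<in> aks_ideal n r u} \<longleftrightarrow> a - b \<in> aks_ideal n r u"
proof
  assume "{p. p - a \<in> aks_ideal n r u} = {p. p - b \<in> aks_ideal n r u}"
  moreover have "a \<in> {p. p - a \<in> aks_ideal n r u}" by (simp add: aks_ideal_0)
  ultimately show "a - b \<in> aks_ideal n r u" by blast
next
  assume ab: "a - b \<in> aks_ideal n r u"
  have "p - a \<in> aks_ideal n r u \<longleftrightarrow> p - b \<in> aks_ideal n r u" for p
  proof
    assume "p - a \<in> aks_ideal n r u"
    from aks_ideal_add[OF this ab] show "p - b \<in> aks_ideal n r u" by simp
  next
    assume p: "p - b \<in> aks_ideal n r u"
    have "fconst (- 1) * (a - b) \<in> aks_ideal n r u"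
      by (intro aks_ideal_l ab mem_free_alg_on_const)
    from aks_ideal_add[OF p this] show "p - a \<in> aks_ideal n r u" by (simp add: fconst_minus)
  qed
  thus "{p. p - a \<in> aks_ideal n r u} = {p. p - b \<in> aks_ideal n r u}" by blast
qed

lemma T_word_unique:
  assumes "reduced n v" "reduced n w" "pos_of_word v = pos_of_word w"
  shows "(\<Prod>i\<leftarrow>v. fT i) - (\<Prod>i\<leftarrow>w. fT i) \<in> aks_ideal n r u"
proof -
  let ?f = "\<lambda>w. {p. p - (\<Prod>i\<leftarrow>w. fT i) \<in> aks_ideal n r u}"
  have "braid_invariant n ?f"
  proof
    fix i v w assume i: "i \<in> {1..<n}" and "?f v = ?f w"
    hence "fT i * ((\<Prod>i\<leftarrow>v. fT i) - (\<Prod>i\<leftarrow>w. fT i)) \<in> aks_ideal n r u"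
      unfolding coset_eq_iff by (intro aks_ideal_l mem_fT)
    thus "?f (i # v) = ?f (i # w)"
      unfolding coset_eq_iff by (simp add: right_diff_distrib)
  next
    fix i w assume i: "i \<in> {1..<n}" "Suc i \<in> {1..<n}" and w: "set w \<subseteq> {1..<n}"
    have "(fT i * fT (i + 1) * fT i - fT (i + 1) * fT i * fT (i + 1)) * (\<Prod>i\<leftarrow>w. fT i) \<in> aks_ideal n r u"
      by (intro aks_ideal_r aks_relation_in_ideal aks_relations.braid mem_T_word w) (use i in auto)
    thus "?f (i # Suc i # i # w) = ?f (Suc i # i # Suc i # w)"
      unfolding coset_eq_iff by (simp add: left_diff_distrib mult.assoc)
  next
    fix i j w assume i: "i \<in> {1..<n}" "j \<in> {1..<n}" "Suc i < j" and w: "set w \<subseteq> {1..<n}"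
    have "(fT i * fT j - fT j * fT i) * (\<Prod>i\<leftarrow>w. fT i) \<in> aks_ideal n r u"
      by (intro aks_ideal_r aks_relation_in_ideal aks_relations.T_comm mem_T_word w) (use i in auto)
    thus "?f (i # j # w) = ?f (j # i # w)"
      unfolding coset_eq_iff by (simp add: left_diff_distrib mult.assoc)
  qed
  from braid_invariant.matsumoto[OF this assms] show ?thesis
    unfolding coset_eq_iff .
qed

text \<open>A reduced word starting with \<open>i\<close> represents the same product, and there
  \<open>T\<^sub>i T\<^sub>i = - T\<^sub>i\<close> applies.\<close>

lemma T_word_descent:
  assumes "reduced n w" "i \<in> {1..<n}" "pos_of_word w (Suc i) < pos_of_word w i"
  shows "fT i * (\<Prod>i\<leftarrow>w. fT i) + (\<Prod>i\<leftarrow>w. fT i) \<in> aks_ideal n r u"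
proof -
  obtain v where v: "reduced n (i # v)" "pos_of_word (i # v) = pos_of_word w"
    using reduced_descent[OF assms] by blast
  let ?v = "\<Prod>i\<leftarrow>v. fT i" and ?w = "\<Prod>i\<leftarrow>w. fT i"
  have mv: "?v \<in> aks_carrier n"
    using v(1) by (intro mem_T_word) (simp add: reduced_def)
  have T: "fT i \<in> aks_carrier n" by (rule mem_fT[OF assms(2)])
  have d: "?w - fT i * ?v \<in> aks_ideal n r u"
    using T_word_unique[OF assms(1) v(1) v(2)[symmetric]] by simp
  have q: "(fT i * (fT i + 1) - 0) * ?v \<in> aks_ideal n r u"
    by (intro aks_ideal_r aks_relation_in_ideal aks_relations.quadratic mv assms)
  have "fT i * ?w + ?w = fT i * (?w - fT i * ?v) + (?w - fT i * ?v) + (fT i * (fT i + 1) - 0) * ?v"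
    by (simp add: algebra_simps)
  also have "\<dots> \<in> aks_ideal n r u"
    by (intro aks_ideal_add aks_ideal_l d q T)
  finally show ?thesis .
qed

context aks_left_ideal
begin

lemma eq_eqK_trans [trans]: "\<lbrakk>p = q; q \<approx> s\<rbrakk> \<Longrightarrow> p \<approx> s"
  and eqK_eq_trans [trans]: "\<lbrakk>p \<approx> q; q = s\<rbrakk> \<Longrightarrow> p \<approx> s"
  by simp_all

text \<open>This is the projection of \<open>T\<^sub>i y \<approx> \<epsilon> y\<close> to weight
  \<open>d\<close>. Write \<open>y\<close> as the sum of its components \<open>L\<^sub>e y\<close>;
  the corrected vector built from \<open>L\<^sub>e y\<close> has weight
  \<open>e \<circ> adj i\<close>. Hence only the component of \<open>d \<circ> adj i\<close> and the
  correction at \<open>d\<close> reach weight \<open>d\<close>.\<close>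

lemma T_color_elem:
  assumes y: "y \<in> aks_carrier n" and i: "i \<in> {1..<n}" and T: "fT i * y \<approx> fconst \<epsilon> * y"
    and d: "d \<in> colorings n r"
  shows "fT i * (color_elem n r u (d \<circ> adj i) * y) \<approx>
    fconst (\<epsilon> + asc d i) * (color_elem n r u d * y)
      - fconst (asc (d \<circ> adj i) i) * (color_elem n r u (d \<circ> adj i) * y)"
proof -
  let ?L = "\<lambda>e. color_elem n r u e * y"
  let ?w = "\<lambda>e. fT i * ?L e + fconst (asc e i) * ?L e"
  let ?s = "d \<circ> adj i"
  have Ti: "fT i \<in> aks_carrier n" by (rule mem_fT[OF i])
  have ds: "?s \<in> colorings n r" by (rule colorings_comp_adj[OF d i])
  have "fT i * y = (\<Sum>e\<in>colorings n r. ?w e - fconst (asc e i) * ?L e)"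
    using sum_color_elem[OF inj_u r_pos, of n]
    by (simp add: sum_distrib_left[symmetric] sum_distrib_right[symmetric])
  hence "color_elem n r u d * (fT i * y) = color_elem n r u d * (\<Sum>e\<in>colorings n r. ?w e - fconst (asc e i) * ?L e)"
    by (rule arg_cong)
  also have "\<dots> = (\<Sum>e\<in>colorings n r. color_elem n r u d * ?w e - fconst (asc e i) * (color_elem n r u d * ?L e))"
    by (simp only: sum_distrib_left right_diff_distrib fconst_left_commute[of "color_elem n r u d"])
  also have "\<dots> \<approx> (\<Sum>e\<in>colorings n r. (if e = ?s then ?w e else 0) - fconst (asc e i) * (if e = d then ?L e else 0))"
  proof (intro eqK_sum eqK_diff eqK_const)
    fix e assume e: "e \<in> colorings n r"
    have w: "weight e (?L e)" by (rule weight_color_elem[OF e y])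
    show "color_elem n r u d * ?L e \<approx> (if e = d then ?L e else 0)"
      by (rule color_elem_weight[OF w e d])
    have iff: "e \<circ> adj i = d \<longleftrightarrow> e = ?s" by (metis adj_adj)
    show "color_elem n r u d * ?w e \<approx> (if e = ?s then ?w e else 0)"
      using color_elem_weight[OF weight_T[OF w i e] colorings_comp_adj[OF e i] d] unfolding iff .
  qed
  also have "\<dots> = (\<Sum>e\<in>colorings n r. if e = ?s then ?w e else 0) - (\<Sum>e\<in>colorings n r. if e = d then fconst (asc e i) * ?L e else 0)"
  proof -
    have "fconst (asc e i) * (if e = d then ?L e else 0) = (if e = d then fconst (asc e i) * ?L e else 0)" for e
      by simp
    thus ?thesis by (simp only: sum_subtractf)
  qed
  also have "\<dots> = ?w ?s - fconst (asc d i) * ?L d"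
    using ds d by (simp add: finite_colorings)
  finally have 1: "color_elem n r u d * (fT i * y) \<approx> ?w ?s - fconst (asc d i) * ?L d" .
  have "color_elem n r u d * (fT i * y) \<approx> color_elem n r u d * (fconst \<epsilon> * y)"
    by (intro eqK_mult mem_color_elem T)
  also have "\<dots> = fconst \<epsilon> * ?L d" by (rule fconst_left_commute)
  finally have "?w ?s - fconst (asc d i) * ?L d \<approx> fconst \<epsilon> * ?L d"
    using 1 eqK_sym eqK_trans by blast
  from eqK_add[OF this, of "fconst (asc d i) * ?L d - fconst (asc ?s i) * ?L ?s" "fconst (asc d i) * ?L d - fconst (asc ?s i) * ?L ?s"]
  show ?thesis by (simp add: fconst_add distrib_right add_diff_eq)
qed

text \<open>At an ascent \<open>i\<close> of a maximal \<open>w\<close> the word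
  \<open>i # w\<close> is reduced and longer, so maximality puts its product into \<open>K\<close>;
  at a descent \<open>T_word_descent\<close> gives the eigenvalue -1.\<close>

lemma hecke_eigenvector:
  assumes "1 \<notin> K"
  obtains y \<epsilon> where "y \<in> aks_carrier n" "y \<notin> K"
    "\<And>i. i \<in> {1..<n} \<Longrightarrow> \<epsilon> i \<in> {0, - 1} \<and> fT i * y \<approx> fconst (\<epsilon> i) * y"
proof -
  let ?P = "\<lambda>w. reduced n w \<and> (\<Prod>i\<leftarrow>w. fT i) \<notin> K"
  have "?P []" using assms by simp
  moreover have "\<forall>w. ?P w \<longrightarrow> length w < Suc (n * n)"
    using inv_count_le by (auto simp: reduced_def less_Suc_eq_le)
  ultimately obtain w where w: "reduced n w" "(\<Prod>i\<leftarrow>w. fT i) \<notin> K"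
    and max: "\<And>v. ?P v \<Longrightarrow> length v \<le> length w"
    using ex_has_greatest_nat[of ?P "[]" length "Suc (n * n)"] by blast
  let ?y = "\<Prod>i\<leftarrow>w. fT i"
  have sw: "set w \<subseteq> {1..<n}" using w by (simp add: reduced_def)
  have "\<exists>e. e \<in> {0, - 1} \<and> fT i * ?y \<approx> fconst e * ?y" if i: "i \<in> {1..<n}" for i
  proof (cases "pos_of_word w i < pos_of_word w (Suc i)")
    case True
    hence "reduced n (i # w)" using w i by (simp add: reduced_Cons_iff)
    hence "fT i * ?y \<in> K" using max[of "i # w"] by auto
    then show ?thesis by (intro exI[of _ 0]) (simp add: eqK_def)
  next
    case False
    hence "pos_of_word w (Suc i) < pos_of_word w i"
      using permutes_neq_Suc[OF pos_of_word_permutes[OF sw], of i] by simp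
    from T_word_descent[OF w(1) i this] have "fT i * ?y + ?y \<in> K"
      using ideal_sub by blast
    then show ?thesis by (intro exI[of _ "- 1"]) (simp add: eqK_def fconst_minus)
  qed
  then obtain \<epsilon> where "\<And>i. i \<in> {1..<n} \<Longrightarrow> \<epsilon> i \<in> {0, - 1} \<and> fT i * ?y \<approx> fconst (\<epsilon> i) * ?y"
    by metis
  thus ?thesis using that[of ?y \<epsilon>] mem_T_word[OF sw] w(2) by blast
qed

end

text \<open>Along an exchange of \<open>d i\<close> and \<open>d (i + 1)\<close> that moves a color word towards the ribbon
  with descents at \<open>\<epsilon> = -1\<close>, the following potential increases.\<close>

definition slope :: "(nat \<Rightarrow> complex) \<Rightarrow> nat \<Rightarrow> int" where
  "slope \<epsilon> j = (\<Sum>k<j. if \<epsilon> k = 0 then 1 else - 1)"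

definition potential :: "nat \<Rightarrow> (nat \<Rightarrow> complex) \<Rightarrow> (nat \<Rightarrow> nat) \<Rightarrow> int" where
  "potential n \<epsilon> d = (\<Sum>j\<in>{1..n}. slope \<epsilon> j * int (d j))"

text \<open>Only the positions \<open>i\<close> and \<open>Suc i\<close> contribute, and their
  slopes differ by the sign at \<open>i\<close>. The summand \<open>k = 0\<close> of
  \<open>slope\<close> shifts all slopes equally and cancels.\<close>

lemma potential_comp_adj:
  assumes "i \<in> {1..<n}"
  shows "potential n \<epsilon> (d \<circ> adj i) = potential n \<epsilon> d +
    (if \<epsilon> i = 0 then 1 else - 1) * (int (d i) - int (d (Suc i)))"
proof -
  have "potential n \<epsilon> (d \<circ> adj i) - potential n \<epsilon> d =
      (\<Sum>j\<in>{1..n}. slope \<epsilon> j * int (d (adj i j)) - slope \<epsilon> j * int (d j))"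
    by (simp add: potential_def sum_subtractf)
  also have "\<dots> = (\<Sum>j\<in>{i, Suc i}. slope \<epsilon> j * int (d (adj i j)) - slope \<epsilon> j * int (d j))"
    using assms by (intro sum.mono_neutral_right) (auto simp: transpose_def)
  also have "\<dots> = (slope \<epsilon> (Suc i) - slope \<epsilon> i) * (int (d i) - int (d (Suc i)))"
    by (simp add: algebra_simps)
  also have "slope \<epsilon> (Suc i) - slope \<epsilon> i = (if \<epsilon> i = 0 then 1 else - 1)"
    by (simp add: slope_def)
  finally show ?thesis by linarith
qed

context aks_left_ideal
begin

lemma eigenvector:
  assumes "1 \<notin> K"
  obtains z d \<epsilon> where "d \<in> colorings n r" "weight d z" "z \<notin> K"
    "\<And>i. i \<in> {1..<n} \<Longrightarrow> \<epsilon> i \<in> {0, - 1} \<and> fT i * z \<approx> fconst (\<epsilon> i) * z"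
proof -
  obtain y \<epsilon> where y: "y \<in> aks_carrier n" "y \<notin> K"
    and T: "\<And>i. i \<in> {1..<n} \<Longrightarrow> \<epsilon> i \<in> {0, - 1} \<and> fT i * y \<approx> fconst (\<epsilon> i) * y"
    using hecke_eigenvector[OF assms] by blast
  let ?L = "\<lambda>e. color_elem n r u e * y"
  define S where "S = {d \<in> colorings n r. ?L d \<notin> K}"
  have "S \<noteq> {}"
  proof
    assume "S = {}"
    hence "(\<Sum>d\<in>colorings n r. ?L d) \<in> K" by (intro K_sum) (auto simp: S_def)
    thus False using y sum_color_elem[OF inj_u r_pos, of n] by (simp add: sum_distrib_right[symmetric])
  qed
  moreover have fin: "finite S" by (simp add: S_def finite_colorings)
  ultimately have "Max (potential n \<epsilon> ` S) \<in> potential n \<epsilon> ` S" by (intro Max_in) auto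
  then obtain d where d: "d \<in> S" "potential n \<epsilon> d = Max (potential n \<epsilon> ` S)" by force
  have max: "potential n \<epsilon> e \<le> potential n \<epsilon> d" if "e \<in> S" for e
    unfolding d(2) using that fin by simp
  have dc: "d \<in> colorings n r" and dK: "?L d \<notin> K" using d(1) by (auto simp: S_def)
  have "\<exists>e. e \<in> {0, - 1} \<and> fT i * ?L d \<approx> fconst e * ?L d" if i: "i \<in> {1..<n}" for i
  proof -
    let ?s = "d \<circ> adj i"
    have sc: "?s \<in> colorings n r" by (rule colorings_comp_adj[OF dc i])
    have \<epsilon>: "\<epsilon> i = 0 \<or> \<epsilon> i = - 1" using T[OF i] by blast
    \<comment> \<open>The neighbour \<open>?L ?s\<close> enters with coefficient
      \<open>\<epsilon> i\<close> if \<open>d i < d (Suc i)\<close> and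
      \<open>\<epsilon> i + 1\<close> if \<open>d (Suc i) < d i\<close>. Whenever this is nonzero
      the exchange raises the potential, so by maximality the neighbour lies in
      \<open>K\<close>.\<close>
    have E: "fT i * ?L d \<approx> fconst (\<epsilon> i + asc ?s i) * ?L ?s - fconst (asc d i) * ?L d"
      using T_color_elem[OF y(1) i _ sc, of "\<epsilon> i"] T[OF i] by simp
    have drop: "?L ?s \<in> K" if "potential n \<epsilon> d < potential n \<epsilon> ?s"
      using max[of ?s] that sc by (force simp: S_def)
    consider "d i < d (Suc i)" | "d (Suc i) < d i" | "d i = d (Suc i)" by linarith
    then show ?thesis
    proof cases
      case 1
      have "fconst (\<epsilon> i) * ?L ?s \<in> K"
      proof (cases "\<epsilon> i = 0")
        case False
        hence "?L ?s \<in> K" using 1 potential_comp_adj[OF i, of \<epsilon> d] by (intro drop) simp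
        then show ?thesis by (rule K_const)
      qed (simp add: K_0)
      hence "fconst (\<epsilon> i) * ?L ?s - ?L d \<approx> fconst (- 1) * ?L d"
        by (simp add: eqK_def fconst_minus)
      moreover have "fT i * ?L d \<approx> fconst (\<epsilon> i) * ?L ?s - ?L d"
        using E 1 by (simp add: asc_def)
      ultimately show ?thesis using eqK_trans by blast
    next
      case 2
      have "fconst (\<epsilon> i + 1) * ?L ?s \<in> K"
      proof (cases "\<epsilon> i = 0")
        case True
        hence "?L ?s \<in> K" using 2 potential_comp_adj[OF i, of \<epsilon> d] by (intro drop) simp
        then show ?thesis by (rule K_const)
      next
        case False
        then show ?thesis using \<epsilon> by (simp add: K_0)
      qed
      hence "fconst (\<epsilon> i + 1) * ?L ?s \<approx> fconst 0 * ?L d"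
        by (simp add: eqK_def)
      moreover have "fT i * ?L d \<approx> fconst (\<epsilon> i + 1) * ?L ?s"
        using E 2 by (simp add: asc_def)
      ultimately show ?thesis using eqK_trans by blast
    next
      case 3
      hence "?s = d" by (intro comp_adj_absorb) simp
      then show ?thesis using E 3 \<epsilon> by (intro exI[of _ "\<epsilon> i"]) (simp add: asc_def)
    qed
  qed
  then obtain \<epsilon>' where "\<And>i. i \<in> {1..<n} \<Longrightarrow> \<epsilon>' i \<in> {0, - 1} \<and> fT i * ?L d \<approx> fconst (\<epsilon>' i) * ?L d"
    by metis
  thus ?thesis using that[OF dc weight_color_elem[OF dc y(1)] dK] by blast
qed

text \<open>The vector \<open>T\<^sub>i z + asc d i z\<close> is a multiple of \<open>z\<close>,
  hence of weight \<open>d\<close>, but also of the different weight \<open>d \<circ> adj i\<close>;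
  so it vanishes modulo \<open>K\<close>.\<close>

lemma eigenvalue_at_unequal_colors:
  assumes "weight d z" "d \<in> colorings n r" "z \<notin> K" "i \<in> {1..<n}"
    and T: "fT i * z \<approx> fconst \<epsilon> * z" and "d i \<noteq> d (Suc i)"
  shows "\<epsilon> = - asc d i"
proof (rule ccontr)
  let ?s = "d \<circ> adj i" and ?y = "fT i * z + fconst (asc d i) * z"
  assume "\<epsilon> \<noteq> - asc d i"
  hence nz: "\<epsilon> + asc d i \<noteq> 0" by (simp add: eq_neg_iff_add_eq_0)
  have "?s i \<noteq> d i" using assms(6) by simp
  hence ne: "?s \<noteq> d" by metis
  have "?y \<approx> fconst \<epsilon> * z + fconst (asc d i) * z"
    by (intro eqK_add T) simp
  hence y: "?y \<approx> fconst (\<epsilon> + asc d i) * z"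
    by (simp add: fconst_add distrib_right)
  have "color_elem n r u d * ?y \<approx> 0"
    using color_elem_weight[OF weight_T[OF assms(1,4,2)] colorings_comp_adj[OF assms(2,4)] assms(2)] ne by simp
  moreover have "color_elem n r u d * ?y \<approx> color_elem n r u d * (fconst (\<epsilon> + asc d i) * z)"
    by (intro eqK_mult mem_color_elem y)
  moreover have "color_elem n r u d * (fconst (\<epsilon> + asc d i) * z) \<approx> fconst (\<epsilon> + asc d i) * z"
    unfolding fconst_left_commute using color_elem_weight[OF assms(1,2,2)] by (intro eqK_const) simp
  ultimately have "fconst (\<epsilon> + asc d i) * z \<approx> 0"
    by (meson eqK_sym eqK_trans)
  hence "fconst (1 / (\<epsilon> + asc d i)) * (fconst (\<epsilon> + asc d i) * z) \<in> K"
    unfolding eqK_0_iff by (rule K_const)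
  moreover have "fconst (1 / (\<epsilon> + asc d i)) * (fconst (\<epsilon> + asc d i) * z) = z"
    using nz by (simp add: mult.assoc[symmetric] fconst_mult[symmetric])
  ultimately show False using assms(3) by simp
qed

end

section \<open>The elements \<open>\<eta>\<^sub>I\<close>\<close>

lemma aks_class_eq_image: "aks_class n r u p = (\<lambda>h. h + p) ` aks_ideal n r u"
  by (auto simp: aks_class_def a_r_coset_def r_coset_def)

lemma aks_class_eq_iff: "aks_class n r u p = aks_class n r u q \<longleftrightarrow> p - q \<in> aks_ideal n r u"
proof -
  have m: "x - p \<in> aks_ideal n r u \<longleftrightarrow> x \<in> aks_class n r u p" for x p
    by (auto simp: aks_class_eq_image image_iff) (metis diff_add_cancel)
  hence "aks_class n r u p = {x. x - p \<in> aks_ideal n r u}" for p by blast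
  thus ?thesis by (simp only: coset_eq_iff)
qed

lemma aks_simps:
  "carrier (aks n r u) = aks_class n r u ` aks_carrier n"
  "one (aks n r u) = aks_class n r u 1"
  "zero (aks n r u) = aks_class n r u 0"
proof -
  have "aks_class n r u 0 = aks_ideal n r u" by (simp add: aks_class_eq_image)
  thus "zero (aks n r u) = aks_class n r u 0" by (simp add: aks_def FactRing_def)
qed (auto simp: aks_def FactRing_def A_RCOSETS_def RCOSETS_def aks_class_def a_r_coset_def)

lemma aks_class_closed [simp]: "p \<in> aks_carrier n \<Longrightarrow> aks_class n r u p \<in> carrier (aks n r u)"
  by (simp add: aks_simps)

lemma aks_class_mult:
  "\<lbrakk>p \<in> aks_carrier n; q \<in> aks_carrier n\<rbrakk> \<Longrightarrow>
    aks_class n r u p \<otimes>\<^bsub>aks n r u\<^esub> aks_class n r u q = aks_class n r u (p * q)"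
  using ideal.rcoset_mult_add[OF ideal_aks[of n r u], of p q]
  by (simp add: aks_def FactRing_def aks_class_def)

lemma aks_class_add:
  "\<lbrakk>p \<in> aks_carrier n; q \<in> aks_carrier n\<rbrakk> \<Longrightarrow>
    aks_class n r u p \<oplus>\<^bsub>aks n r u\<^esub> aks_class n r u q = aks_class n r u (p + q)"
  using abelian_subgroup.a_rcos_sum[OF abelian_subgroupI3[OF ideal.axioms(1)[OF ideal_aks[of n r u]]
      ring.is_abelian_group[OF ring_free_alg_on]], of p q]
  by (simp add: aks_def FactRing_def aks_class_def)

lemma ring_aks: "ring (aks n r u)"
  unfolding aks_def by (rule ideal.quotient_is_ring[OF ideal_aks])

lemma aks_class_uminus:
  assumes "p \<in> aks_carrier n"
  shows "\<ominus>\<^bsub>aks n r u\<^esub> aks_class n r u p = aks_class n r u (- p)"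
proof -
  interpret ring "aks n r u" by (rule ring_aks)
  show ?thesis
    by (rule minus_equality) (use assms in \<open>simp_all add: aks_class_add mem_free_alg_on_uminus aks_simps(3)\<close>)
qed

lemma aks_class_finsum:
  assumes "finite I" "\<And>i. i \<in> I \<Longrightarrow> f i \<in> aks_carrier n"
  shows "(\<Oplus>\<^bsub>aks n r u\<^esub>i\<in>I. aks_class n r u (f i)) = aks_class n r u (sum f I)"
proof -
  interpret ring "aks n r u" by (rule ring_aks)
  show ?thesis
    using assms
  proof (induction I rule: finite_induct)
    case (insert i I)
    then have "(\<lambda>i. aks_class n r u (f i)) \<in> I \<rightarrow> carrier (aks n r u)" by auto
    then show ?case
      using insert by (simp add: aks_class_add mem_free_alg_on_sum)
  qed (simp add: aks_simps)
qed

lemma mem_hecke_elem: "hecke_elem n a \<in> aks_carrier n"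
  unfolding hecke_elem_def
  by (intro mem_free_alg_on_sum mem_free_alg_on_mult mem_free_alg_on_const mem_T_word)
    (use reduced_perm_word in \<open>auto simp: reduced_def\<close>)

lemma hecke_elem_class:
  "(\<Oplus>\<^bsub>aks n r u\<^esub>\<sigma>\<in>{\<sigma>. \<sigma> permutes {1..n}}. aks_const n r u (a \<sigma>) \<otimes>\<^bsub>aks n r u\<^esub> aks_Tperm n r u \<sigma>)
    = aks_class n r u (hecke_elem n a)"
proof -
  interpret ring "aks n r u" by (rule ring_aks)
  have w: "(\<Prod>i\<leftarrow>perm_word n \<sigma>. fT i) \<in> aks_carrier n" if "\<sigma> permutes {1..n}" for \<sigma>
    using reduced_perm_word[OF that] by (intro mem_T_word) (simp add: reduced_def)
  have "(\<Oplus>\<^bsub>aks n r u\<^esub>\<sigma>\<in>{\<sigma>. \<sigma> permutes {1..n}}. aks_const n r u (a \<sigma>) \<otimes>\<^bsub>aks n r u\<^esub> aks_Tperm n r u \<sigma>)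
     = (\<Oplus>\<^bsub>aks n r u\<^esub>\<sigma>\<in>{\<sigma>. \<sigma> permutes {1..n}}. aks_class n r u (fconst (a \<sigma>) * (\<Prod>i\<leftarrow>perm_word n \<sigma>. fT i)))"
    using w by (intro finsum_cong')
      (auto simp: aks_const_def aks_Tperm_def perm_word_def[symmetric] aks_class_mult mem_free_alg_on_const mem_free_alg_on_mult)
  also have "\<dots> = aks_class n r u (hecke_elem n a)"
    unfolding hecke_elem_def using w
    by (intro aks_class_finsum finite_permutations) (auto intro!: mem_free_alg_on_mult mem_free_alg_on_const)
  finally show ?thesis .
qed

section \<open>Left multiplication by \<open>T\<^sub>i\<close> in terms of coefficients\<close>

lemma perm_inv_adj_comp:
  assumes "\<sigma> permutes {1..n}"
  shows "perm_inv (adj i \<circ> \<sigma>) = perm_inv \<sigma> \<circ> adj i"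
  using o_inv_distrib[of "adj i" \<sigma>] permutes_bij[OF assms] by simp

lemma adj_comp_permutes:
  "\<lbrakk>\<sigma> permutes {1..n}; i \<in> {1..<n}\<rbrakk> \<Longrightarrow> adj i \<circ> \<sigma> permutes {1..n}"
  by (rule permutes_compose[OF _ adj_permutes])

lemma T_perm_word:
  assumes \<sigma>: "\<sigma> permutes {1..n}" and i: "i \<in> {1..<n}"
  shows "fT i * (\<Prod>i\<leftarrow>perm_word n \<sigma>. fT i) -
    (if perm_inv \<sigma> (Suc i) < perm_inv \<sigma> i then - (\<Prod>i\<leftarrow>perm_word n \<sigma>. fT i)
     else (\<Prod>i\<leftarrow>perm_word n (adj i \<circ> \<sigma>). fT i)) \<in> aks_ideal n r u"
proof (cases "perm_inv \<sigma> (Suc i) < perm_inv \<sigma> i")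
  case True
  then show ?thesis
    using T_word_descent[OF reduced_perm_word[OF \<sigma>] i, of r u] by (simp add: pos_of_perm_word[OF \<sigma>])
next
  case False
  hence "perm_inv \<sigma> i < perm_inv \<sigma> (Suc i)"
    using permutes_neq_Suc[OF permutes_inv[OF \<sigma>], of i] by simp
  hence "reduced n (i # perm_word n \<sigma>)"
    using reduced_perm_word[OF \<sigma>] i pos_of_perm_word[OF \<sigma>] by (simp add: reduced_Cons_iff)
  moreover have "pos_of_word (i # perm_word n \<sigma>) = pos_of_word (perm_word n (adj i \<circ> \<sigma>))"
    unfolding pos_of_word_Cons pos_of_perm_word[OF \<sigma>] pos_of_perm_word[OF adj_comp_permutes[OF \<sigma> i]]
      perm_inv_adj_comp[OF \<sigma>] ..
  ultimately have "(\<Prod>i\<leftarrow>i # perm_word n \<sigma>. fT i) - (\<Prod>i\<leftarrow>perm_word n (adj i \<circ> \<sigma>). fT i) \<in> aks_ideal n r u"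
    by (intro T_word_unique reduced_perm_word adj_comp_permutes \<sigma> i)
  then show ?thesis using False by simp
qed

lemma aks_ideal_sum: "(\<And>i. i \<in> I \<Longrightarrow> f i \<in> aks_ideal n r u) \<Longrightarrow> sum f I \<in> aks_ideal n r u"
  by (induction I rule: infinite_finite_induct) (auto simp: aks_ideal_0 aks_ideal_add)

text \<open>Multiplication in the algebra is thus the same operator from which the action was built.
  As \<open>hecke_op\<close> works with functions of the inverse permutation, the coefficients are
  inverted before and after.\<close>

lemma T_hecke_elem:
  assumes i: "i \<in> {1..<n}"
  shows "fT i * hecke_elem n a - hecke_elem n (\<lambda>\<sigma>. hecke_op i (a \<circ> perm_inv) (perm_inv \<sigma>)) \<in> aks_ideal n r u"
proof -
  let ?X = "{\<sigma>. \<sigma> permutes {1..n}}"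
  let ?d = "\<lambda>\<sigma>. perm_inv \<sigma> (Suc i) < perm_inv \<sigma> i"
  let ?T = "\<lambda>\<sigma>. \<Prod>i\<leftarrow>perm_word n \<sigma>. fT i"
  let ?s = "\<lambda>\<sigma>. adj i \<circ> \<sigma>"
  have fin: "finite ?X" by (rule finite_permutations) simp
  have ss: "?s (?s \<sigma>) = \<sigma>" for \<sigma> :: "nat \<Rightarrow> nat" by (simp add: fun_eq_iff)
  have sX: "?s \<sigma> \<in> ?X" if "\<sigma> \<in> ?X" for \<sigma>
    using that adj_comp_permutes[OF _ i] by simp
  have ds: "?d (?s \<sigma>) \<longleftrightarrow> \<not> ?d \<sigma>" if "\<sigma> \<in> ?X" for \<sigma>
    using that perm_inv_adj_comp[of \<sigma> n i] permutes_neq_Suc[OF permutes_inv[of \<sigma>], of "{1..n}" i] by auto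
  have "(\<Sum>\<sigma>\<in>?X. fconst (a \<sigma>) * (fT i * ?T \<sigma> - (if ?d \<sigma> then - ?T \<sigma> else ?T (?s \<sigma>)))) \<in> aks_ideal n r u"
    using T_perm_word[OF _ i] by (intro aks_ideal_sum aks_ideal_l mem_free_alg_on_const) simp
  also have "(\<Sum>\<sigma>\<in>?X. fconst (a \<sigma>) * (fT i * ?T \<sigma> - (if ?d \<sigma> then - ?T \<sigma> else ?T (?s \<sigma>)))) =
      fT i * hecke_elem n a - (\<Sum>\<sigma>\<in>?X. fconst (a \<sigma>) * (if ?d \<sigma> then - ?T \<sigma> else ?T (?s \<sigma>)))"
    unfolding hecke_elem_def
    by (simp only: right_diff_distrib sum_subtractf sum_distrib_left fconst_left_commute[of "fT i"])
  also have "(\<Sum>\<sigma>\<in>?X. fconst (a \<sigma>) * (if ?d \<sigma> then - ?T \<sigma> else ?T (?s \<sigma>))) =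
      (\<Sum>\<sigma>\<in>?X. if ?d \<sigma> then - (fconst (a \<sigma>) * ?T \<sigma>) else 0) + (\<Sum>\<sigma>\<in>?X. if ?d \<sigma> then 0 else fconst (a \<sigma>) * ?T (?s \<sigma>))"
    unfolding sum.distrib[symmetric] by (intro sum.cong) auto
  \<comment> \<open>Left multiplication by the adjacent transposition exchanges permutations with
    and without a descent at \<open>i\<close>, which moves these terms to the descents.\<close>
  also have "(\<Sum>\<sigma>\<in>?X. if ?d \<sigma> then 0 else fconst (a \<sigma>) * ?T (?s \<sigma>)) =
      (\<Sum>\<sigma>\<in>?X. if ?d \<sigma> then fconst (a (?s \<sigma>)) * ?T \<sigma> else 0)"
    by (rule sum.reindex_bij_witness[of _ ?s ?s]) (use ss sX ds in auto)
  also have "(\<Sum>\<sigma>\<in>?X. if ?d \<sigma> then - (fconst (a \<sigma>) * ?T \<sigma>) else 0) + \<dots> =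
      hecke_elem n (\<lambda>\<sigma>. hecke_op i (a \<circ> perm_inv) (perm_inv \<sigma>))"
    unfolding sum.distrib[symmetric] hecke_elem_def
  proof (intro sum.cong refl)
    fix \<sigma> assume "\<sigma> \<in> ?X"
    hence \<sigma>: "\<sigma> permutes {1..n}" by simp
    have "perm_inv (perm_inv \<sigma> \<circ> adj i) = ?s \<sigma>"
      using perm_inv_adj_comp[OF \<sigma>, of i] permutes_inv_inv[OF adj_comp_permutes[OF \<sigma> i]] by simp
    thus "(if ?d \<sigma> then - (fconst (a \<sigma>) * ?T \<sigma>) else 0) + (if ?d \<sigma> then fconst (a (?s \<sigma>)) * ?T \<sigma> else 0)
        = fconst (hecke_op i (a \<circ> perm_inv) (perm_inv \<sigma>)) * ?T \<sigma>"
      using permutes_inv_inv[OF \<sigma>] by (simp add: hecke_op_def fconst_diff left_diff_distrib)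
  qed
  finally show ?thesis .
qed

lemma hecke_elem_cong:
  "(\<And>\<sigma>. \<sigma> permutes {1..n} \<Longrightarrow> a \<sigma> = b \<sigma>) \<Longrightarrow> hecke_elem n a = hecke_elem n b"
  unfolding hecke_elem_def by (intro sum.cong) auto

lemma hecke_elem_scale: "hecke_elem n (\<lambda>\<sigma>. z * a \<sigma>) = fconst z * hecke_elem n a"
  unfolding hecke_elem_def by (simp add: sum_distrib_left fconst_mult mult.assoc)

text \<open>The coefficients of \<open>\<eta>\<^sub>I\<close>: the permutations \<open>\<sigma> = v w\<^sub>0\<close> with \<open>v\<close> in the parabolic subgroup
  generated by the \<open>s\<^sub>i\<close> with \<open>i \<notin> Des I\<close>, described through \<open>\<tau> = \<sigma>\<^sup>-\<^sup>1\<close>.\<close>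

definition eta_coeff :: "nat \<Rightarrow> nat set \<Rightarrow> (nat \<Rightarrow> nat) \<Rightarrow> complex" where
  "eta_coeff n D \<tau> = (if \<forall>k\<in>D. \<forall>i\<in>{1..k}. \<forall>j\<in>{Suc k..n}. \<tau> j < \<tau> i then 1 else 0)"

definition eta_elem :: "nat \<Rightarrow> nat set \<Rightarrow> aks_free" where
  "eta_elem n D = hecke_elem n (eta_coeff n D \<circ> perm_inv)"

definition descent_sign :: "nat set \<Rightarrow> nat \<Rightarrow> complex" where
  "descent_sign D i = (if i \<in> D then - 1 else 0)"

text \<open>For \<open>k\<close> other than \<open>i\<close> the exchange maps each of the blocks
  \<open>{1..k}\<close> and \<open>{Suc k..n}\<close> to itself.\<close>

lemma eta_coeff_comp_adj:
  assumes "i \<notin> D" "D \<subseteq> {1..<n}" "i \<in> {1..<n}"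
  shows "eta_coeff n D (\<tau> \<circ> adj i) = eta_coeff n D \<tau>"
proof -
  let ?B = "\<lambda>\<tau> :: nat \<Rightarrow> nat. \<forall>k\<in>D. \<forall>i\<in>{1..k}. \<forall>j\<in>{Suc k..n}. \<tau> j < \<tau> i"
  have imp: "?B (\<tau> \<circ> adj i)" if B: "?B \<tau>" for \<tau> :: "nat \<Rightarrow> nat"
  proof (intro ballI)
    fix k a b assume k: "k \<in> D" and ab: "a \<in> {1..k}" "b \<in> {Suc k..n}"
    have "k \<noteq> i" using k assms(1) by blast
    hence "adj i a \<in> {1..k}" "adj i b \<in> {Suc k..n}"
      using ab assms(3) by (auto simp: transpose_def)
    thus "(\<tau> \<circ> adj i) b < (\<tau> \<circ> adj i) a" using B k by simp
  qed
  have "?B (\<tau> \<circ> adj i) \<longleftrightarrow> ?B \<tau>" using imp[of \<tau>] imp[of "\<tau> \<circ> adj i"] by (metis adj_adj)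
  thus ?thesis unfolding eta_coeff_def by presburger
qed

lemma eta_coeff_ascent:
  assumes "i \<in> D" "i \<in> {1..<n}" "\<not> \<tau> (Suc i) < \<tau> i"
  shows "eta_coeff n D \<tau> = 0"
proof -
  have "i \<in> {1..i}" "Suc i \<in> {Suc i..n}" using assms(2) by auto
  thus ?thesis unfolding eta_coeff_def using assms(1,3) by (meson)
qed

text \<open>For \<open>i \<in> D\<close> the support consists of \<tau> with a descent at
  \<open>i\<close>, where the exchanged coefficient is 0 and the value -1 remains. For
  \<open>i \<notin> D\<close> the coefficient is invariant under the exchange and the difference
  vanishes.\<close>

lemma hecke_op_eta_coeff:
  assumes "D \<subseteq> {1..<n}" "i \<in> {1..<n}"
  shows "hecke_op i (eta_coeff n D) \<tau> = descent_sign D i * eta_coeff n D \<tau>"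
proof (cases "i \<in> D")
  case True
  then show ?thesis
    using eta_coeff_ascent[OF True assms(2), of \<tau>] eta_coeff_ascent[OF True assms(2), of "\<tau> \<circ> adj i"]
    by (simp add: hecke_op_def descent_sign_def)
next
  case False
  then show ?thesis
    using eta_coeff_comp_adj[OF False assms] by (simp add: hecke_op_def descent_sign_def)
qed

lemma mem_eta_elem: "eta_elem n D \<in> aks_carrier n"
  unfolding eta_elem_def by (rule mem_hecke_elem)

lemma T_eta_elem:
  assumes "D \<subseteq> {1..<n}" "i \<in> {1..<n}"
  shows "fT i * eta_elem n D - fconst (descent_sign D i) * eta_elem n D \<in> aks_ideal n r u"
proof -
  have "hecke_elem n (\<lambda>\<sigma>. hecke_op i ((eta_coeff n D \<circ> perm_inv) \<circ> perm_inv) (perm_inv \<sigma>)) =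
      hecke_elem n (\<lambda>\<sigma>. descent_sign D i * (eta_coeff n D \<circ> perm_inv) \<sigma>)"
  proof (rule hecke_elem_cong)
    fix \<sigma> assume \<sigma>: "\<sigma> permutes {1..n}"
    have "hecke_op i ((eta_coeff n D \<circ> perm_inv) \<circ> perm_inv) (perm_inv \<sigma>) = hecke_op i (eta_coeff n D) (perm_inv \<sigma>)"
      using permutes_inv_inv[OF \<sigma>] permutes_inv_inv[OF adj_comp_permutes[OF \<sigma> assms(2)]] perm_inv_adj_comp[OF \<sigma>, of i]
      by (simp add: hecke_op_def)
    thus "hecke_op i ((eta_coeff n D \<circ> perm_inv) \<circ> perm_inv) (perm_inv \<sigma>) = descent_sign D i * (eta_coeff n D \<circ> perm_inv) \<sigma>"
      using hecke_op_eta_coeff[OF assms] by simp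
  qed
  with T_hecke_elem[OF assms(2), of "eta_coeff n D \<circ> perm_inv" r u]
  show ?thesis unfolding eta_elem_def by (simp only: hecke_elem_scale)
qed

lemma eta_coeff_longest: "D \<subseteq> {1..<n} \<Longrightarrow> eta_coeff n D (perm_inv (longest_perm n)) = 1"
proof -
  assume D: "D \<subseteq> {1..<n}"
  have "perm_inv (longest_perm n) b < perm_inv (longest_perm n) a"
    if "k \<in> D" "a \<in> {1..k}" "b \<in> {Suc k..n}" for k a b
  proof -
    have "perm_inv (longest_perm n) i = Suc n - i" if "i \<in> {1..n}" for i
      by (rule permutes_no_ascent[OF permutes_inv[OF longest_perm_permutes]]) (use longest_perm_no_ascent that in auto)
    from this[of a] this[of b] show ?thesis using that D by fastforce
  qed
  thus ?thesis by (simp add: eta_coeff_def)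
qed

text \<open>Zeros propagate downwards from the longest permutation. At an ascent \<open>i\<close> of
  \<tau> the equation at \<tau> gives \<open>f \<tau> = 0\<close> if \<open>i \<in> D\<close>;
  otherwise the equation at \<open>\<tau> \<circ> adj i\<close> gives
  \<open>f \<tau> = f (\<tau> \<circ> adj i)\<close>, and this value is already zero.\<close>

lemma hecke_eigenfunction_zero:
  assumes f: "\<And>i \<tau>. \<lbrakk>i \<in> {1..<n}; \<tau> permutes {1..n}\<rbrakk> \<Longrightarrow> hecke_op i f \<tau> = descent_sign D i * f \<tau>"
    and top: "f (perm_inv (longest_perm n)) = 0" and \<tau>: "\<tau> permutes {1..n}"
  shows "f \<tau> = 0"
  using \<tau>
proof (induction "n * n - inv_count n \<tau>" arbitrary: \<tau> rule: less_induct)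
  case less
  show ?case
  proof (cases "\<exists>i\<in>{1..<n}. \<tau> i < \<tau> (Suc i)")
    case True
    then obtain i where i: "i \<in> {1..<n}" "\<tau> i < \<tau> (Suc i)" by blast
    have p: "\<tau> \<circ> adj i permutes {1..n}"
      by (rule permutes_compose[OF adj_permutes[OF i(1)] less.prems])
    have "f (\<tau> \<circ> adj i) = 0"
      using inv_count_adj_ascent[of i n \<tau>] i inv_count_le[of n "\<tau> \<circ> adj i"] by (intro less.hyps p) simp
    moreover have "hecke_op i f \<tau> = 0" using i by (simp add: hecke_op_def)
    moreover have "hecke_op i f (\<tau> \<circ> adj i) = f \<tau> - f (\<tau> \<circ> adj i)" using i by (simp add: hecke_op_def)
    ultimately show ?thesis
      using f[OF i(1) less.prems] f[OF i(1) p] by (cases "i \<in> D") (simp_all add: descent_sign_def)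
  next
    case False
    have "\<tau> = perm_inv (longest_perm n)"
      by (rule permutes_no_ascent_unique[OF less.prems _ permutes_inv[OF longest_perm_permutes]])
        (use False longest_perm_no_ascent in \<open>auto simp: not_less\<close>)
    then show ?thesis using top by simp
  qed
qed

text \<open>Testing the congruences on \<open>vacuum\<close> at the constant color word 1 turns them
  into eigenvalue equations for coefficient functions. Their solutions are determined by the
  coefficient at the longest permutation, so even the representatives in the free algebra
  coincide.\<close>

lemma hecke_elem_eigen_unique:
  assumes "inj_on u {1..r}" "1 \<le> r" and D: "D \<subseteq> {1..<n}"
    and T: "\<And>i. i \<in> {1..<n} \<Longrightarrow> fT i * hecke_elem n a - fconst (descent_sign D i) * hecke_elem n a \<in> aks_ideal n r u"
    and top: "a (longest_perm n) = 1"
  shows "hecke_elem n a = eta_elem n D"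
  unfolding eta_elem_def
proof (rule hecke_elem_cong)
  fix \<sigma> assume \<sigma>: "\<sigma> permutes {1..n}"
  let ?a = "\<lambda>\<tau>. if \<tau> permutes {1..n} then a (perm_inv \<tau>) else 0"
  let ?f = "\<lambda>\<tau>. ?a \<tau> - eta_coeff n D \<tau>"
  have x: "(\<lambda>_. 1, \<tau>) \<in> colored_points r" for \<tau>
    using assms(2) by (auto simp: colored_points_def)
  have "?f (perm_inv \<sigma>) = 0"
  proof (rule hecke_eigenfunction_zero[of n ?f D])
    fix i \<tau> assume i: "i \<in> {1..<n}"
    have "aks_act u (fT i * hecke_elem n a - fconst (descent_sign D i) * hecke_elem n a) vacuum (\<lambda>_. 1, \<tau>) = 0"
      by (rule aks_act_ideal[OF assms(1) T[OF i] x])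
    hence "hecke_op i ?a \<tau> = descent_sign D i * ?a \<tau>"
      by (simp only: act_diff aks.act_mult act_const aks_act_hecke_elem aks_act_T_colorless case_prod_conv) simp
    thus "hecke_op i ?f \<tau> = descent_sign D i * ?f \<tau>"
      unfolding hecke_op_diff using hecke_op_eta_coeff[OF D i, of \<tau>] by (simp only: right_diff_distrib)
  next
    show "?f (perm_inv (longest_perm n)) = 0"
      using top eta_coeff_longest[OF D] permutes_inv[OF longest_perm_permutes[of n]]
        permutes_inv_inv[OF longest_perm_permutes[of n]] by simp
  qed (rule permutes_inv[OF \<sigma>])
  thus "a \<sigma> = (eta_coeff n D \<circ> perm_inv) \<sigma>"
    using permutes_inv[OF \<sigma>] permutes_inv_inv[OF \<sigma>] by simp
qed

lemma aks_eta_eq: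
  assumes "inj_on u {1..r}" "1 \<le> r" and D: "Des I \<subseteq> {1..<n}"
  shows "aks_eta n r u I = aks_class n r u (eta_elem n (Des I))"
proof -
  let ?D = "Des I"
  \<comment> \<open>Both alternatives in the definition of the element become one congruence with
    the scalar \<open>descent_sign\<close>, so that the \<open>THE\<close> is resolved by computing
    in the free algebra.\<close>
  have eq: "aks_T n r u i \<otimes>\<^bsub>aks n r u\<^esub> aks_class n r u h =
        (if i \<in> ?D then \<ominus>\<^bsub>aks n r u\<^esub> aks_class n r u h else \<zero>\<^bsub>aks n r u\<^esub>)
      \<longleftrightarrow> fT i * h - fconst (descent_sign ?D i) * h \<in> aks_ideal n r u"
    if "i \<in> {1..<n}" "h \<in> aks_carrier n" for i h
    using that
    by (simp add: aks_T_def aks_class_mult mem_fT aks_class_uminus aks_simps(3) aks_class_eq_iff descent_sign_def fconst_minus)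
  show ?thesis
    unfolding aks_eta_def hecke_elem_class
  proof (rule the_equality)
    have "aks_class n r u (eta_elem n ?D) = aks_class n r u (hecke_elem n (eta_coeff n ?D \<circ> perm_inv))"
      by (simp only: eta_elem_def)
    moreover have "(eta_coeff n ?D \<circ> perm_inv) (longest_perm n) = 1"
      using eta_coeff_longest[OF D] by simp
    moreover have "\<forall>i\<in>{1..<n}. aks_T n r u i \<otimes>\<^bsub>aks n r u\<^esub> aks_class n r u (eta_elem n ?D) =
        (if i \<in> ?D then \<ominus>\<^bsub>aks n r u\<^esub> aks_class n r u (eta_elem n ?D) else \<zero>\<^bsub>aks n r u\<^esub>)"
      using eq[OF _ mem_eta_elem] T_eta_elem[OF D] by blast
    ultimately show "(\<exists>a. aks_class n r u (eta_elem n ?D) = aks_class n r u (hecke_elem n a) \<and> a (longest_perm n) = 1) \<and>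
        (\<forall>i\<in>{1..<n}. aks_T n r u i \<otimes>\<^bsub>aks n r u\<^esub> aks_class n r u (eta_elem n ?D) =
        (if i \<in> ?D then \<ominus>\<^bsub>aks n r u\<^esub> aks_class n r u (eta_elem n ?D) else \<zero>\<^bsub>aks n r u\<^esub>))"
      by blast
  next
    fix x assume x: "(\<exists>a. x = aks_class n r u (hecke_elem n a) \<and> a (longest_perm n) = 1) \<and>
        (\<forall>i\<in>{1..<n}. aks_T n r u i \<otimes>\<^bsub>aks n r u\<^esub> x =
        (if i \<in> ?D then \<ominus>\<^bsub>aks n r u\<^esub> x else \<zero>\<^bsub>aks n r u\<^esub>))"
    then obtain a where a: "x = aks_class n r u (hecke_elem n a)" "a (longest_perm n) = 1" by blast
    have "hecke_elem n a = eta_elem n ?D"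
      using x a eq[OF _ mem_hecke_elem, of _ a] by (intro hecke_elem_eigen_unique[OF assms]) auto
    thus "x = aks_class n r u (eta_elem n ?D)" using a by simp
  qed
qed

section \<open>Compositions and ribbons\<close>

lemma Des_Nil [simp]: "Des [] = {}"
  by (simp add: Des_def)

lemma Des_Cons: "Des (a # I) = (if I = [] then {} else insert a ((+) a ` Des I))"
proof (cases "I = []")
  case False
  have "Des (a # I) = insert a ((+) a ` Des I)"
  proof (intro equalityI subsetI)
    fix x assume "x \<in> Des (a # I)"
    then obtain k where k: "x = sum_list (take k (a # I))" "1 \<le> k" "k < Suc (length I)"
      by (auto simp: Des_def)
    obtain k' where k': "k = Suc k'" using k(2) by (cases k) auto
    show "x \<in> insert a ((+) a ` Des I)"
    proof (cases "k' = 0")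
      case False
      hence "sum_list (take k' I) \<in> Des I" using k k' unfolding Des_def by force
      then show ?thesis using k(1) k' by simp
    qed (use k k' in simp)
  next
    fix x assume "x \<in> insert a ((+) a ` Des I)"
    then consider "x = a" | k where "x = a + sum_list (take k I)" "1 \<le> k" "k < length I"
      by (auto simp: Des_def)
    then show "x \<in> Des (a # I)"
    proof cases
      case 1
      have "x = sum_list (take 1 (a # I))" using 1 by simp
      then show ?thesis using False unfolding Des_def by (intro CollectI exI[of _ 1]) simp
    next
      case 2
      have "x = sum_list (take (Suc k) (a # I))" using 2 by simp
      then show ?thesis using 2 unfolding Des_def by (intro CollectI exI[of _ "Suc k"]) simp
    qed
  qed
  then show ?thesis using False by simp
qed (auto simp: Des_def)

lemma Des_subset: "\<forall>i\<in>set I. 1 \<le> i \<Longrightarrow> Des I \<subseteq> {1..<sum_list I}"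
proof (induction I)
  case (Cons a I)
  have "1 \<le> sum_list I" if "I \<noteq> []" using that Cons.prems by (cases I) auto
  then show ?case using Cons by (auto simp: Des_Cons)
qed simp

lemma composition_Des_subset: "composition n I \<Longrightarrow> Des I \<subseteq> {1..<n}"
  using Des_subset[of I] by (simp add: composition_def)

text \<open>The least descent is the first part, and the other descents, shifted back by it, are
  those of the tail.\<close>

lemma composition_unique:
  "\<lbrakk>composition n I; composition n J; Des I = Des J\<rbrakk> \<Longrightarrow> I = J"
proof (induction I arbitrary: n J)
  case Nil
  then show ?case by (cases J) (auto simp: composition_def)
next
  case (Cons a I)
  then obtain b J' where J: "J = b # J'" by (cases J) (auto simp: composition_def)
  show ?case
  proof (cases "I = []")
    case True
    hence "J' = []" using Cons.prems J by (simp add: Des_Cons split: if_splits)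
    then show ?thesis using True Cons.prems J by (simp add: composition_def)
  next
    case False
    hence J': "J' \<noteq> []" using Cons.prems J by (auto simp: Des_Cons split: if_splits)
    have fin: "finite (Des K)" if "composition m K" for m K
      using composition_Des_subset[OF that] finite_subset by blast
    have cI: "composition (n - a) I" and cJ: "composition (n - b) J'"
      using Cons.prems J by (auto simp: composition_def)
    have "Min (Des (a # I)) = a"
      using fin[OF Cons.prems(1)] False by (intro Min_eqI) (auto simp: Des_Cons)
    moreover have "Min (Des (b # J')) = b"
      using fin[OF Cons.prems(2)] J J' by (intro Min_eqI) (auto simp: Des_Cons)
    ultimately have ab: "a = b" using Cons.prems J by simp
    have "a \<notin> (+) a ` Des I" "a \<notin> (+) a ` Des J'"
      using composition_Des_subset[OF cI] composition_Des_subset[OF cJ] by auto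
    moreover have "insert a ((+) a ` Des I) = insert a ((+) a ` Des J')"
      using Cons.prems(3) J J' False ab by (simp add: Des_Cons)
    ultimately have "(+) a ` Des I = (+) a ` Des J'" by (simp add: insert_ident)
    hence "Des I = Des J'" by (simp add: inj_image_eq_iff)
    then show ?thesis using Cons.IH[OF cI] cJ ab J by simp
  qed
qed

text \<open>The recursion of \<open>composition_unique\<close> read backwards: split off the least
  element of \<open>D\<close> as the first part and shift the rest.\<close>

lemma composition_exists:
  assumes "1 \<le> n" "D \<subseteq> {1..<n}"
  shows "\<exists>I. composition n I \<and> Des I = D"
  using assms
proof (induction n arbitrary: D rule: less_induct)
  case (less n)
  show ?case
  proof (cases "D = {}")
    case True
    then show ?thesis using less.prems by (intro exI[of _ "[n]"]) (auto simp: composition_def Des_Cons)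
  next
    case False
    have fin: "finite D" using less.prems(2) finite_subset by blast
    define m where "m = Min D"
    have m: "m \<in> D" "\<And>x. x \<in> D \<Longrightarrow> m \<le> x" using False fin by (auto simp: m_def)
    have mn: "1 \<le> m" "m < n" using m(1) less.prems(2) by auto
    define E where "E = (\<lambda>x. x - m) ` (D - {m})"
    have E: "E \<subseteq> {1..<n - m}"
    proof
      fix y assume "y \<in> E"
      then obtain x where x: "y = x - m" "x \<in> D" "x \<noteq> m" by (auto simp: E_def)
      hence "m < x" "x < n" using m(2)[of x] less.prems(2) by auto
      thus "y \<in> {1..<n - m}" using x by auto
    qed
    have DE: "insert m ((+) m ` E) = D"
    proof -
      have "(+) m ` E = (\<lambda>x. x) ` (D - {m})"
        unfolding E_def image_image by (intro image_cong refl) (use m(2) in auto)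
      thus ?thesis using m(1) by auto
    qed
    obtain I where I: "composition (n - m) I" "Des I = E"
      using less.IH[OF _ _ E] mn by force
    have "I \<noteq> []" using I(1) mn by (auto simp: composition_def)
    then show ?thesis
      using I mn DE by (intro exI[of _ "m # I"]) (auto simp: composition_def Des_Cons)
  qed
qed

section \<open>The involution \<phi>, and the ribbon elements as eigenvectors\<close>

definition phi_des :: "nat \<Rightarrow> nat set \<Rightarrow> nat list \<Rightarrow> nat set" where
  "phi_des n D c = {j \<in> D. color c j = color c (j + 1)} \<union> {j \<in> {1..<n} - D. color c j \<noteq> color c (j + 1)}"

lemma
  assumes "1 \<le> n" "composition n I"
  shows composition_ribbon_phi: "composition n (fst (ribbon_phi n (I, c)))"
    and Des_ribbon_phi: "Des (fst (ribbon_phi n (I, c))) = phi_des n (Des I) c"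
proof -
  let ?P = "\<lambda>I'. composition n I' \<and> Des I' = phi_des n (Des I) c"
  have "phi_des n (Des I) c \<subseteq> {1..<n}"
    using composition_Des_subset[OF assms(2)] by (auto simp: phi_des_def)
  hence "\<exists>I'. ?P I'" using composition_exists[OF assms(1)] by blast
  hence "\<exists>!I'. ?P I'" using composition_unique by metis
  from theI'[OF this] have "?P (THE I'. ?P I')" .
  moreover have "fst (ribbon_phi n (I, c)) = (THE I'. ?P I')"
    by (simp add: phi_des_def)
  ultimately show "composition n (fst (ribbon_phi n (I, c)))" "Des (fst (ribbon_phi n (I, c))) = phi_des n (Des I) c"
    by simp_all
qed

lemma anticycloribbon_ribbon_phi:
  assumes "1 \<le> n" "is_cycloribbon n r (I, c)"
  shows "is_anticycloribbon n r (ribbon_phi n (I, c))"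
proof -
  have I: "composition n I" using assms(2) by simp
  obtain I' where I': "ribbon_phi n (I, c) = (I', c)" by simp
  have "composition n I'" "Des I' = phi_des n (Des I) c"
    using composition_ribbon_phi[OF assms(1) I, of c] Des_ribbon_phi[OF assms(1) I, of c] unfolding I' by simp_all
  thus ?thesis using assms(2) unfolding I' by (force simp: phi_des_def)
qed

definition ribbon_elem :: "nat \<Rightarrow> nat \<Rightarrow> (nat \<Rightarrow> complex) \<Rightarrow> nat list \<Rightarrow> nat list \<Rightarrow> aks_free" where
  "ribbon_elem n r u I c = color_elem n r u (color c) * eta_elem n (Des I)"

lemma mem_ribbon_elem: "ribbon_elem n r u I c \<in> aks_carrier n"
  unfolding ribbon_elem_def by (intro mem_free_alg_on_mult mem_color_elem mem_eta_elem)

lemma aks_left_ideal_aks_ideal: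
  "\<lbrakk>inj_on u {1..r}; 1 \<le> r\<rbrakk> \<Longrightarrow> aks_left_ideal n r u (aks_ideal n r u)"
  by (simp add: aks_left_ideal_def aks_ideal_add aks_ideal_l)

lemma aks_eta_ribbon_eq:
  assumes "inj_on u {1..r}" "1 \<le> r" "composition n I"
  shows "aks_eta_ribbon n r u (I, c) = aks_class n r u (ribbon_elem n r u I c)"
proof -
  have "aks_L n r u c = aks_class n r u (color_elem n r u (color c))"
    by (simp only: aks_L_def color_elem_def)
  thus ?thesis
    by (simp add: aks_eta_eq[OF assms(1,2) composition_Des_subset[OF assms(3)]] ribbon_elem_def
        aks_class_mult mem_color_elem mem_eta_elem)
qed

lemma color_range:
  assumes "length c = n" "set c \<subseteq> {1..r}" "j \<in> {1..n}"
  shows "color c j \<in> {1..r}"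
proof -
  have "c ! (j - 1) \<in> set c" using assms by (intro nth_mem) auto
  thus ?thesis using assms(2) unfolding color_def by blast
qed

lemma color_elem_cong: "(\<And>j. j \<in> {1..n} \<Longrightarrow> d j = e j) \<Longrightarrow> color_elem n r u d = color_elem n r u e"
  unfolding color_elem_def by (intro arg_cong[where f = prod_list] map_cong refl) auto

lemma
  assumes "inj_on u {1..r}" "1 \<le> r" and Q: "is_cycloribbon n r (I, c)"
  shows ribbon_elem_notin: "ribbon_elem n r u I c \<notin> aks_ideal n r u"
    and Xi_ribbon_elem: "\<And>j. j \<in> {1..n} \<Longrightarrow>
      fXi j * ribbon_elem n r u I c - fconst (u (color c j)) * ribbon_elem n r u I c \<in> aks_ideal n r u"
    and T_ribbon_elem: "\<And>i. i \<in> {1..<n} \<Longrightarrow>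
      fT i * ribbon_elem n r u I c - fconst (descent_sign (phi_des n (Des I) c) i) * ribbon_elem n r u I c \<in> aks_ideal n r u"
proof -
  interpret J: aks_left_ideal n r u "aks_ideal n r u"
    by (rule aks_left_ideal_aks_ideal[OF assms(1,2)])
  have comp: "composition n I" and c: "length c = n" "set c \<subseteq> {1..r}" using Q by auto
  have D: "Des I \<subseteq> {1..<n}" by (rule composition_Des_subset[OF comp])
  \<comment> \<open>Restriction turns \<open>color c\<close>, whose values outside
    \<open>{1..n}\<close> are arbitrary, into a member of \<open>colorings n r\<close>.\<close>
  define d where "d = restrict (color c) {1..n}"
  have d: "d \<in> colorings n r"
    using color_range[OF c] by (auto simp: d_def colorings_def)
  have dj: "d j = color c j" if "j \<in> {1..n}" for j using that by (simp add: d_def)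
  let ?y = "eta_elem n (Des I)"
  have z: "ribbon_elem n r u I c = color_elem n r u d * ?y"
    unfolding ribbon_elem_def using color_elem_cong[of n "color c" d] dj by simp
  show "ribbon_elem n r u I c \<notin> aks_ideal n r u"
    unfolding ribbon_elem_def eta_elem_def
    by (rule color_elem_hecke_elem_notin_ideal[OF assms(1,2) color_range[OF c] longest_perm_permutes])
      (use eta_coeff_longest[OF D] in simp_all)
  show "fXi j * ribbon_elem n r u I c - fconst (u (color c j)) * ribbon_elem n r u I c \<in> aks_ideal n r u"
    if "j \<in> {1..n}" for j
    using J.weight_color_elem[OF d mem_eta_elem[of n "Des I"]] that dj[OF that]
    unfolding z J.weight_def J.eqK_def by metis
  show "fT i * ribbon_elem n r u I c - fconst (descent_sign (phi_des n (Des I) c) i) * ribbon_elem n r u I c \<in> aks_ideal n r u"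
    if i: "i \<in> {1..<n}" for i
  proof -
    let ?s = "d \<circ> adj i"
    let ?e = "descent_sign (Des I) i"
    have ij: "i \<in> {1..n}" "Suc i \<in> {1..n}" using i by auto
    have cyc: "i \<notin> Des I \<longrightarrow> d i \<le> d (Suc i)" "i \<in> Des I \<longrightarrow> d (Suc i) \<le> d i"
      using Q i dj[OF ij(1)] dj[OF ij(2)] by auto
    \<comment> \<open>At equal colors \<phi> keeps the descent status. At unequal ones it reverses
      it, and in a cycloribbon these are descents of \<open>I\<close> exactly where the color drops;
      so \<phi> has a descent there exactly where it rises.\<close>
    have sgn: "descent_sign (phi_des n (Des I) c) i =
        (if d i = d (Suc i) then ?e else - asc d i)"
      using cyc i dj[OF ij(1)] dj[OF ij(2)] by (auto simp: descent_sign_def phi_des_def asc_def)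
    have "J.eqK (fT i * ?y) (fconst ?e * ?y)"
      using T_eta_elem[OF D i] by (simp add: J.eqK_def)
    from J.T_color_elem[OF mem_eta_elem i this colorings_comp_adj[OF d i]]
    have E: "J.eqK (fT i * (color_elem n r u d * ?y))
        (fconst (?e + asc ?s i) * (color_elem n r u ?s * ?y) - fconst (asc d i) * (color_elem n r u d * ?y))"
      by simp
    have "J.eqK (fT i * (color_elem n r u d * ?y)) (fconst (descent_sign (phi_des n (Des I) c) i) * (color_elem n r u d * ?y))"
    proof (cases "d i = d (Suc i)")
      case True
      hence "?s = d" by (intro comp_adj_absorb) simp
      then show ?thesis using E True sgn by (simp add: asc_def)
    next
      case False
      \<comment> \<open>The coefficient of the neighbouring color word: \<open>-1 + 1\<close> where
        the color drops, which is a descent of \<open>I\<close>, and \<open>0 + 0\<close> where it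
        rises.\<close>
      hence "?e + asc ?s i = 0" using cyc by (auto simp: descent_sign_def asc_def)
      then show ?thesis using E False sgn by (simp add: fconst_minus)
    qed
    thus ?thesis by (simp add: z J.eqK_def)
  qed
qed

lemma cycloribbon_of_eigenvalues:
  assumes "1 \<le> n" "d \<in> colorings n r"
    and \<epsilon>: "\<And>i. i \<in> {1..<n} \<Longrightarrow> \<epsilon> i \<in> {0, - 1}"
    and neq: "\<And>i. \<lbrakk>i \<in> {1..<n}; d i \<noteq> d (Suc i)\<rbrakk> \<Longrightarrow> \<epsilon> i = - asc d i"
  obtains I c where "is_cycloribbon n r (I, c)" "\<And>j. j \<in> {1..n} \<Longrightarrow> color c j = d j"
    "\<And>i. i \<in> {1..<n} \<Longrightarrow> descent_sign (phi_des n (Des I) c) i = \<epsilon> i"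
proof -
  define c where "c = map d [1..<Suc n]"
  have len: "length c = n" by (simp add: c_def)
  have col: "color c j = d j" if "j \<in> {1..n}" for j
    using that by (auto simp: color_def c_def simp del: upt_Suc)
  have "set c \<subseteq> {1..r}"
    unfolding c_def set_map set_upt_Suc using colorings_range[OF assms(2)] by blast
  \<comment> \<open>\<phi> undone: at equal colors a descent means eigenvalue -1, while at unequal
    colors the eigenvalue is \<open>- asc d i\<close>, and \<open>\<epsilon> i = 0\<close> singles
    out the places where the color drops.\<close>
  define D where "D = {i \<in> {1..<n}. if d i = d (Suc i) then \<epsilon> i = - 1 else \<epsilon> i = 0}"
  obtain I where I: "composition n I" "Des I = D"
    using composition_exists[OF assms(1), of D] unfolding D_def by blast
  have ci: "color c i = d i" "color c (i + 1) = d (Suc i)" if "i \<in> {1..<n}" for i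
    using that col[of i] col[of "Suc i"] by auto
  have "is_cycloribbon n r (I, c)"
    unfolding is_cycloribbon.simps is_colored_ribbon.simps
  proof (intro conjI ballI impI I len)
    fix j assume j: "j \<in> {1..<n}"
    show "color c j \<le> color c (j + 1)" if "j \<notin> Des I"
      using that neq[OF j] j I unfolding ci[OF j] by (cases "d j = d (Suc j)") (auto simp: D_def asc_def split: if_splits)
    show "color c (j + 1) \<le> color c j" if "j \<in> Des I"
      using that neq[OF j] j I unfolding ci[OF j] by (cases "d j = d (Suc j)") (auto simp: D_def asc_def split: if_splits)
  qed fact
  moreover have "descent_sign (phi_des n (Des I) c) i = \<epsilon> i" if i: "i \<in> {1..<n}" for i
    unfolding descent_sign_def phi_des_def I(2) using \<epsilon>[OF i] i ci[OF i] by (auto simp: D_def)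
  ultimately show ?thesis using that col by blast
qed

section \<open>One-dimensional modules\<close>

lemma (in vectorspace) dim_line:
  assumes z: "z \<in> carrier V" "z \<noteq> \<zero>\<^bsub>V\<^esub>" and line: "\<And>x. x \<in> carrier V \<Longrightarrow> \<exists>k\<in>carrier K. x = k \<odot>\<^bsub>V\<^esub> z"
  shows "fin_dim \<and> dim = 1"
proof -
  have lc: "lincomb a {z} = a z \<odot>\<^bsub>V\<^esub> z" if "a z \<in> carrier K" for a
    using that z by (simp add: lincomb_def)
  have gen: "gen_set {z}"
  proof
    show "span {z} \<subseteq> carrier V" using z by (intro span_is_subset2) simp
    show "carrier V \<subseteq> span {z}"
    proof
      fix x assume "x \<in> carrier V"
      then obtain k where k: "k \<in> carrier K" "x = k \<odot>\<^bsub>V\<^esub> z" using line by blast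
      hence "x = lincomb (\<lambda>_. k) {z}" using lc[of "\<lambda>_. k"] by simp
      thus "x \<in> span {z}" unfolding span_def using k by blast
    qed
  qed
  have "lin_indpt {z}"
  proof (rule finite_lin_indpt2)
    fix a assume a: "a \<in> {z} \<rightarrow> carrier K" and 0: "lincomb a {z} = \<zero>\<^bsub>V\<^esub>"
    hence az: "a z \<in> carrier K" "a z \<odot>\<^bsub>V\<^esub> z = \<zero>\<^bsub>V\<^esub>" using lc[of a] by auto
    have "a z = \<zero>\<^bsub>K\<^esub>"
    proof (rule ccontr)
      assume "a z \<noteq> \<zero>\<^bsub>K\<^esub>"
      hence u: "a z \<in> Units K" using az(1) by (simp add: field_Units)
      have "z = (inv\<^bsub>K\<^esub> (a z) \<otimes>\<^bsub>K\<^esub> a z) \<odot>\<^bsub>V\<^esub> z" using u z(1) by simp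
      also have "\<dots> = inv\<^bsub>K\<^esub> (a z) \<odot>\<^bsub>V\<^esub> (a z \<odot>\<^bsub>V\<^esub> z)"
        using u z(1) az(1) by (intro smult_assoc1) auto
      also have "\<dots> = \<zero>\<^bsub>V\<^esub>" using u unfolding az(2) by simp
      finally show False using z(2) by simp
    qed
    thus "\<forall>v\<in>{z}. a v = \<zero>\<^bsub>K\<^esub>" by simp
  qed (use z in auto)
  hence "basis {z}" unfolding basis_def using gen z by simp
  hence "dim = card {z}" by (intro dim_basis) auto
  moreover have fin_dim unfolding fin_dim_def using gen z by (intro exI[of _ "{z}"]) simp
  ultimately show ?thesis by simp
qed

section \<open>Left modules, their submodules and scalars\<close>

lemma module_submodule_iff:
  "Module.submodule N R M \<longleftrightarrow>
    subgroup N (add_monoid M) \<and> (\<forall>a\<in>carrier R. \<forall>x\<in>N. a \<odot>\<^bsub>M\<^esub> x \<in> N)"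
  by (simp add: Module.submodule_def Module.submodule_axioms_def Ball_def)

lemma (in left_module) lsmult_r_zero: "a \<in> carrier R \<Longrightarrow> a \<odot>\<^bsub>M\<^esub> \<zero>\<^bsub>M\<^esub> = \<zero>\<^bsub>M\<^esub>"
  using lsmult_r_distr[of a "\<zero>\<^bsub>M\<^esub>" "\<zero>\<^bsub>M\<^esub>"] lsmult_closed[of a "\<zero>\<^bsub>M\<^esub>"]
    M.add.l_cancel_one'[of "a \<odot>\<^bsub>M\<^esub> \<zero>\<^bsub>M\<^esub>" "a \<odot>\<^bsub>M\<^esub> \<zero>\<^bsub>M\<^esub>"] by simp

lemma (in left_module) lsmult_l_zero: "x \<in> carrier M \<Longrightarrow> \<zero>\<^bsub>R\<^esub> \<odot>\<^bsub>M\<^esub> x = \<zero>\<^bsub>M\<^esub>"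
  using lsmult_l_distr[of "\<zero>\<^bsub>R\<^esub>" "\<zero>\<^bsub>R\<^esub>" x] lsmult_closed[of "\<zero>\<^bsub>R\<^esub>" x]
    M.add.l_cancel_one'[of "\<zero>\<^bsub>R\<^esub> \<odot>\<^bsub>M\<^esub> x" "\<zero>\<^bsub>R\<^esub> \<odot>\<^bsub>M\<^esub> x"] by simp

lemma (in left_module) submodule_cyclic:
  assumes x: "x \<in> carrier M"
  shows "Module.submodule ((\<lambda>a. a \<odot>\<^bsub>M\<^esub> x) ` carrier R) R M"
proof -
  let ?N = "(\<lambda>a. a \<odot>\<^bsub>M\<^esub> x) ` carrier R"
  have "subgroup ?N (add_monoid M)"
  proof (rule M.add.subgroupI)
    show "?N \<subseteq> carrier M" using x lsmult_closed by auto
    show "?N \<noteq> {}" using R.zero_closed by blast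
  next
    fix y assume "y \<in> ?N"
    then obtain a where a: "a \<in> carrier R" "y = a \<odot>\<^bsub>M\<^esub> x" by blast
    have "(\<ominus>\<^bsub>R\<^esub> a) \<odot>\<^bsub>M\<^esub> x \<oplus>\<^bsub>M\<^esub> y = \<zero>\<^bsub>M\<^esub>"
      using a x lsmult_l_distr[of "\<ominus>\<^bsub>R\<^esub> a" a x] by (simp add: R.l_neg lsmult_l_zero)
    hence "\<ominus>\<^bsub>M\<^esub> y = (\<ominus>\<^bsub>R\<^esub> a) \<odot>\<^bsub>M\<^esub> x"
      using a x lsmult_closed by (intro M.minus_equality) auto
    thus "\<ominus>\<^bsub>M\<^esub> y \<in> ?N" using a by blast
  next
    fix y y' assume "y \<in> ?N" "y' \<in> ?N"
    then obtain a a' where "a \<in> carrier R" "y = a \<odot>\<^bsub>M\<^esub> x" "a' \<in> carrier R" "y' = a' \<odot>\<^bsub>M\<^esub> x" by blast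
    thus "y \<oplus>\<^bsub>M\<^esub> y' \<in> ?N" using x lsmult_l_distr[of a a' x, symmetric] by (auto intro: imageI)
  qed
  moreover have "a \<odot>\<^bsub>M\<^esub> y \<in> ?N" if "a \<in> carrier R" "y \<in> ?N" for a y
    using that x lsmult_assoc[of a _ x, symmetric] by (auto intro!: imageI)
  ultimately show ?thesis
    unfolding module_submodule_iff by blast
qed

lemma (in left_module) left_module_submodule:
  assumes N: "Module.submodule N R M"
  shows "left_module R (M\<lparr>carrier := N\<rparr>)"
proof -
  have sub: "subgroup N (add_monoid M)" and cl: "\<And>a x. a \<in> carrier R \<Longrightarrow> x \<in> N \<Longrightarrow> a \<odot>\<^bsub>M\<^esub> x \<in> N"
    using N unfolding module_submodule_iff by blast+
  have NM: "x \<in> carrier M" if "x \<in> N" for x using subgroup.subset[OF sub] that by auto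
  have "abelian_group (M\<lparr>carrier := N\<rparr>)"
  proof (rule abelian_groupI)
    fix x assume x: "x \<in> carrier (M\<lparr>carrier := N\<rparr>)"
    have "\<ominus>\<^bsub>M\<^esub> x \<in> N" using subgroup.m_inv_closed[OF sub, of x] x by (simp add: a_inv_def)
    thus "\<exists>y\<in>carrier (M\<lparr>carrier := N\<rparr>). y \<oplus>\<^bsub>M\<lparr>carrier := N\<rparr>\<^esub> x = \<zero>\<^bsub>M\<lparr>carrier := N\<rparr>\<^esub>"
      using x NM by (intro bexI[of _ "\<ominus>\<^bsub>M\<^esub> x"]) (auto simp: M.l_neg)
  qed (use subgroup.m_closed[OF sub] subgroup.one_closed[OF sub] in \<open>auto simp: NM M.a_ac\<close>)
  thus ?thesis
    by (intro left_module.intro left_module_axioms.intro R.ring_axioms)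
      (auto simp: cl NM lsmult_l_distr lsmult_r_distr lsmult_assoc lsmult_one)
qed

lemma left_module_left_regular:
  assumes "ring R"
  shows "left_module R (left_regular R)"
proof -
  interpret ring R by fact
  have "abelian_group (left_regular R)"
    by (rule abelian_groupI) (auto simp: left_regular_def a_ac intro!: bexI[of _ "\<ominus>\<^bsub>R\<^esub> x" for x] l_neg)
  thus ?thesis
    by (intro left_module.intro left_module_axioms.intro assms)
      (auto simp: left_regular_def l_distr r_distr m_assoc)
qed

lemma aks_const_simps:
  "aks_const n r u a \<in> carrier (aks n r u)"
  "aks_const n r u a \<oplus>\<^bsub>aks n r u\<^esub> aks_const n r u b = aks_const n r u (a + b)"
  "aks_const n r u a \<otimes>\<^bsub>aks n r u\<^esub> aks_const n r u b = aks_const n r u (a * b)"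
  "aks_const n r u 1 = \<one>\<^bsub>aks n r u\<^esub>"
  "aks_const n r u 0 = \<zero>\<^bsub>aks n r u\<^esub>"
  by (simp_all add: aks_const_def aks_class_add aks_class_mult mem_free_alg_on_const fconst_add fconst_mult aks_simps(2,3))

lemma aks_const_commute:
  "a \<in> carrier (aks n r u) \<Longrightarrow>
    a \<otimes>\<^bsub>aks n r u\<^esub> aks_const n r u z = aks_const n r u z \<otimes>\<^bsub>aks n r u\<^esub> a"
  by (auto simp: aks_simps(1) aks_const_def aks_class_mult mem_free_alg_on_const fconst_commute)

lemma vectorspace_aks_vspace:
  assumes "left_module (aks n r u) M"
  shows "vectorspace class_ring (aks_vspace n r u M)"
proof -
  interpret left_module "aks n r u" M by fact
  have ag: "abelian_group (aks_vspace n r u M)"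
    by (rule abelian_groupI) (auto simp: aks_vspace_def M.a_ac intro!: bexI[of _ "\<ominus>\<^bsub>M\<^esub> x" for x] M.l_neg)
  have "Module.module class_ring (aks_vspace n r u M)"
    by (intro Module.module.intro Module.module_axioms.intro fieldE(1)[OF class_field] ag)
      (auto simp: aks_vspace_def aks_const_simps lsmult_closed lsmult_r_distr lsmult_one
        lsmult_l_distr[symmetric] lsmult_assoc[symmetric])
  thus ?thesis by (intro vectorspace.intro class_field)
qed

text \<open>The homomorphism from the free algebra to the complex numbers with prescribed values on
  the generators. As an action on functions on a one-point set it inherits multiplicativity from
  \<open>act_mult\<close>.\<close>

definition character :: "('g \<Rightarrow> complex) \<Rightarrow> 'g free_alg \<Rightarrow> complex" where
  "character \<chi> p = act (\<lambda>g F x. \<chi> g * F x) p (\<lambda>_. 1) ()"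

lemma linear_action_character: "linear_action (\<lambda>g F (x::unit). \<chi> g * F x)"
  by standard (simp_all add: fun_eq_iff algebra_simps)

lemma character_simps:
  "character \<chi> (fconst z) = z"
  "character \<chi> (p + q) = character \<chi> p + character \<chi> q"
  "character \<chi> (fgen g * q) = \<chi> g * character \<chi> q"
proof -
  show "character \<chi> (fconst z) = z" by (simp add: character_def act_const)
  show "character \<chi> (p + q) = character \<chi> p + character \<chi> q" by (simp add: character_def act_add)
  show "character \<chi> (fgen g * q) = \<chi> g * character \<chi> q"
    by (simp only: character_def linear_action.act_mult[OF linear_action_character] act_gen)
qed

text \<open>Both the ribbon modules and an arbitrary simple module are shown to be of this form, so
  simplicity, dimension and isomorphism are settled once. The values of \<chi> on the generators in
  \<open>aks_gens n\<close> determine the isomorphism class.\<close>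

locale aks_line = left_module "aks n r u" M
  for n r :: nat and u :: "nat \<Rightarrow> complex" and M :: "(aks_free set, 'm) module" +
  fixes z :: 'm and \<chi> :: "aks_gen \<Rightarrow> complex"
  assumes z: "z \<in> carrier M" and z_nonzero: "z \<noteq> \<zero>\<^bsub>M\<^esub>"
    and carrier_cyclic: "carrier M = (\<lambda>a. a \<odot>\<^bsub>M\<^esub> z) ` carrier (aks n r u)"
    and eigen: "g \<in> aks_gens n \<Longrightarrow> aks_class n r u (fgen g) \<odot>\<^bsub>M\<^esub> z = aks_const n r u (\<chi> g) \<odot>\<^bsub>M\<^esub> z"
begin

abbreviation const where "const \<equiv> aks_const n r u"

lemma const_mult: "x \<in> carrier M \<Longrightarrow> const a \<odot>\<^bsub>M\<^esub> (const b \<odot>\<^bsub>M\<^esub> x) = const (a * b) \<odot>\<^bsub>M\<^esub> x"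
  by (simp add: lsmult_assoc[symmetric] aks_const_simps)

lemma const_swap:
  "\<lbrakk>a \<in> carrier (aks n r u); x \<in> carrier M\<rbrakk> \<Longrightarrow>
    a \<odot>\<^bsub>M\<^esub> (const b \<odot>\<^bsub>M\<^esub> x) = const b \<odot>\<^bsub>M\<^esub> (a \<odot>\<^bsub>M\<^esub> x)"
  by (simp add: lsmult_assoc[symmetric] aks_const_simps aks_const_commute)

lemma class_action: "p \<in> aks_carrier n \<Longrightarrow> aks_class n r u p \<odot>\<^bsub>M\<^esub> z = const (character \<chi> p) \<odot>\<^bsub>M\<^esub> z"
proof (induction p rule: free_alg_on_induct)
  case (const c)
  then show ?case by (simp add: character_simps aks_const_def)
next
  case (gen g q)
  have "aks_class n r u (fgen g * q) \<odot>\<^bsub>M\<^esub> z = aks_class n r u (fgen g) \<odot>\<^bsub>M\<^esub> (aks_class n r u q \<odot>\<^bsub>M\<^esub> z)"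
    using gen z by (simp add: aks_class_mult[symmetric] mem_free_alg_on_gen lsmult_assoc)
  also have "\<dots> = const (character \<chi> q) \<odot>\<^bsub>M\<^esub> (const (\<chi> g) \<odot>\<^bsub>M\<^esub> z)"
    using gen z by (simp add: const_swap mem_free_alg_on_gen eigen)
  also have "\<dots> = const (character \<chi> (fgen g * q)) \<odot>\<^bsub>M\<^esub> z"
    using z by (simp add: const_mult character_simps mult.commute)
  finally show ?case .
next
  case (add p q)
  then show ?case
    using z by (simp add: aks_class_add[symmetric] lsmult_l_distr character_simps aks_const_simps(1) aks_const_simps(2)[symmetric])
qed

lemma carrier_line: "carrier M = range (\<lambda>c. const c \<odot>\<^bsub>M\<^esub> z)"
proof
  show "carrier M \<subseteq> range (\<lambda>c. const c \<odot>\<^bsub>M\<^esub> z)"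
    unfolding carrier_cyclic aks_simps(1) using class_action by auto
qed (auto simp: lsmult_closed z aks_const_simps)

lemma const_eq_zero_iff: "const c \<odot>\<^bsub>M\<^esub> z = \<zero>\<^bsub>M\<^esub> \<longleftrightarrow> c = 0"
proof
  assume 0: "const c \<odot>\<^bsub>M\<^esub> z = \<zero>\<^bsub>M\<^esub>"
  show "c = 0"
  proof (rule ccontr)
    assume "c \<noteq> 0"
    hence "z = const (1 / c) \<odot>\<^bsub>M\<^esub> (const c \<odot>\<^bsub>M\<^esub> z)"
      using z by (simp add: const_mult aks_const_simps lsmult_one)
    thus False using z_nonzero by (simp add: 0 lsmult_r_zero aks_const_simps)
  qed
qed (simp add: aks_const_simps lsmult_l_zero z)

lemma const_inject: "const a \<odot>\<^bsub>M\<^esub> z = const b \<odot>\<^bsub>M\<^esub> z \<Longrightarrow> a = b"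
proof -
  assume e: "const a \<odot>\<^bsub>M\<^esub> z = const b \<odot>\<^bsub>M\<^esub> z"
  have "const (a - b) \<odot>\<^bsub>M\<^esub> z \<oplus>\<^bsub>M\<^esub> const b \<odot>\<^bsub>M\<^esub> z = \<zero>\<^bsub>M\<^esub> \<oplus>\<^bsub>M\<^esub> const b \<odot>\<^bsub>M\<^esub> z"
    using z e by (simp add: lsmult_l_distr[symmetric] aks_const_simps lsmult_closed)
  hence "const (a - b) \<odot>\<^bsub>M\<^esub> z = \<zero>\<^bsub>M\<^esub>"
    using z by (simp add: aks_const_simps lsmult_closed)
  thus "a = b" by (simp add: const_eq_zero_iff)
qed

lemma generator_action:
  assumes "g \<in> aks_gens n" "x \<in> carrier M"
  shows "aks_class n r u (fgen g) \<odot>\<^bsub>M\<^esub> x = const (\<chi> g) \<odot>\<^bsub>M\<^esub> x"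
proof -
  obtain c where "x = const c \<odot>\<^bsub>M\<^esub> z" using assms(2) carrier_line by auto
  thus ?thesis
    using assms(1) z eigen by (simp add: const_swap mem_free_alg_on_gen const_mult mult.commute)
qed

lemma simple: "simple_left_module (aks n r u) M"
  unfolding simple_left_module_def
proof (intro conjI allI impI left_module_axioms)
  show "carrier M \<noteq> {\<zero>\<^bsub>M\<^esub>}" using z z_nonzero by auto
next
  fix N assume N: "Module.submodule N (aks n r u) M"
  have sub: "subgroup N (add_monoid M)" and cl: "\<And>a x. a \<in> carrier (aks n r u) \<Longrightarrow> x \<in> N \<Longrightarrow> a \<odot>\<^bsub>M\<^esub> x \<in> N"
    using N unfolding module_submodule_iff by blast+
  have NM: "N \<subseteq> carrier M" and N0: "\<zero>\<^bsub>M\<^esub> \<in> N"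
    using subgroup.subset[OF sub] subgroup.one_closed[OF sub] by auto
  show "N = {\<zero>\<^bsub>M\<^esub>} \<or> N = carrier M"
  proof (cases "N = {\<zero>\<^bsub>M\<^esub>}")
    case False
    then obtain x where x: "x \<in> N" "x \<noteq> \<zero>\<^bsub>M\<^esub>" using N0 by blast
    then obtain c where c: "x = const c \<odot>\<^bsub>M\<^esub> z" using NM carrier_line by auto
    have "c \<noteq> 0" using x c const_eq_zero_iff by auto
    hence "z = const (1 / c) \<odot>\<^bsub>M\<^esub> x" using z by (simp add: c const_mult aks_const_simps lsmult_one)
    hence "z \<in> N" using cl[OF aks_const_simps(1) x(1)] by metis
    hence "carrier M \<subseteq> N" unfolding carrier_cyclic using cl by auto
    then show ?thesis using NM by blast
  qed simp
qed

lemma has_dim_1: "aks_has_dim n r u M 1"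
proof -
  have vs: "vectorspace class_ring (aks_vspace n r u M)"
    by (rule vectorspace_aks_vspace[OF left_module_axioms])
  have "vectorspace.fin_dim class_ring (aks_vspace n r u M) \<and> vectorspace.dim class_ring (aks_vspace n r u M) = 1"
    by (rule vectorspace.dim_line[OF vs, of z]) (use z z_nonzero carrier_line in \<open>auto simp: aks_vspace_def\<close>)
  thus ?thesis unfolding aks_has_dim_def using vs by blast
qed

end

lemma aks_line_iso:
  assumes "aks_line n r u M z \<chi>" "aks_line n r u M' z' \<chi>"
  shows "left_module_iso (aks n r u) M M'"
proof -
  interpret M: aks_line n r u M z \<chi> by fact
  interpret M': aks_line n r u M' z' \<chi> by fact
  \<comment> \<open>The linear map sending \<open>z\<close> to \<open>z'\<close>;
    \<open>const_inject\<close> makes the coordinate on the line unique. It commutes with the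
    algebra because both sides act through \<open>character \<chi>\<close>.\<close>
  define f where "f = (\<lambda>x. aks_const n r u (THE c. x = aks_const n r u c \<odot>\<^bsub>M\<^esub> z) \<odot>\<^bsub>M'\<^esub> z')"
  have f: "f (aks_const n r u c \<odot>\<^bsub>M\<^esub> z) = aks_const n r u c \<odot>\<^bsub>M'\<^esub> z'" for c
  proof -
    have "(THE d. aks_const n r u c \<odot>\<^bsub>M\<^esub> z = aks_const n r u d \<odot>\<^bsub>M\<^esub> z) = c"
      using M.const_inject by blast
    thus ?thesis by (simp add: f_def)
  qed
  have "bij_betw f (carrier M) (carrier M')"
    unfolding bij_betw_def
  proof
    show "inj_on f (carrier M)"
      by (rule inj_onI) (auto simp: M.carrier_line f dest: M'.const_inject)
    show "f ` carrier M = carrier M'"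
      by (simp add: M.carrier_line M'.carrier_line image_image f)
  qed
  moreover have "f (x \<oplus>\<^bsub>M\<^esub> y) = f x \<oplus>\<^bsub>M'\<^esub> f y" if xy: "x \<in> carrier M" "y \<in> carrier M" for x y
  proof -
    obtain a b where ab: "x = aks_const n r u a \<odot>\<^bsub>M\<^esub> z" "y = aks_const n r u b \<odot>\<^bsub>M\<^esub> z"
      using xy unfolding M.carrier_line by blast
    have "x \<oplus>\<^bsub>M\<^esub> y = aks_const n r u (a + b) \<odot>\<^bsub>M\<^esub> z"
      using M.z by (simp add: ab M.lsmult_l_distr[symmetric] aks_const_simps)
    thus ?thesis
      using M'.z by (simp add: ab f M'.lsmult_l_distr[symmetric] aks_const_simps)
  qed
  moreover have "f (a \<odot>\<^bsub>M\<^esub> x) = a \<odot>\<^bsub>M'\<^esub> f x" if ax: "a \<in> carrier (aks n r u)" "x \<in> carrier M" for a x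
  proof -
    obtain c where c: "x = aks_const n r u c \<odot>\<^bsub>M\<^esub> z"
      using ax(2) unfolding M.carrier_line by blast
    obtain p where p: "p \<in> aks_carrier n" "a = aks_class n r u p"
      using ax(1) unfolding aks_simps by blast
    have "a \<odot>\<^bsub>M\<^esub> x = aks_const n r u (c * character \<chi> p) \<odot>\<^bsub>M\<^esub> z"
      using p M.z by (simp add: c M.const_swap M.class_action M.const_mult)
    moreover have "a \<odot>\<^bsub>M'\<^esub> f x = aks_const n r u (c * character \<chi> p) \<odot>\<^bsub>M'\<^esub> z'"
      using p M'.z by (simp add: c f M'.const_swap M'.class_action M'.const_mult)
    ultimately show ?thesis by (simp add: f)
  qed
  ultimately show ?thesis unfolding left_module_iso_def by blast
qed

text \<open>A generator acts by one scalar on the whole line, so it can be compared at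
  \<open>z'\<close> and at the preimage of \<open>z'\<close>, wherever that lies.\<close>

lemma aks_line_iso_eigenvalues:
  assumes "aks_line n r u M z \<chi>" "aks_line n r u M' z' \<chi>'" "left_module_iso (aks n r u) M M'"
    and g: "g \<in> aks_gens n"
  shows "\<chi> g = \<chi>' g"
proof -
  interpret M: aks_line n r u M z \<chi> by fact
  interpret M': aks_line n r u M' z' \<chi>' by fact
  obtain f where bij: "bij_betw f (carrier M) (carrier M')"
    and hom: "\<And>a x. \<lbrakk>a \<in> carrier (aks n r u); x \<in> carrier M\<rbrakk> \<Longrightarrow> f (a \<odot>\<^bsub>M\<^esub> x) = a \<odot>\<^bsub>M'\<^esub> f x"
    using assms(3) unfolding left_module_iso_def by blast
  have "z' \<in> f ` carrier M" using bij M'.z by (simp add: bij_betw_def)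
  then obtain x where x: "x \<in> carrier M" "f x = z'" by blast
  have "aks_const n r u (\<chi> g) \<odot>\<^bsub>M'\<^esub> z' = f (aks_const n r u (\<chi> g) \<odot>\<^bsub>M\<^esub> x)"
    using hom[OF aks_const_simps(1) x(1)] x(2) by simp
  also have "\<dots> = f (aks_class n r u (fgen g) \<odot>\<^bsub>M\<^esub> x)"
    by (simp only: M.generator_action[OF g x(1)])
  also have "\<dots> = aks_class n r u (fgen g) \<odot>\<^bsub>M'\<^esub> z'"
    using hom[of "aks_class n r u (fgen g)" x] x g by (simp add: mem_free_alg_on_gen)
  also have "\<dots> = aks_const n r u (\<chi>' g) \<odot>\<^bsub>M'\<^esub> z'"
    by (rule M'.eigen[OF g])
  finally show ?thesis by (rule M'.const_inject)
qed

section \<open>The simple modules\<close>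

lemma (in left_module) lsmult_minus_one: "x \<in> carrier M \<Longrightarrow> (\<ominus>\<^bsub>R\<^esub> \<one>\<^bsub>R\<^esub>) \<odot>\<^bsub>M\<^esub> x = \<ominus>\<^bsub>M\<^esub> x"
  using lsmult_l_distr[of "\<ominus>\<^bsub>R\<^esub> \<one>\<^bsub>R\<^esub>" "\<one>\<^bsub>R\<^esub>" x] lsmult_closed[of "\<ominus>\<^bsub>R\<^esub> \<one>\<^bsub>R\<^esub>" x]
  by (intro M.minus_equality[symmetric]) (simp_all add: R.l_neg lsmult_l_zero lsmult_one)

lemma (in left_module) submodule_restrict:
  assumes N: "Module.submodule N R M" and L: "Module.submodule L R M" "L \<subseteq> N"
  shows "Module.submodule L R (M\<lparr>carrier := N\<rparr>)"
proof -
  interpret N: left_module R "M\<lparr>carrier := N\<rparr>" by (rule left_module_submodule[OF N])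
  have sub: "subgroup L (add_monoid M)" and cl: "\<And>a x. a \<in> carrier R \<Longrightarrow> x \<in> L \<Longrightarrow> a \<odot>\<^bsub>M\<^esub> x \<in> L"
    using L(1) unfolding module_submodule_iff by blast+
  have "subgroup L (add_monoid (M\<lparr>carrier := N\<rparr>))"
  proof (rule N.M.add.subgroupI)
    show "L \<subseteq> carrier (M\<lparr>carrier := N\<rparr>)" using L(2) by simp
    show "L \<noteq> {}" using subgroup.one_closed[OF sub] by blast
    \<comment> \<open>Negation in the restricted record is a different operation from that of
      \<open>M\<close>; as multiplication by minus one it is covered by the stability of
      \<open>L\<close> under scalars.\<close>
    show "\<ominus>\<^bsub>M\<lparr>carrier := N\<rparr>\<^esub> x \<in> L" if "x \<in> L" for x
      using N.lsmult_minus_one[of x] cl[of "\<ominus>\<^bsub>R\<^esub> \<one>\<^bsub>R\<^esub>" x] that L(2) by auto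
    show "x \<oplus>\<^bsub>M\<lparr>carrier := N\<rparr>\<^esub> y \<in> L" if "x \<in> L" "y \<in> L" for x y
      using subgroup.m_closed[OF sub, of x y] that by simp
  qed
  thus ?thesis unfolding module_submodule_iff using cl by simp
qed

section \<open>The ribbon modules and the classification\<close>

definition ribbon_char :: "nat \<Rightarrow> (nat \<Rightarrow> complex) \<Rightarrow> nat list \<Rightarrow> nat list \<Rightarrow> aks_gen \<Rightarrow> complex" where
  "ribbon_char n u I c g =
     (case g of GenT i \<Rightarrow> descent_sign (phi_des n (Des I) c) i | GenXi j \<Rightarrow> u (color c j))"

lemma aks_S_eq:
  assumes "inj_on u {1..r}" "1 \<le> r" "composition n I"
  shows "aks_S n r u (I, c) = (left_regular (aks n r u))
    \<lparr>carrier := (\<lambda>a. a \<odot>\<^bsub>left_regular (aks n r u)\<^esub> aks_class n r u (ribbon_elem n r u I c)) ` carrier (aks n r u)\<rparr>"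
  unfolding aks_S_def principal_left_ideal_def aks_eta_ribbon_eq[OF assms]
  by (simp add: left_regular_def)

lemma
  assumes u: "inj_on u {1..r}" "1 \<le> r" and Q: "is_cycloribbon n r (I, c)"
  shows aks_line_aks_S:
      "aks_line n r u (aks_S n r u (I, c)) (aks_class n r u (ribbon_elem n r u I c)) (ribbon_char n u I c)"
    and minimal_left_ideal_aks_S: "minimal_left_ideal (carrier (aks_S n r u (I, c))) (aks n r u)"
proof -
  let ?A = "aks n r u" and ?z = "ribbon_elem n r u I c" and ?S = "aks_S n r u (I, c)"
  have comp: "composition n I" using Q by simp
  interpret A: ring ?A by (rule ring_aks)
  interpret L: left_module ?A "left_regular ?A" by (rule left_module_left_regular[OF ring_aks])
  have zc: "aks_class n r u ?z \<in> carrier (left_regular ?A)"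
    by (simp add: left_regular_def mem_ribbon_elem)
  note S = aks_S_eq[OF u comp, of c]
  have sub: "Module.submodule (carrier ?S) ?A (left_regular ?A)"
    unfolding S using L.submodule_cyclic[OF zc] by simp
  have SL: "?S = (left_regular ?A)\<lparr>carrier := carrier ?S\<rparr>" unfolding S by simp
  have lm: "left_module ?A ?S"
    using L.left_module_submodule[OF sub] SL by simp
  have ops: "x \<odot>\<^bsub>?S\<^esub> y = x \<otimes>\<^bsub>?A\<^esub> y" "\<zero>\<^bsub>?S\<^esub> = \<zero>\<^bsub>?A\<^esub>" for x y
    by (simp_all add: S left_regular_def)
  have car: "carrier ?S = (\<lambda>a. a \<odot>\<^bsub>?S\<^esub> aks_class n r u ?z) ` carrier ?A"
    by (simp add: S left_regular_def)
  have nz: "aks_class n r u ?z \<noteq> \<zero>\<^bsub>?A\<^esub>"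
    using ribbon_elem_notin[OF u Q] by (simp add: aks_simps(3) aks_class_eq_iff)
  have eig: "aks_class n r u (fgen g) \<odot>\<^bsub>?S\<^esub> aks_class n r u ?z = aks_const n r u (ribbon_char n u I c g) \<odot>\<^bsub>?S\<^esub> aks_class n r u ?z"
    if g: "g \<in> aks_gens n" for g
  proof -
    have "fgen g * ?z - fconst (ribbon_char n u I c g) * ?z \<in> aks_ideal n r u"
      using g Xi_ribbon_elem[OF u Q] T_ribbon_elem[OF u Q]
      by (cases g) (auto simp: aks_gens_def ribbon_char_def)
    thus ?thesis
      using g by (simp add: ops aks_const_def aks_class_mult mem_ribbon_elem mem_free_alg_on_const mem_free_alg_on_gen aks_class_eq_iff)
  qed
  have one: "aks_class n r u ?z \<in> carrier ?S"
    unfolding car ops using A.l_one[of "aks_class n r u ?z"] A.one_closed mem_ribbon_elem[of n r u I c]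
    by (intro image_eqI[of _ _ "\<one>\<^bsub>?A\<^esub>"]) simp_all
  show line: "aks_line n r u ?S (aks_class n r u ?z) (ribbon_char n u I c)"
    using lm one nz car eig ops(2) by (intro aks_line.intro aks_line_axioms.intro) simp_all
  show "minimal_left_ideal (carrier ?S) ?A"
    unfolding minimal_left_ideal_def left_ideal_def
  proof (intro conjI allI impI)
    show "carrier ?S \<noteq> {\<zero>\<^bsub>?A\<^esub>}" using one nz by blast
    \<comment> \<open>A left ideal inside the ribbon module is a submodule of it, so minimality is
      simplicity read in the regular module.\<close>
    fix K assume K: "Module.submodule K ?A (left_regular ?A) \<and> K \<subseteq> carrier ?S"
    hence "Module.submodule K ?A ?S"
      using L.submodule_restrict[OF sub, of K] SL by simp
    thus "K = {\<zero>\<^bsub>?A\<^esub>} \<or> K = carrier ?S"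
      using aks_line.simple[OF line] ops(2) unfolding simple_left_module_def by simp
  qed (rule sub)
qed

lemma aks_line_of_simple:
  assumes n: "1 \<le> n" and u: "inj_on u {1..r}" "1 \<le> r" and M: "simple_left_module (aks n r u) M"
  obtains I c z where "is_cycloribbon n r (I, c)" "aks_line n r u M z (ribbon_char n u I c)"
proof -
  let ?A = "aks n r u"
  have lm: "left_module ?A M" and ne: "carrier M \<noteq> {\<zero>\<^bsub>M\<^esub>}"
    and simple: "\<And>N. Module.submodule N ?A M \<Longrightarrow> N = {\<zero>\<^bsub>M\<^esub>} \<or> N = carrier M"
    using M unfolding simple_left_module_def by blast+
  interpret left_module ?A M by (rule lm)
  obtain x where x: "x \<in> carrier M" "x \<noteq> \<zero>\<^bsub>M\<^esub>" using ne M.zero_closed by blast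
  \<comment> \<open>The annihilator of \<open>x\<close> pulled back to the free algebra; the
    eigenvector found modulo \<open>K\<close> becomes a vector of \<open>M\<close> when it is
    applied to \<open>x\<close>.\<close>
  define K where "K = {p \<in> aks_carrier n. aks_class n r u p \<odot>\<^bsub>M\<^esub> x = \<zero>\<^bsub>M\<^esub>}"
  have add: "aks_class n r u (p + q) \<odot>\<^bsub>M\<^esub> x = aks_class n r u p \<odot>\<^bsub>M\<^esub> x \<oplus>\<^bsub>M\<^esub> aks_class n r u q \<odot>\<^bsub>M\<^esub> x"
    if "p \<in> aks_carrier n" "q \<in> aks_carrier n" for p q
    using that x by (simp add: aks_class_add[symmetric] lsmult_l_distr)
  have mult: "aks_class n r u (p * q) \<odot>\<^bsub>M\<^esub> x = aks_class n r u p \<odot>\<^bsub>M\<^esub> (aks_class n r u q \<odot>\<^bsub>M\<^esub> x)"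
    if "p \<in> aks_carrier n" "q \<in> aks_carrier n" for p q
    using that x by (simp add: aks_class_mult[symmetric] lsmult_assoc)
  interpret K: aks_left_ideal n r u K
  proof
    show "inj_on u {1..r}" "1 \<le> r" by (rule u)+
    show "p + q \<in> K" if "p \<in> K" "q \<in> K" for p q
      using that by (simp add: K_def add mem_free_alg_on_add)
    show "p * q \<in> K" if "p \<in> aks_carrier n" "q \<in> K" for p q
      using that by (simp add: K_def mult mem_free_alg_on_mult lsmult_r_zero)
    show "aks_ideal n r u \<subseteq> K"
    proof
      fix p assume p: "p \<in> aks_ideal n r u"
      hence "aks_class n r u p = \<zero>\<^bsub>?A\<^esub>" by (simp add: aks_simps(3) aks_class_eq_iff)
      thus "p \<in> K" using p x by (simp add: K_def aks_ideal_carrier lsmult_l_zero)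
    qed
  qed
  have 1: "1 \<notin> K" using x by (simp add: K_def aks_simps(2)[symmetric] lsmult_one)
  obtain y d \<epsilon> where d: "d \<in> colorings n r" and y: "K.weight d y" "y \<notin> K"
    and \<epsilon>: "\<And>i. i \<in> {1..<n} \<Longrightarrow> \<epsilon> i \<in> {0, - 1} \<and> K.eqK (fT i * y) (fconst (\<epsilon> i) * y)"
    by (rule K.eigenvector[OF 1]) (rule that; assumption)
  have yc: "y \<in> aks_carrier n" using y(1) by (simp add: K.weight_def)
  have \<epsilon>_neq: "\<epsilon> i = - asc d i" if "i \<in> {1..<n}" "d i \<noteq> d (Suc i)" for i
    by (rule K.eigenvalue_at_unequal_colors[OF y(1) d y(2) that(1) _ that(2)]) (use \<epsilon>[OF that(1)] in simp)
  obtain I c where Q: "is_cycloribbon n r (I, c)" "\<And>j. j \<in> {1..n} \<Longrightarrow> color c j = d j"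
    "\<And>i. i \<in> {1..<n} \<Longrightarrow> descent_sign (phi_des n (Des I) c) i = \<epsilon> i"
    by (rule cycloribbon_of_eigenvalues[OF n d, of \<epsilon>], erule conjunct1[OF \<epsilon>], erule (1) \<epsilon>_neq)
      (rule that; assumption)
  define z where "z = aks_class n r u y \<odot>\<^bsub>M\<^esub> x"
  have z: "z \<in> carrier M" "z \<noteq> \<zero>\<^bsub>M\<^esub>"
    using x yc y(2) by (simp_all add: z_def lsmult_closed K_def)
  let ?N = "(\<lambda>a. a \<odot>\<^bsub>M\<^esub> z) ` carrier ?A"
  have "z \<in> ?N" using z by (intro image_eqI[of _ _ "\<one>\<^bsub>?A\<^esub>"]) (simp_all add: lsmult_one)
  hence N: "carrier M = ?N" using simple[OF submodule_cyclic[OF z(1)]] z(2) by blast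
  have "aks_class n r u (fgen g) \<odot>\<^bsub>M\<^esub> z = aks_const n r u (ribbon_char n u I c g) \<odot>\<^bsub>M\<^esub> z"
    if g: "g \<in> aks_gens n" for g
  proof -
    let ?p = "fgen g * y" and ?q = "fconst (ribbon_char n u I c g) * y"
    have pq: "?p \<in> aks_carrier n" "?q \<in> aks_carrier n"
      using g yc by (simp_all add: mem_free_alg_on_mult mem_free_alg_on_gen mem_free_alg_on_const)
    have "K.eqK ?p ?q"
    proof (cases g)
      case (GenT i)
      hence i: "i \<in> {1..<n}" using g by (auto simp: aks_gens_def)
      then show ?thesis using \<epsilon>[OF i] Q(3)[OF i] by (simp add: GenT ribbon_char_def)
    next
      case (GenXi j)
      hence j: "j \<in> {1..n}" using g by (auto simp: aks_gens_def)
      then show ?thesis using y(1) Q(2)[OF j] by (simp add: GenXi ribbon_char_def K.weight_def)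
    qed
    hence "?p - ?q \<in> K" by (simp only: K.eqK_def)
    hence "aks_class n r u (?p - ?q) \<odot>\<^bsub>M\<^esub> x = \<zero>\<^bsub>M\<^esub>" by (simp add: K_def)
    hence "aks_class n r u ?p \<odot>\<^bsub>M\<^esub> x = aks_class n r u ?q \<odot>\<^bsub>M\<^esub> x"
      using add[of "?p - ?q" ?q] pq x by (simp add: mem_free_alg_on_diff lsmult_closed)
    thus ?thesis
      using g yc by (simp add: mult mem_free_alg_on_gen mem_free_alg_on_const z_def aks_const_def)
  qed
  hence "aks_line n r u M z (ribbon_char n u I c)"
    using lm z N by (intro aks_line.intro aks_line_axioms.intro) simp_all
  thus ?thesis using that Q(1) by blast
qed

text \<open>The \<xi> give back the colors because \<open>u\<close> is injective, and for fixed
  colors \<phi> only keeps or reverses the status of each position, so the descents can be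
  recovered.\<close>

lemma ribbon_char_inject:
  assumes u: "inj_on u {1..r}" and Q: "is_cycloribbon n r (I, c)" "is_cycloribbon n r (I', c')"
    and eq: "\<And>g. g \<in> aks_gens n \<Longrightarrow> ribbon_char n u I c g = ribbon_char n u I' c' g"
  shows "(I, c) = (I', c')"
proof -
  have c: "length c = n" "set c \<subseteq> {1..r}" "length c' = n" "set c' \<subseteq> {1..r}"
    and I: "composition n I" "composition n I'" using Q by auto
  have "color c j = color c' j" if j: "j \<in> {1..n}" for j
  proof -
    have "u (color c j) = u (color c' j)"
      using eq[of "GenXi j"] j by (simp add: ribbon_char_def aks_gens_def)
    thus ?thesis using inj_onD[OF u] color_range[OF c(1,2) j] color_range[OF c(3,4) j] by blast
  qed
  hence "c ! i = c' ! i" if "i < n" for i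
    using that by (force simp: color_def dest: spec[of _ "Suc i"])
  hence cc: "c = c'" using c by (intro nth_equalityI) auto
  have "i \<in> Des I \<longleftrightarrow> i \<in> Des I'" if i: "i \<in> {1..<n}" for i
  proof -
    have "descent_sign (phi_des n (Des I) c) i = descent_sign (phi_des n (Des I') c) i"
      using eq[of "GenT i"] i by (simp add: ribbon_char_def aks_gens_def cc)
    hence "i \<in> phi_des n (Des I) c \<longleftrightarrow> i \<in> phi_des n (Des I') c"
      by (simp add: descent_sign_def split: if_splits)
    thus ?thesis using i by (cases "color c i = color c (i + 1)") (auto simp: phi_des_def)
  qed
  hence "Des I = Des I'"
    using composition_Des_subset[OF I(1)] composition_Des_subset[OF I(2)] by blast
  thus ?thesis using composition_unique[OF I] cc by simp
qed

theorem theorem3p2: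
  fixes n r :: nat and u :: "nat \<Rightarrow> complex"
  assumes "1 \<le> n" and "1 \<le> r" and "inj_on u {1..r}"
  shows
    "(\<forall>I c. is_cycloribbon n r (I, c) \<longrightarrow>
        simple_left_module (aks n r u) (aks_S n r u (I, c)) \<and>
        minimal_left_ideal (carrier (aks_S n r u (I, c))) (aks n r u) \<and>
        (\<forall>i\<in>{1..n}. \<forall>x\<in>carrier (aks_S n r u (I, c)).
           aks_Xi n r u i \<odot>\<^bsub>aks_S n r u (I, c)\<^esub> x =
           aks_const n r u (u (color c i)) \<odot>\<^bsub>aks_S n r u (I, c)\<^esub> x) \<and>
        is_anticycloribbon n r (ribbon_phi n (I, c)) \<and>
        (\<forall>i\<in>{1..<n}. \<forall>x\<in>carrier (aks_S n r u (I, c)).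
           aks_T n r u i \<odot>\<^bsub>aks_S n r u (I, c)\<^esub> x =
           aks_const n r u (if i \<in> Des (fst (ribbon_phi n (I, c))) then -1 else 0)
             \<odot>\<^bsub>aks_S n r u (I, c)\<^esub> x) \<and>
        aks_has_dim n r u (aks_S n r u (I, c)) 1) \<and>
     (\<forall>Q Q'. is_cycloribbon n r Q \<and> is_cycloribbon n r Q' \<and> Q \<noteq> Q' \<longrightarrow>
        \<not> left_module_iso (aks n r u) (aks_S n r u Q) (aks_S n r u Q')) \<and>
     (\<forall>M :: (aks_free set, 'm) module. simple_left_module (aks n r u) M \<longrightarrow>
        aks_has_dim n r u M 1 \<and>
        (\<exists>Q. is_cycloribbon n r Q \<and> left_module_iso (aks n r u) M (aks_S n r u Q)))"
proof (intro conjI allI impI ballI)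
  fix I c assume Q: "is_cycloribbon n r (I, c)"
  interpret S: aks_line n r u "aks_S n r u (I, c)" "aks_class n r u (ribbon_elem n r u I c)" "ribbon_char n u I c"
    by (rule aks_line_aks_S[OF assms(3,2) Q])
  show "simple_left_module (aks n r u) (aks_S n r u (I, c))" by (rule S.simple)
  show "minimal_left_ideal (carrier (aks_S n r u (I, c))) (aks n r u)"
    by (rule minimal_left_ideal_aks_S[OF assms(3,2) Q])
  show "is_anticycloribbon n r (ribbon_phi n (I, c))"
    by (rule anticycloribbon_ribbon_phi[OF assms(1) Q])
  show "aks_has_dim n r u (aks_S n r u (I, c)) 1" by (rule S.has_dim_1)
  fix i x assume x: "x \<in> carrier (aks_S n r u (I, c))"
  show "aks_Xi n r u i \<odot>\<^bsub>aks_S n r u (I, c)\<^esub> x = aks_const n r u (u (color c i)) \<odot>\<^bsub>aks_S n r u (I, c)\<^esub> x"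
    if "i \<in> {1..n}"
    using S.generator_action[of "GenXi i" x] x that by (simp add: aks_Xi_def aks_gens_def ribbon_char_def)
  have "composition n I" using Q by simp
  from Des_ribbon_phi[OF assms(1) this]
  show "aks_T n r u i \<odot>\<^bsub>aks_S n r u (I, c)\<^esub> x =
      aks_const n r u (if i \<in> Des (fst (ribbon_phi n (I, c))) then -1 else 0) \<odot>\<^bsub>aks_S n r u (I, c)\<^esub> x"
    if "i \<in> {1..<n}"
    using S.generator_action[of "GenT i" x] x that
    by (simp add: aks_T_def aks_gens_def ribbon_char_def descent_sign_def del: ribbon_phi.simps)
next
  fix Q Q' assume H: "is_cycloribbon n r Q \<and> is_cycloribbon n r Q' \<and> Q \<noteq> Q'"
  obtain I c I' c' where Q: "Q = (I, c)" "Q' = (I', c')" by (cases Q; cases Q')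
  have cyc: "is_cycloribbon n r (I, c)" "is_cycloribbon n r (I', c')" using H unfolding Q by blast+
  show "\<not> left_module_iso (aks n r u) (aks_S n r u Q) (aks_S n r u Q')"
  proof
    assume "left_module_iso (aks n r u) (aks_S n r u Q) (aks_S n r u Q')"
    hence "ribbon_char n u I c g = ribbon_char n u I' c' g" if "g \<in> aks_gens n" for g
      using aks_line_iso_eigenvalues[OF aks_line_aks_S[OF assms(3,2) cyc(1)] aks_line_aks_S[OF assms(3,2) cyc(2)] _ that]
      unfolding Q by blast
    from ribbon_char_inject[OF assms(3) cyc this] show False using H unfolding Q by blast
  qed
next
  fix M :: "(aks_free set, 'm) module" assume M: "simple_left_module (aks n r u) M"
  obtain I c z where Q: "is_cycloribbon n r (I, c)" and line: "aks_line n r u M z (ribbon_char n u I c)"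
    by (rule aks_line_of_simple[OF assms(1,3,2) M])
  show "aks_has_dim n r u M 1" by (rule aks_line.has_dim_1[OF line])
  show "\<exists>Q. is_cycloribbon n r Q \<and> left_module_iso (aks n r u) M (aks_S n r u Q)"
    using Q aks_line_iso[OF line aks_line_aks_S[OF assms(3,2) Q]] by blast
qed

end
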